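(* Let $\overline M=M\cup\partial M$ be a smooth manifold with boundary and let $\nabla$ be a projectively pre-compact (special, torsion-free) linear connection on $TM$. Then for $\xi\in\mathfrak X(\overline M)$ and $\eta\in\Gamma(T^b\overline M(-1))\subset\Gamma(T\overline M(-1))$, the weighted vector field $\nabla_\xi\eta$ defined on $M$ admits a smooth extension to the boundary. If the boundary is strongly totally geodesic, then this extension is tangent to $\partial M$ along $\partial M$, i.e. it is a section of $T^b\overline M(-1)$. Hence, under this assumption, $\nabla$ extends smoothly to a linear connection on the vector bundle $T^b\overline M(-1)\to\overline M$.
   Context: Setting. $\overline M$ is a smooth manifold with boundary $\partial M$ and interior $M$, $\dim\overline M=n+1$. An object on $U\cap M$ ($U\subset\overline M$ open) "admits a smooth extension to the boundary" (is "smooth up to the boundary") if it is the restriction of a smooth object on $U$. A local defining function for $\partial M$ is a smooth $\rho:U\to\mathbb R$, $U\subset\overline M$ open, with $\rho^{-1}(0)=U\cap\partial M$ and $d\rho$ nowhere zero on $U\cap\partial M$. $\mathfrak X_\partial(U)\subset\mathfrak X(U)$ is the space of vector fields tangent to $\partial M$ along $U\cap\partial M$. Connections. A torsion-free linear connection on $TM$ is special if it preserves a (nowhere vanishing) volume density. For a one-form $\Upsilon$, $\nabla+\Upsilon$ denotes the connection $\nabla_\xi\eta+\Upsilon(\xi)\eta+\Upsilon(\eta)\xi$. Put $\nabla^\rho:=\nabla+\frac{d\rho}{\rho}$ on $U\cap M$. A special $\nabla$ is projectively pre-compact (of order $1$) if for each $U$ and each local defining function $\rho:U\to\mathbb R$: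 (i) $d\rho(\nabla^\rho_\xi\eta)$ is smooth up to the boundary for all $\xi,\eta\in\mathfrak X(U)$; (ii) $\rho\nabla^\rho_\xi\eta$ is smooth up to the boundary for all $\xi,\eta\in\mathfrak X(U)$; (iii) $\nabla^\rho_\xi\eta$ is smooth up to the boundary if at least one of $\xi,\eta\in\mathfrak X(U)$ lies in $\mathfrak X_\partial(U)$. Densities and b-tangent bundle. $\mathcal E(w)$ is the oriented line bundle of projective densities of weight $w$, normalized so that $\mathcal E(-n-2)$ is the bundle of volume densities; $B(w):=B\otimes\mathcal E(w)$. $T^b\overline M\to\overline M$ is Melrose's b-tangent bundle, the rank $n+1$ vector bundle whose sheaf of smooth sections is $\mathfrak X_\partial$; it coincides with $TM$ over $M$. So sections of $T^b\overline M(-1)$ are the sections of $T\overline M(-1)$ that are tangent to $\partial M$ along $\partial M$. Over $M$, $\nabla$ induces a linear connection on $TM(-1)$, also denoted $\nabla$. Strongly totally geodesic. Fix a nowhere vanishing $\nabla$-parallel $\sigma\in\Gamma(\mathcal E(1)|_M)$. For any $\rho$, $\nabla^\rho\nabla^\rho\sigma$ is smooth up to the boundary; its boundary value on pairs in $T\overline M|_{\partial M}\times T\partial M$ is independent of $\rho$ and denoted $\Phi$. The boundary is strongly totally geodesic if $\Phi$ vanishes on $T\overline M|_{\partial M}\times T\partial M$. Equivalently, for all $\xi\in\mathfrak X(\overline M)$, $\eta\in\mathfrak X_\partial(\overline M)$, the functions $d\rho(\nabla^\rho_\xi\eta)$ and $\frac{d\rho(\xi)d\rho(\eta)}{\rho}$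 have the same boundary value. *)

theory Defs
  imports "HOL-Analysis.Analysis"
begin

section \<open>Smoothness in the model half space\<close>

primrec ck_on :: "nat \<Rightarrow> 'e::real_normed_vector set \<Rightarrow> ('e \<Rightarrow> 'f::real_normed_vector) \<Rightarrow> bool" where
  "ck_on 0 W f \<longleftrightarrow> continuous_on W f"
| "ck_on (Suc k) W f \<longleftrightarrow>
     (\<forall>x\<in>W. f differentiable (at x)) \<and> (\<forall>v. ck_on k W (\<lambda>x. frechet_derivative f (at x) v))"

text \<open>The set \<open>S\<close> below need not be open (it will be relatively open in the half space):
  smoothness means local extendability to a smooth map on an open set.\<close>

definition smooth_on :: "'e::real_normed_vector set \<Rightarrow> ('e \<Rightarrow> 'f::real_normed_vector) \<Rightarrow> bool" where
  "smooth_on S f \<longleftrightarrow>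
     (\<forall>x\<in>S. \<exists>W h. open W \<and> x \<in> W \<and> (\<forall>k. ck_on k W h) \<and> (\<forall>y\<in>W \<inter> S. h y = f y))"

text \<open>The half space is cut out by one coordinate; which one is immaterial.\<close>

definition bdry_index :: "'n::finite" where
  "bdry_index = (SOME i. True)"

definition half_space :: "(real ^ 'n::finite) set" where
  "half_space = {x. 0 \<le> x $ bdry_index}"


section \<open>Manifolds with boundary\<close>

text \<open>The manifold is the whole type \<open>'a\<close>, of dimension \<open>n + 1 = CARD('n)\<close>. A chart is a pair of
  its domain and its coordinate map (total, but irrelevant off the domain).\<close>

type_synonym ('a, 'n) chart = "'a set \<times> ('a \<Rightarrow> real ^ 'n)"

definition chart_inv :: "('a, 'n::finite) chart \<Rightarrow> real ^ 'n \<Rightarrow> 'a" where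
  "chart_inv c = inv_into (fst c) (snd c)"

definition smooth_manifold_with_boundary ::
  "('a::{t2_space,second_countable_topology}, 'n::finite) chart set \<Rightarrow> bool" where
  "smooth_manifold_with_boundary A \<longleftrightarrow>
     (\<Union>c\<in>A. fst c) = UNIV \<and>
     (\<forall>c\<in>A. open (fst c) \<and> openin (top_of_set half_space) (snd c ` fst c) \<and>
        homeomorphism (fst c) (snd c ` fst c) (snd c) (chart_inv c)) \<and>
     (\<forall>c\<in>A. \<forall>d\<in>A. smooth_on (snd c ` (fst c \<inter> fst d)) (snd d \<circ> chart_inv c))"

definition mfd_bdry :: "('a, 'n::finite) chart set \<Rightarrow> 'a set" where
  "mfd_bdry A = {p. \<exists>c\<in>A. p \<in> fst c \<and> snd c p $ bdry_index = 0}"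

definition mfd_int :: "('a, 'n::finite) chart set \<Rightarrow> 'a set" where
  "mfd_int A = - mfd_bdry A"

definition smooth_in_chart ::
  "('a, 'n::finite) chart \<Rightarrow> 'a set \<Rightarrow> ('a \<Rightarrow> 'b::real_normed_vector) \<Rightarrow> bool" where
  "smooth_in_chart c V F \<longleftrightarrow> smooth_on (snd c ` (V \<inter> fst c)) (F \<circ> chart_inv c)"

definition smooth_fun :: "('a, 'n::finite) chart set \<Rightarrow> 'a set \<Rightarrow> ('a \<Rightarrow> real) \<Rightarrow> bool" where
  "smooth_fun A V f \<longleftrightarrow> (\<forall>c\<in>A. smooth_in_chart c V f)"

text \<open>Derivative of \<open>F\<close> at \<open>p\<close> in the coordinates \<open>c\<close>. The derivative within the chart image is
  uniquely determined also at boundary points, since the image is relatively open in the half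
  space.\<close>

definition chart_deriv ::
  "('a, 'n::finite) chart \<Rightarrow> ('a \<Rightarrow> 'b::real_normed_vector) \<Rightarrow> 'a \<Rightarrow> real ^ 'n \<Rightarrow> 'b" where
  "chart_deriv c F p = frechet_derivative (F \<circ> chart_inv c) (at (snd c p) within snd c ` fst c)"

definition jac ::
  "('a, 'n::finite) chart \<Rightarrow> ('a, 'n) chart \<Rightarrow> 'a \<Rightarrow> real ^ 'n \<Rightarrow> real ^ 'n" where
  "jac c d p = chart_deriv c (snd d) p"


section \<open>Sections of tensor and density bundles\<close>

text \<open>A section of a bundle is given by its local representatives in all charts, subject to the
  transformation law of the bundle. Representatives only matter on the domain of the chart, and
  sections over \<open>V\<close> only on \<open>V\<close>; \<open>sec_eq\<close> is equality of sections over \<open>V\<close>.\<close>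

type_synonym ('a, 'n, 'b) sec = "('a, 'n) chart \<Rightarrow> 'a \<Rightarrow> 'b"
type_synonym ('a, 'n) vfield = "('a, 'n, real ^ 'n) sec"
type_synonym ('a, 'n) density = "('a, 'n, real) sec"

definition sec_eq ::
  "('a, 'n::finite) chart set \<Rightarrow> 'a set \<Rightarrow> ('a, 'n, 'b) sec \<Rightarrow> ('a, 'n, 'b) sec \<Rightarrow> bool" where
  "sec_eq A V s t \<longleftrightarrow> (\<forall>c\<in>A. \<forall>p\<in>V \<inter> fst c. s c p = t c p)"

text \<open>The transition function of \<open>\<E>(w)\<close>. Volume densities transform by \<open>1 / \<bar>det J\<bar>\<close>, and the
  normalization is that they have weight \<open>-n-2 = -(CARD('n) + 1)\<close>.\<close>

definition dens_factor ::
  "real \<Rightarrow> ('a, 'n::finite) chart \<Rightarrow> ('a, 'n) chart \<Rightarrow> 'a \<Rightarrow> real" where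
  "dens_factor w c d p = \<bar>det (matrix (jac c d p))\<bar> powr (w / (real CARD('n) + 1))"

text \<open>Smooth sections over \<open>V\<close> of \<open>\<E>(w)\<close> and of \<open>TM(w)\<close>.\<close>

definition densities ::
  "('a, 'n::finite) chart set \<Rightarrow> real \<Rightarrow> 'a set \<Rightarrow> ('a, 'n) density set" where
  "densities A w V = {s.
     (\<forall>c\<in>A. smooth_in_chart c V (s c)) \<and>
     (\<forall>c\<in>A. \<forall>d\<in>A. \<forall>p\<in>V \<inter> fst c \<inter> fst d. s d p = dens_factor w c d p * s c p)}"

definition wvfields ::
  "('a, 'n::finite) chart set \<Rightarrow> real \<Rightarrow> 'a set \<Rightarrow> ('a, 'n) vfield set" where
  "wvfields A w V = {X.
     (\<forall>c\<in>A. smooth_in_chart c V (X c)) \<and>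
     (\<forall>c\<in>A. \<forall>d\<in>A. \<forall>p\<in>V \<inter> fst c \<inter> fst d.
        X d p = dens_factor w c d p *\<^sub>R jac c d p (X c p))}"

abbreviation vfields :: "('a, 'n::finite) chart set \<Rightarrow> 'a set \<Rightarrow> ('a, 'n) vfield set" where
  "vfields A V \<equiv> wvfields A 0 V"

text \<open>Smooth sections over \<open>V\<close> of \<open>T\<^sup>bM(w)\<close>: those of \<open>TM(w)\<close> tangent to the boundary
  along the boundary. For \<open>w = 0\<close> this is \<open>\<XX>\<^sub>\<partial>(V)\<close>.\<close>

definition b_wvfields ::
  "('a, 'n::finite) chart set \<Rightarrow> real \<Rightarrow> 'a set \<Rightarrow> ('a, 'n) vfield set" where
  "b_wvfields A w V =
     {X \<in> wvfields A w V. \<forall>c\<in>A. \<forall>p\<in>V \<inter> mfd_bdry A \<inter> fst c. X c p $ bdry_index = 0}"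

text \<open>The derivative \<open>\<xi> \<cdot> f = df(\<xi>)\<close> does not depend on the chart used to compute it.\<close>

definition deriv_along ::
  "('a, 'n::finite) chart set \<Rightarrow> ('a, 'n) vfield \<Rightarrow> ('a \<Rightarrow> real) \<Rightarrow> 'a \<Rightarrow> real" where
  "deriv_along A \<xi> f p =
     (let c = (SOME c. c \<in> A \<and> p \<in> fst c) in chart_deriv c f p (\<xi> c p))"

definition lie_bracket :: "('a, 'n::finite) vfield \<Rightarrow> ('a, 'n) vfield \<Rightarrow> ('a, 'n) vfield" where
  "lie_bracket \<xi> \<eta> = (\<lambda>c p. chart_deriv c (\<eta> c) p (\<xi> c p) - chart_deriv c (\<xi> c) p (\<eta> c p))"

text \<open>The vector field on the domain of \<open>c\<close> whose representative in \<open>c\<close> is \<open>F\<close>.\<close>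

definition vf_in :: "('a, 'n::finite) chart \<Rightarrow> ('a \<Rightarrow> real ^ 'n) \<Rightarrow> ('a, 'n) vfield" where
  "vf_in c F = (\<lambda>d p. jac c d p (F p))"


section \<open>Linear connections\<close>

text \<open>A linear connection over the open set \<open>W\<close> on the vector bundle whose sheaf of smooth sections
  is \<open>S\<close>. Since all sections are total functions, a single operator encodes the compatible family
  of operators over the open subsets of \<open>W\<close>.\<close>

definition linear_connection ::
  "('a::topological_space, 'n::finite) chart set \<Rightarrow> 'a set \<Rightarrow>
   ('a set \<Rightarrow> ('a, 'n, 'b::real_vector) sec set) \<Rightarrow>
   (('a, 'n) vfield \<Rightarrow> ('a, 'n, 'b) sec \<Rightarrow> ('a, 'n, 'b) sec) \<Rightarrow> bool" where
  "linear_connection A W S D \<longleftrightarrow> (\<forall>V. open V \<and> V \<subseteq> W \<longrightarrow>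
     (\<forall>\<xi>\<in>vfields A V. \<forall>s\<in>S V. D \<xi> s \<in> S V) \<and>
     (\<forall>\<xi>\<in>vfields A V. \<forall>\<xi>'\<in>vfields A V. \<forall>s\<in>S V. \<forall>s'\<in>S V.
        sec_eq A V \<xi> \<xi>' \<and> sec_eq A V s s' \<longrightarrow> sec_eq A V (D \<xi> s) (D \<xi>' s')) \<and>
     (\<forall>\<xi>\<in>vfields A V. \<forall>\<xi>'\<in>vfields A V. \<forall>s\<in>S V.
        sec_eq A V (D (\<lambda>c p. \<xi> c p + \<xi>' c p) s) (\<lambda>c p. D \<xi> s c p + D \<xi>' s c p)) \<and>
     (\<forall>f. smooth_fun A V f \<longrightarrow> (\<forall>\<xi>\<in>vfields A V. \<forall>s\<in>S V.
        sec_eq A V (D (\<lambda>c p. f p *\<^sub>R \<xi> c p) s) (\<lambda>c p. f p *\<^sub>R D \<xi> s c p))) \<and>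
     (\<forall>\<xi>\<in>vfields A V. \<forall>s\<in>S V. \<forall>s'\<in>S V.
        sec_eq A V (D \<xi> (\<lambda>c p. s c p + s' c p)) (\<lambda>c p. D \<xi> s c p + D \<xi> s' c p)) \<and>
     (\<forall>f. smooth_fun A V f \<longrightarrow> (\<forall>\<xi>\<in>vfields A V. \<forall>s\<in>S V.
        sec_eq A V (D \<xi> (\<lambda>c p. f p *\<^sub>R s c p))
          (\<lambda>c p. deriv_along A \<xi> f p *\<^sub>R s c p + f p *\<^sub>R D \<xi> s c p))))"

type_synonym ('a, 'n) conn = "('a, 'n) vfield \<Rightarrow> ('a, 'n) vfield \<Rightarrow> ('a, 'n) vfield"

definition torsion_free ::
  "('a::topological_space, 'n::finite) chart set \<Rightarrow> 'a set \<Rightarrow> ('a, 'n) conn \<Rightarrow> bool" where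
  "torsion_free A W D \<longleftrightarrow> (\<forall>V. open V \<and> V \<subseteq> W \<longrightarrow>
     (\<forall>\<xi>\<in>vfields A V. \<forall>\<eta>\<in>vfields A V.
        sec_eq A V (\<lambda>c p. D \<xi> \<eta> c p - D \<eta> \<xi> c p) (lie_bracket \<xi> \<eta>)))"

text \<open>Trace of \<open>\<partial>\<^sub>k \<mapsto> \<nabla>\<^sub>\<xi> \<partial>\<^sub>k\<close> for the coordinate vector fields of \<open>c\<close>, i.e. \<open>\<xi>\<^sup>i \<Gamma>\<^sub>i\<^sub>k\<^sup>k\<close>.\<close>

definition conn_trace ::
  "('a, 'n::finite) conn \<Rightarrow> ('a, 'n) vfield \<Rightarrow> ('a, 'n) chart \<Rightarrow> 'a \<Rightarrow> real" where
  "conn_trace D \<xi> c p = (\<Sum>k\<in>UNIV. D \<xi> (vf_in c (\<lambda>_. axis k 1)) c p $ k)"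

text \<open>The connections induced by \<open>D\<close> on \<open>\<E>(w)\<close> and \<open>TM(w)\<close>. On the coordinate volume density,
  of weight \<open>-n-2\<close>, the induced connection is minus the trace above; so on the density of weight
  \<open>w\<close> represented by \<open>1\<close> in the chart it is \<open>w / (n + 2)\<close> times the trace.\<close>

definition dens_conn ::
  "real \<Rightarrow> ('a, 'n::finite) conn \<Rightarrow> ('a, 'n) vfield \<Rightarrow> ('a, 'n) density \<Rightarrow> ('a, 'n) density" where
  "dens_conn w D \<xi> s = (\<lambda>c p.
     chart_deriv c (s c) p (\<xi> c p) + w / (real CARD('n) + 1) * conn_trace D \<xi> c p * s c p)"

definition wvf_conn :: "real \<Rightarrow> ('a, 'n::finite) conn \<Rightarrow> ('a, 'n) conn" where
  "wvf_conn w D \<xi> \<eta> = (\<lambda>c p.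
     D \<xi> (vf_in c (\<eta> c)) c p + (w / (real CARD('n) + 1) * conn_trace D \<xi> c p) *\<^sub>R \<eta> c p)"

definition nowhere_vanishing ::
  "('a, 'n::finite) chart set \<Rightarrow> 'a set \<Rightarrow> ('a, 'n) density \<Rightarrow> bool" where
  "nowhere_vanishing A V s \<longleftrightarrow> (\<forall>c\<in>A. \<forall>p\<in>V \<inter> fst c. s c p \<noteq> 0)"

definition parallel ::
  "('a::topological_space, 'n::finite) chart set \<Rightarrow> 'a set \<Rightarrow> real \<Rightarrow> ('a, 'n) conn \<Rightarrow>
   ('a, 'n) density \<Rightarrow> bool" where
  "parallel A W w D s \<longleftrightarrow> (\<forall>V. open V \<and> V \<subseteq> W \<longrightarrow>
     (\<forall>\<xi>\<in>vfields A V. sec_eq A V (dens_conn w D \<xi> s) (\<lambda>c p. 0)))"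

definition special ::
  "('a::topological_space, 'n::finite) chart set \<Rightarrow> 'a set \<Rightarrow> ('a, 'n) conn \<Rightarrow> bool" where
  "special A W D \<longleftrightarrow>
     (\<exists>\<nu>\<in>densities A (- (real CARD('n) + 1)) W.
        nowhere_vanishing A W \<nu> \<and> parallel A W (- (real CARD('n) + 1)) D \<nu>)"


section \<open>Projective pre-compactness\<close>

definition local_defining_function ::
  "('a::topological_space, 'n::finite) chart set \<Rightarrow> 'a set \<Rightarrow> ('a \<Rightarrow> real) \<Rightarrow> bool" where
  "local_defining_function A U \<rho> \<longleftrightarrow>
     open U \<and> smooth_fun A U \<rho> \<and> {p \<in> U. \<rho> p = 0} = U \<inter> mfd_bdry A \<and>
     (\<forall>c\<in>A. \<forall>p\<in>U \<inter> mfd_bdry A \<inter> fst c. chart_deriv c \<rho> p \<noteq> (\<lambda>v. 0))"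

text \<open>\<open>\<nabla> + \<Upsilon>\<close>, where the one-form \<open>\<Upsilon>\<close> is given by its action on vector fields.\<close>

definition proj_change ::
  "('a, 'n::finite) conn \<Rightarrow> (('a, 'n) vfield \<Rightarrow> 'a \<Rightarrow> real) \<Rightarrow> ('a, 'n) conn" where
  "proj_change D \<Upsilon> \<xi> \<eta> = (\<lambda>c p. D \<xi> \<eta> c p + \<Upsilon> \<xi> p *\<^sub>R \<eta> c p + \<Upsilon> \<eta> p *\<^sub>R \<xi> c p)"

definition conn_rho ::
  "('a, 'n::finite) chart set \<Rightarrow> ('a, 'n) conn \<Rightarrow> ('a \<Rightarrow> real) \<Rightarrow> ('a, 'n) conn" where
  "conn_rho A D \<rho> = proj_change D (\<lambda>\<xi> p. deriv_along A \<xi> \<rho> p / \<rho> p)"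

text \<open>A section over \<open>U \<inter> M\<close> (resp. a function on \<open>U \<inter> M\<close>) is smooth up to the boundary if it is
  the restriction of a smooth one on \<open>U\<close>.\<close>

definition is_extension ::
  "('a, 'n::finite) chart set \<Rightarrow> 'a set \<Rightarrow> ('a set \<Rightarrow> ('a, 'n, 'b) sec set) \<Rightarrow>
   ('a, 'n, 'b) sec \<Rightarrow> ('a, 'n, 'b) sec \<Rightarrow> bool" where
  "is_extension A U S s t \<longleftrightarrow> t \<in> S U \<and> sec_eq A (U \<inter> mfd_int A) t s"

definition fun_smooth_to_bdry ::
  "('a, 'n::finite) chart set \<Rightarrow> 'a set \<Rightarrow> ('a \<Rightarrow> real) \<Rightarrow> bool" where
  "fun_smooth_to_bdry A U f \<longleftrightarrow> (\<exists>g. smooth_fun A U g \<and> (\<forall>p\<in>U \<inter> mfd_int A. g p = f p))"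

definition vf_smooth_to_bdry ::
  "('a, 'n::finite) chart set \<Rightarrow> 'a set \<Rightarrow> ('a, 'n) vfield \<Rightarrow> bool" where
  "vf_smooth_to_bdry A U X \<longleftrightarrow> (\<exists>Y. is_extension A U (vfields A) X Y)"

definition proj_precompact ::
  "('a::topological_space, 'n::finite) chart set \<Rightarrow> ('a, 'n) conn \<Rightarrow> bool" where
  "proj_precompact A D \<longleftrightarrow> (\<forall>U \<rho>. local_defining_function A U \<rho> \<longrightarrow>
     (\<forall>\<xi>\<in>vfields A U. \<forall>\<eta>\<in>vfields A U.
        fun_smooth_to_bdry A U (deriv_along A (conn_rho A D \<rho> \<xi> \<eta>) \<rho>) \<and>
        vf_smooth_to_bdry A U (\<lambda>c p. \<rho> p *\<^sub>R conn_rho A D \<rho> \<xi> \<eta> c p) \<and>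
        (\<xi> \<in> b_wvfields A 0 U \<or> \<eta> \<in> b_wvfields A 0 U \<longrightarrow>
           vf_smooth_to_bdry A U (conn_rho A D \<rho> \<xi> \<eta>))))"


section \<open>Strongly totally geodesic boundary\<close>

text \<open>The second covariant derivative \<open>(\<nabla>\<nabla>s)(\<xi>, \<eta>)\<close> of a density \<open>s\<close> of weight \<open>w\<close>.\<close>

definition second_deriv ::
  "real \<Rightarrow> ('a, 'n::finite) conn \<Rightarrow> ('a, 'n) density \<Rightarrow> ('a, 'n) vfield \<Rightarrow> ('a, 'n) vfield \<Rightarrow>
   ('a, 'n) density" where
  "second_deriv w D s \<xi> \<eta> =
     (\<lambda>c p. dens_conn w D \<xi> (dens_conn w D \<eta> s) c p - dens_conn w D (D \<xi> \<eta>) s c p)"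

text \<open>The boundary value at \<open>p\<close> of \<open>\<nabla>\<^sup>\<rho>\<nabla>\<^sup>\<rho>\<sigma>\<close>, expressed in the chart \<open>c\<close> and evaluated on the
  tangent vectors at \<open>p\<close> with components \<open>v\<close> and \<open>v'\<close>. The boundary value is the limit from the
  interior, which is the value at \<open>p\<close> of the smooth extension.\<close>

definition Phi ::
  "('a::topological_space, 'n::finite) chart set \<Rightarrow> ('a, 'n) conn \<Rightarrow> ('a, 'n) density \<Rightarrow>
   ('a \<Rightarrow> real) \<Rightarrow> ('a, 'n) chart \<Rightarrow> 'a \<Rightarrow> real ^ 'n \<Rightarrow> real ^ 'n \<Rightarrow> real" where
  "Phi A D \<sigma> \<rho> c p v v' = Lim (at p within mfd_int A)
     (second_deriv 1 (conn_rho A D \<rho>) \<sigma> (vf_in c (\<lambda>_. v)) (vf_in c (\<lambda>_. v')) c)"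

definition strongly_totally_geodesic ::
  "('a::topological_space, 'n::finite) chart set \<Rightarrow> ('a, 'n) conn \<Rightarrow> ('a, 'n) density \<Rightarrow> bool" where
  "strongly_totally_geodesic A D \<sigma> \<longleftrightarrow>
     (\<forall>U \<rho>. local_defining_function A U \<rho> \<longrightarrow>
        (\<forall>c\<in>A. \<forall>p\<in>U \<inter> mfd_bdry A \<inter> fst c. \<forall>v v'.
           v' $ bdry_index = 0 \<longrightarrow> Phi A D \<sigma> \<rho> c p v v' = 0))"

end

theory Submission
  imports Defs
begin

text \<open>
  Everything happens in one chart \<open>c\<close>. Let \<open>x\<^sub>0\<close> be the coordinate that cuts out the half space and
  take \<open>\<rho> = x\<^sub>0\<close>, which is a defining function on the domain of \<open>c\<close>. Let \<open>\<nabla>\<^sup>\<rho> = \<nabla> + d\<rho>/\<rho>\<close> and let \<open>N\<close> be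
  the dimension. The trace of \<open>\<nabla>\<^sup>\<rho>\<^sub>\<xi>\<close> differs from that of \<open>\<nabla>\<^sub>\<xi>\<close> by \<open>(N + 1) d\<rho>(\<xi>)/\<rho>\<close>, and the weight \<open>-1\<close> is
  chosen exactly so that this correction cancels the term \<open>(d\<rho>(\<xi>)/\<rho>) \<eta>\<close>. Over the interior,
  with \<open>\<eta>\<close> identified with its representative in \<open>c\<close>,
  \<open>\<nabla>\<^sub>\<xi>\<eta> = \<nabla>\<^sup>\<rho>\<^sub>\<xi>\<eta> - (d\<rho>(\<eta>)/\<rho>) \<xi> - tr(\<nabla>\<^sup>\<rho>\<^sub>\<xi>)/(N + 1) \<eta>\<close>.
  If \<open>\<eta>\<close> is tangent to the boundary, then each term is smooth up to the boundary: the first by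
  pre-compactness, the second because \<open>d\<rho>(\<eta>)\<close> vanishes on the boundary and so is smoothly divisible by
  \<open>\<rho>\<close> (Hadamard's lemma, \<open>smooth_on_bdry_quotient\<close>), the third because the trace only involves the
  coefficients \<open>(\<nabla>\<^sup>\<rho>\<^sub>\<xi> \<partial>\<^sub>k)\<^sup>k\<close>: for \<open>k \<noteq> 0\<close> the field \<open>\<partial>\<^sub>k\<close> is tangent to the boundary, and for \<open>k = 0\<close> the
  coefficient is \<open>d\<rho>(\<nabla>\<^sup>\<rho>\<^sub>\<xi> \<partial>\<^sub>0)\<close>.

  In terms of the frame \<open>\<partial>\<^sub>k\<close> (\<open>k \<noteq> 0\<close>), \<open>x\<^sub>0 \<partial>\<^sub>0\<close> of the b-tangent bundle this says that finitely many
  connection coefficients extend smoothly (\<open>weighted_christoffel_extends\<close>). With the extended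
  coefficients an explicit formula, \<open>b_connection\<close>, gives the extension of \<open>\<nabla>\<^sub>\<xi>\<eta>\<close> for all \<open>\<xi>\<close> and
  \<open>\<eta>\<close> over all open sets at once, and the axioms of a linear connection can be read off from it. Only its
  transformation law is not visible in the formula. Over the interior a parallel volume
  density \<open>\<nu>\<close> provides the parallel trivialization \<open>u = \<bar>\<nu>\<bar> powr (- 1 / (N + 1))\<close> of \<open>\<E>(1)\<close>, so that
  \<open>u \<nabla>\<^sub>\<xi>\<eta> = \<nabla>\<^sub>\<xi>(u\<eta>)\<close> is an ordinary vector field (\<open>wvf_conn_change\<close>); the boundary is reached by
  continuity and density of the interior.

  For tangency, let \<open>\<sigma>\<close> be parallel of weight \<open>1\<close>. Then \<open>\<nabla>\<^sup>\<rho>\<sigma> = (d\<rho>/\<rho>) \<sigma>\<close>, and for coordinate fields with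
  \<open>k \<noteq> 0\<close> this gives \<open>(\<nabla>\<^sup>\<rho>\<nabla>\<^sup>\<rho>\<sigma>)(\<partial>\<^sub>i, \<partial>\<^sub>k) = - d\<rho>(\<nabla>\<^sup>\<rho>\<^sub>i \<partial>\<^sub>k) \<sigma>/\<rho>\<close>. The logarithmic derivative of \<open>\<sigma>/\<rho>\<close> is a
  one-form that is continuous up to the boundary, hence \<open>\<sigma>/\<rho>\<close> has a nonzero boundary limit
  (\<open>parallel_density_bdry_limit\<close>), and vanishing of \<open>\<Phi>\<close> means that \<open>d\<rho>(\<nabla>\<^sup>\<rho>\<^sub>i \<partial>\<^sub>k) = 0\<close> on the boundary.
  What remains of the normal component of the extension at a boundary point is
  \<open>\<xi>\<^sup>0 \<partial>\<^sub>0\<eta>\<^sup>0 - (\<eta>\<^sup>0/x\<^sub>0) \<xi>\<^sup>0\<close>, which is zero because \<open>\<eta>\<^sup>0/x\<^sub>0\<close> has the boundary value \<open>\<partial>\<^sub>0\<eta>\<^sup>0\<close>.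
\<close>


section \<open>Calculus of smooth maps on open sets\<close>

lemma ck_on_cong:
  assumes "open W" "\<And>x. x \<in> W \<Longrightarrow> f x = g x" "ck_on k W f"
  shows "ck_on k W g"
  using assms(2,3)
proof (induction k arbitrary: f g)
  case 0
  then show ?case using continuous_on_cong[of W W f g] by simp
next
  case (Suc k)
  have diff: "f differentiable (at x)" if "x \<in> W" for x using Suc.prems that by simp
  have eq: "frechet_derivative f (at x) = frechet_derivative g (at x)" if "x \<in> W" for x
    using frechet_derivative_transform_within_open[OF diff[OF that] assms(1) that] Suc.prems(1) by blast
  have "g differentiable (at x)" if "x \<in> W" for x
    using diff[OF that] has_derivative_transform_within_open[OF _ assms(1) that] Suc.prems(1)
    unfolding differentiable_def by blast
  moreover have "ck_on k W (\<lambda>x. frechet_derivative g (at x) v)" for v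
    by (rule Suc.IH[of "\<lambda>x. frechet_derivative f (at x) v"]) (use eq Suc.prems in auto)
  ultimately show ?case by simp
qed

text \<open>Any family of derivatives may be used to check differentiability classes; this is how all closure
  properties below are reduced to lower order.\<close>

lemma ck_on_SucI:
  assumes "open W" "\<And>x. x \<in> W \<Longrightarrow> (f has_derivative f' x) (at x)" "\<And>v. ck_on k W (\<lambda>x. f' x v)"
  shows "ck_on (Suc k) W f"
proof -
  have "f' x = frechet_derivative f (at x)" if "x \<in> W" for x
    using frechet_derivative_at[OF assms(2)[OF that]] .
  then have "ck_on k W (\<lambda>x. frechet_derivative f (at x) v)" for v
    using ck_on_cong[OF assms(1) _ assms(3)[of v]] by simp
  then show ?thesis using assms(2) by (auto simp: differentiable_def)
qed

lemma ck_on_has_derivative: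
  assumes "ck_on (Suc k) W f" "x \<in> W"
  shows "(f has_derivative frechet_derivative f (at x)) (at x)"
  using assms by (simp add: frechet_derivative_works)

lemma ck_on_SucD: "ck_on (Suc k) W f \<Longrightarrow> ck_on k W f"
proof (induction k arbitrary: f)
  case 0
  then show ?case
    by (auto intro!: continuous_at_imp_continuous_on differentiable_imp_continuous_within)
next
  case (Suc k)
  then have "ck_on k W (\<lambda>x. frechet_derivative f (at x) v)" for v
    using Suc.IH[of "\<lambda>x. frechet_derivative f (at x) v"] by simp
  with Suc.prems show ?case by simp
qed

lemma ck_on_imp_continuous_on: "ck_on k W f \<Longrightarrow> continuous_on W f"
  by (induction k) (use ck_on_SucD in auto)

lemma ck_on_subset: "ck_on k W f \<Longrightarrow> W' \<subseteq> W \<Longrightarrow> ck_on k W' f"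
  by (induction k arbitrary: f) (auto intro: continuous_on_subset)

lemma ck_on_const: "open W \<Longrightarrow> ck_on k W (\<lambda>x. a)"
proof (induction k arbitrary: a)
  case (Suc k)
  then show ?case by (intro ck_on_SucI[where f' = "\<lambda>x v. 0"]) auto
qed simp

lemma ck_on_bounded_linear:
  assumes "open W" "bounded_linear f"
  shows "ck_on k W f"
proof (cases k)
  case 0
  then show ?thesis using assms by (simp add: linear_continuous_on)
next
  case (Suc m)
  show ?thesis unfolding Suc
    by (rule ck_on_SucI[where f' = "\<lambda>x. f"])
       (use assms in \<open>auto intro: ck_on_const bounded_linear_imp_has_derivative\<close>)
qed

lemma ck_on_add:
  "open W \<Longrightarrow> ck_on k W f \<Longrightarrow> ck_on k W g \<Longrightarrow> ck_on k W (\<lambda>x. f x + g x)"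
proof (induction k arbitrary: f g)
  case 0
  then show ?case by (auto intro: continuous_intros)
next
  case (Suc k)
  show ?case
    by (rule ck_on_SucI[where f' = "\<lambda>x v. frechet_derivative f (at x) v + frechet_derivative g (at x) v"])
       (use Suc in \<open>auto intro!: has_derivative_add ck_on_has_derivative\<close>)
qed

lemma (in bounded_bilinear) ck_on_prod:
  "open W \<Longrightarrow> ck_on k W f \<Longrightarrow> ck_on k W g \<Longrightarrow> ck_on k W (\<lambda>x. prod (f x) (g x))"
proof (induction k arbitrary: f g)
  case 0
  then show ?case by (auto intro: continuous_on)
next
  case (Suc k)
  show ?case
  proof (rule ck_on_SucI[OF Suc.prems(1)])
    fix x assume "x \<in> W"
    then show "((\<lambda>x. prod (f x) (g x)) has_derivative (\<lambda>v. prod (f x) (frechet_derivative g (at x) v) +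
          prod (frechet_derivative f (at x) v) (g x))) (at x)"
      by (intro FDERIV ck_on_has_derivative[OF Suc.prems(2)] ck_on_has_derivative[OF Suc.prems(3)])
  next
    fix v
    have "ck_on k W (\<lambda>x. frechet_derivative f (at x) v)" "ck_on k W (\<lambda>x. frechet_derivative g (at x) v)"
      using Suc.prems by simp_all
    then show "ck_on k W (\<lambda>x. prod (f x) (frechet_derivative g (at x) v) +
          prod (frechet_derivative f (at x) v) (g x))"
      by (intro ck_on_add Suc.prems(1) Suc.IH ck_on_SucD[OF Suc.prems(2)] ck_on_SucD[OF Suc.prems(3)])
  qed
qed

lemma ck_on_bounded_linear_compose:
  assumes "open W" "bounded_linear L"
  shows "ck_on k W f \<Longrightarrow> ck_on k W (\<lambda>x. L (f x))"
proof (induction k arbitrary: f)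
  case 0
  then show ?case using assms by (auto intro: bounded_linear.continuous_on)
next
  case (Suc k)
  show ?case
    by (rule ck_on_SucI[where f' = "\<lambda>x v. L (frechet_derivative f (at x) v)"])
       (use Suc assms in \<open>auto intro!: bounded_linear.has_derivative[OF assms(2)] ck_on_has_derivative\<close>)
qed

lemma ck_on_sum:
  assumes "open W" "\<And>i. i \<in> I \<Longrightarrow> ck_on k W (f i)"
  shows "ck_on k W (\<lambda>x. \<Sum>i\<in>I. f i x)"
  using assms(2) by (induction I rule: infinite_finite_induct) (auto intro: ck_on_const ck_on_add assms(1))

text \<open>The derivative of the composite is a sum over a basis of products of directional derivatives of the
  two factors, so the order of differentiability drops by one on both sides and the induction closes.\<close>

lemma ck_on_compose:
  fixes f :: "'e::real_normed_vector \<Rightarrow> 'm::euclidean_space"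
  assumes "open W" "open W'" "f ` W \<subseteq> W'"
  shows "ck_on k W f \<Longrightarrow> ck_on k W' g \<Longrightarrow> ck_on k W (\<lambda>x. g (f x))"
proof (induction k arbitrary: g)
  case 0
  then show ?case using continuous_on_compose2[of W' g W f] assms(3) by simp
next
  case (Suc k)
  let ?f = "\<lambda>x. frechet_derivative f (at x)" and ?g = "\<lambda>x. frechet_derivative g (at x)"
  have f': "(f has_derivative ?f x) (at x)" if "x \<in> W" for x
    by (rule ck_on_has_derivative[OF Suc.prems(1) that])
  have g': "(g has_derivative ?g (f x)) (at (f x))" if "x \<in> W" for x
    using assms(3) that by (intro ck_on_has_derivative[OF Suc.prems(2)]) auto
  have der: "((\<lambda>x. g (f x)) has_derivative (\<lambda>v. \<Sum>b\<in>Basis. (?f x v \<bullet> b) *\<^sub>R ?g (f x) b)) (at x)"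
    if "x \<in> W" for x
  proof -
    have lin: "linear (?g (f x))" by (rule has_derivative_linear[OF g'[OF that]])
    have "?g (f x) w = (\<Sum>b\<in>Basis. (w \<bullet> b) *\<^sub>R ?g (f x) b)" for w
      using linear_sum[OF lin, of "\<lambda>b. (w \<bullet> b) *\<^sub>R b" Basis]
      by (simp only: euclidean_representation linear_scale[OF lin])
    then have "(\<lambda>v. ?g (f x) (?f x v)) = (\<lambda>v. \<Sum>b\<in>Basis. (?f x v \<bullet> b) *\<^sub>R ?g (f x) b)"
      by blast
    with has_derivative_compose[OF f'[OF that] g'[OF that]] show ?thesis by metis
  qed
  show ?case
  proof (rule ck_on_SucI[OF assms(1) der])
    fix v
    have "ck_on k W (\<lambda>x. ?f x v \<bullet> b)" for b
      using ck_on_bounded_linear_compose[OF assms(1) bounded_linear_inner_left, of k "\<lambda>x. ?f x v"]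
        Suc.prems by simp
    moreover have "ck_on k W (\<lambda>x. ?g (f x) b)" for b
      using Suc.IH[OF ck_on_SucD[OF Suc.prems(1)], of "\<lambda>y. ?g y b"] Suc.prems(2) by simp
    ultimately show "ck_on k W (\<lambda>x. \<Sum>b\<in>Basis. (?f x v \<bullet> b) *\<^sub>R ?g (f x) b)"
      by (intro ck_on_sum bounded_bilinear.ck_on_prod[OF bounded_bilinear_scaleR] assms(1))
  qed
qed

text \<open>The factor \<open>b\<close> makes the statement closed under differentiation.\<close>

lemma ck_on_powr: "ck_on k {0<..} (\<lambda>t::real. b * t powr a)"
proof (induction k arbitrary: a b)
  case 0
  show ?case by (auto intro!: continuous_intros)
next
  case (Suc k)
  show ?case
  proof (rule ck_on_SucI[where f' = "\<lambda>t v. v * (b * (a * t powr (a - 1)))"])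
    fix t :: real assume t: "t \<in> {0<..}"
    then have "((\<lambda>t. b * t powr a) has_field_derivative b * (a * t powr (a - 1))) (at t)"
      by (auto intro!: derivative_eq_intros)
    then show "((\<lambda>t. b * t powr a) has_derivative (\<lambda>v. v * (b * (a * t powr (a - 1))))) (at t)"
      unfolding has_field_derivative_def by (rule has_derivative_eq_rhs) (simp add: fun_eq_iff)
  next
    fix v show "ck_on k {0<..} (\<lambda>t::real. v * (b * (a * t powr (a - 1))))"
      using Suc.IH[of "v * (b * a)" "a - 1"] by (simp only: mult.assoc)
  qed simp
qed


section \<open>Smoothness up to the boundary of the half space\<close>

lemma smooth_onE:
  assumes "smooth_on S f" "x \<in> S"
  obtains W h where "open W" "x \<in> W" "\<And>k. ck_on k W h" "\<And>y. y \<in> W \<Longrightarrow> y \<in> S \<Longrightarrow> h y = f y"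
proof -
  from assms obtain W h where "open W \<and> x \<in> W \<and> (\<forall>k. ck_on k W h) \<and> (\<forall>y\<in>W \<inter> S. h y = f y)"
    unfolding smooth_on_def by meson
  then show thesis using that[of W h] by simp
qed

lemma smooth_on_ck_on:
  assumes "open W" "\<And>k. ck_on k W f"
  shows "smooth_on W f"
  unfolding smooth_on_def
proof
  fix x assume "x \<in> W"
  with assms show "\<exists>V h. open V \<and> x \<in> V \<and> (\<forall>k. ck_on k V h) \<and> (\<forall>y\<in>V \<inter> W. h y = f y)"
    by (intro exI[of _ W] exI[of _ f]) auto
qed

lemma smooth_on_local:
  assumes "\<And>x. x \<in> S \<Longrightarrow> \<exists>W. open W \<and> x \<in> W \<and> smooth_on (W \<inter> S) f"
  shows "smooth_on S f"
  unfolding smooth_on_def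
proof
  fix x assume "x \<in> S"
  from assms[OF this] obtain W where W: "open W" "x \<in> W" "smooth_on (W \<inter> S) f" by auto
  from W(2) \<open>x \<in> S\<close> have "x \<in> W \<inter> S" by simp
  then obtain W' h where h: "open W'" "x \<in> W'" "\<And>k. ck_on k W' h"
    "\<And>y. y \<in> W' \<Longrightarrow> y \<in> W \<inter> S \<Longrightarrow> h y = f y" by (rule smooth_onE[OF W(3)]) auto
  have "\<forall>k. ck_on k (W \<inter> W') h" using ck_on_subset[OF h(3)] by simp
  with h(1,2,4) W show "\<exists>W h. open W \<and> x \<in> W \<and> (\<forall>k. ck_on k W h) \<and> (\<forall>y\<in>W \<inter> S. h y = f y)"
    by (intro exI[of _ "W \<inter> W'"] exI[of _ h]) (simp add: open_Int)
qed

lemma smooth_on_cong: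
  assumes "\<And>x. x \<in> S \<Longrightarrow> f x = g x"
  shows "smooth_on S f \<longleftrightarrow> smooth_on S g"
proof -
  have "(\<forall>y\<in>W \<inter> S. h y = f y) \<longleftrightarrow> (\<forall>y\<in>W \<inter> S. h y = g y)" for W h using assms by auto
  then show ?thesis unfolding smooth_on_def by simp
qed

lemma smooth_on_subset:
  assumes "smooth_on S f" "T \<subseteq> S"
  shows "smooth_on T f"
  unfolding smooth_on_def
proof
  fix x assume "x \<in> T"
  with assms(2) have x: "x \<in> S" by auto
  obtain W h where h: "open W" "x \<in> W" "\<And>k. ck_on k W h" "\<And>y. y \<in> W \<Longrightarrow> y \<in> S \<Longrightarrow> h y = f y"
    by (rule smooth_onE[OF assms(1) x]) auto
  with assms(2) show "\<exists>W h. open W \<and> x \<in> W \<and> (\<forall>k. ck_on k W h) \<and> (\<forall>y\<in>W \<inter> T. h y = f y)"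
    by (intro exI[of _ W] exI[of _ h]) auto
qed

lemma smooth_on_imp_continuous_on:
  assumes "smooth_on S f"
  shows "continuous_on S f"
  unfolding continuous_on_eq_continuous_within
proof
  fix x assume x: "x \<in> S"
  then obtain W h where h: "open W" "x \<in> W" "\<And>k. ck_on k W h"
    "\<And>y. y \<in> W \<Longrightarrow> y \<in> S \<Longrightarrow> h y = f y" by (rule smooth_onE[OF assms]) auto
  have "isCont h x" using h ck_on_imp_continuous_on continuous_on_eq_continuous_at by blast
  then have "(h \<longlongrightarrow> f x) (at x within S)"
    using h(4)[OF h(2) x] by (metis continuous_at_imp_continuous_at_within continuous_within)
  moreover have "\<forall>\<^sub>F y in at x within S. h y = f y"
    unfolding eventually_at_topological using h by blast
  ultimately show "continuous (at x within S) f"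
    unfolding continuous_within using tendsto_cong by blast
qed

lemma smooth_on_const: "smooth_on S (\<lambda>x. a)"
  by (rule smooth_on_subset[of UNIV], rule smooth_on_ck_on) (auto intro: ck_on_const)

lemma smooth_on_bounded_linear: "bounded_linear f \<Longrightarrow> smooth_on S f"
  by (rule smooth_on_subset[of UNIV], rule smooth_on_ck_on) (auto intro: ck_on_bounded_linear)

lemma smooth_on_nth: "smooth_on S (\<lambda>x. x $ i)" for S :: "(real ^ 'n::finite) set"
  by (rule smooth_on_bounded_linear[OF bounded_linear_vec_nth])

lemma smooth_on_add:
  assumes "smooth_on S f" "smooth_on S g"
  shows "smooth_on S (\<lambda>x. f x + g x)"
  unfolding smooth_on_def
proof
  fix x assume x: "x \<in> S"
  obtain W h where h: "open W" "x \<in> W" "\<And>k. ck_on k W h" "\<And>y. y \<in> W \<Longrightarrow> y \<in> S \<Longrightarrow> h y = f y"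
    by (rule smooth_onE[OF assms(1) x]) auto
  obtain W' h' where h': "open W'" "x \<in> W'" "\<And>k. ck_on k W' h'"
    "\<And>y. y \<in> W' \<Longrightarrow> y \<in> S \<Longrightarrow> h' y = g y"
    by (rule smooth_onE[OF assms(2) x]) auto
  have "ck_on k (W \<inter> W') (\<lambda>x. h x + h' x)" for k
    by (rule ck_on_add) (use h(1) h'(1) ck_on_subset[OF h(3)] ck_on_subset[OF h'(3)] in auto)
  with h h' show "\<exists>W h. open W \<and> x \<in> W \<and> (\<forall>k. ck_on k W h) \<and> (\<forall>y\<in>W \<inter> S. h y = f y + g y)"
    by (intro exI[of _ "W \<inter> W'"] exI[of _ "\<lambda>x. h x + h' x"]) auto
qed

lemma (in bounded_bilinear) smooth_on_prod:
  assumes "smooth_on S f" "smooth_on S g"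
  shows "smooth_on S (\<lambda>x. prod (f x) (g x))"
  unfolding smooth_on_def
proof
  fix x assume x: "x \<in> S"
  obtain W h where h: "open W" "x \<in> W" "\<And>k. ck_on k W h" "\<And>y. y \<in> W \<Longrightarrow> y \<in> S \<Longrightarrow> h y = f y"
    by (rule smooth_onE[OF assms(1) x]) auto
  obtain W' h' where h': "open W'" "x \<in> W'" "\<And>k. ck_on k W' h'"
    "\<And>y. y \<in> W' \<Longrightarrow> y \<in> S \<Longrightarrow> h' y = g y"
    by (rule smooth_onE[OF assms(2) x]) auto
  have "ck_on k (W \<inter> W') (\<lambda>x. prod (h x) (h' x))" for k
    by (rule ck_on_prod) (use h(1) h'(1) ck_on_subset[OF h(3)] ck_on_subset[OF h'(3)] in auto)
  with h h' show "\<exists>W h. open W \<and> x \<in> W \<and> (\<forall>k. ck_on k W h) \<and> (\<forall>y\<in>W \<inter> S. h y = prod (f y) (g y))"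
    by (intro exI[of _ "W \<inter> W'"] exI[of _ "\<lambda>x. prod (h x) (h' x)"]) auto
qed

lemmas smooth_on_scaleR = bounded_bilinear.smooth_on_prod[OF bounded_bilinear_scaleR]
lemmas smooth_on_mult = bounded_bilinear.smooth_on_prod[OF bounded_bilinear_mult]

lemma smooth_on_sum:
  assumes "\<And>i. i \<in> I \<Longrightarrow> smooth_on S (f i)"
  shows "smooth_on S (\<lambda>x. \<Sum>i\<in>I. f i x)"
  using assms by (induction I rule: infinite_finite_induct) (auto intro: smooth_on_const smooth_on_add)

lemma smooth_on_diff:
  fixes f :: "'e::real_normed_vector \<Rightarrow> 'f::real_normed_vector"
  assumes "smooth_on S f" "smooth_on S g"
  shows "smooth_on S (\<lambda>x. f x - g x)"
  using smooth_on_add[OF assms(1) smooth_on_scaleR[OF smooth_on_const[of S "-1"] assms(2)]] by simp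

lemma smooth_on_compose:
  fixes f :: "'e::real_normed_vector \<Rightarrow> 'm::euclidean_space"
  assumes "smooth_on S f" "smooth_on T g" "f ` S \<subseteq> T"
  shows "smooth_on S (\<lambda>x. g (f x))"
  unfolding smooth_on_def
proof
  fix x assume x: "x \<in> S"
  obtain W h where h: "open W" "x \<in> W" "\<And>k. ck_on k W h" "\<And>y. y \<in> W \<Longrightarrow> y \<in> S \<Longrightarrow> h y = f y"
    by (rule smooth_onE[OF assms(1) x]) auto
  have fx: "f x \<in> T" using x assms(3) by blast
  obtain W' h' where h': "open W'" "f x \<in> W'" "\<And>k. ck_on k W' h'"
    "\<And>y. y \<in> W' \<Longrightarrow> y \<in> T \<Longrightarrow> h' y = g y"
    by (rule smooth_onE[OF assms(2) fx]) auto
  define V where "V = W \<inter> h -` W'"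
  have V: "open V" unfolding V_def
    using continuous_open_preimage[OF ck_on_imp_continuous_on[OF h(3)] h(1) h'(1)] .
  have xV: "x \<in> V" using h h' x by (auto simp: V_def)
  have "ck_on k V (\<lambda>x. h' (h x))" for k
    by (rule ck_on_compose[OF V h'(1) _ _ h'(3)]) (use ck_on_subset[OF h(3)] in \<open>auto simp: V_def\<close>)
  with V xV h h' assms(3)
  show "\<exists>W h. open W \<and> x \<in> W \<and> (\<forall>k. ck_on k W h) \<and> (\<forall>y\<in>W \<inter> S. h y = g (f y))"
    by (intro exI[of _ V] exI[of _ "\<lambda>x. h' (h x)"]) (fastforce simp: V_def)
qed

lemma smooth_on_component:
  fixes f :: "'e::real_normed_vector \<Rightarrow> real ^ 'n::finite"
  shows "smooth_on S f \<Longrightarrow> smooth_on S (\<lambda>x. f x $ i)"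
  by (rule smooth_on_compose[where T = UNIV and g = "\<lambda>x. x $ i"]) (auto intro: smooth_on_nth)

lemma smooth_on_powr:
  fixes f :: "'e::real_normed_vector \<Rightarrow> real"
  assumes "smooth_on S f" "\<And>x. x \<in> S \<Longrightarrow> f x > 0"
  shows "smooth_on S (\<lambda>x. f x powr a)"
  by (rule smooth_on_compose[OF assms(1), where T = "{0<..}" and g = "\<lambda>t. t powr a"])
     (use assms(2) ck_on_powr[of _ 1 a] in \<open>auto intro: smooth_on_ck_on\<close>)


text \<open>At a boundary point of the half space the derivative is one-sided in the normal direction but still
  unique, and it agrees with the derivative of any smooth local extension. All derivatives in charts
  turn out to be of this form, whatever relatively open set they are computed in.\<close>

abbreviation hderiv :: "(real ^ 'n::finite \<Rightarrow> 'b::real_normed_vector) \<Rightarrow> real ^ 'n \<Rightarrow> real ^ 'n \<Rightarrow> 'b" where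
  "hderiv f x \<equiv> frechet_derivative f (at x within half_space)"

lemma at_within_openin_half_space:
  assumes "openin (top_of_set half_space) S" "S \<subseteq> T" "T \<subseteq> half_space" "x \<in> S"
  shows "at x within T = at x within half_space"
proof -
  obtain O' where "open O'" "S = half_space \<inter> O'" using assms(1) unfolding openin_open by blast
  with assms show ?thesis by (intro at_within_nhd[of x O']) auto
qed

lemma half_space_derivative_unique:
  fixes f :: "real ^ 'n::finite \<Rightarrow> 'b::real_normed_vector"
  assumes "(f has_derivative f') (at x within half_space)" "(f has_derivative f'') (at x within half_space)"
    "x \<in> half_space"
  shows "f' = f''"
proof (rule frechet_derivative_unique_within[OF assms(1,2)])
  fix i :: "real ^ 'n" and e :: real assume i: "i \<in> Basis" and e: "e > 0"
  have "0 \<le> i $ bdry_index" using i by (auto simp: Basis_vec_def axis_def)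
  with e assms(3) show "\<exists>d. 0 < \<bar>d\<bar> \<and> \<bar>d\<bar> < e \<and> x + d *\<^sub>R i \<in> half_space"
    by (intro exI[of _ "e / 2"]) (auto simp: half_space_def)
qed

lemma hderiv_eq:
  assumes "(f has_derivative f') (at x within half_space)" "x \<in> half_space"
  shows "hderiv f x = f'"
proof -
  have "f differentiable (at x within half_space)" using assms(1) by (rule differentiableI)
  then show ?thesis
    using half_space_derivative_unique[OF _ assms] frechet_derivative_works by blast
qed

lemma has_derivative_half_space_cong:
  assumes "openin (top_of_set half_space) S" "x \<in> S" "\<And>y. y \<in> S \<Longrightarrow> f y = g y"
    "(f has_derivative f') (at x within half_space)"
  shows "(g has_derivative f') (at x within half_space)"
proof -
  have eq: "at x within S = at x within half_space"
    using at_within_openin_half_space[OF assms(1) _ _ assms(2)] assms(1) openin_imp_subset by blast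
  show ?thesis using has_derivative_transform[of x S g f f'] assms unfolding eq by auto
qed

lemma smooth_on_extension_derivative:
  assumes "openin (top_of_set half_space) S" "x \<in> S" "open W" "x \<in> W" "ck_on (Suc 0) W h"
    "\<And>y. y \<in> W \<Longrightarrow> y \<in> S \<Longrightarrow> h y = f y"
  shows "(f has_derivative frechet_derivative h (at x)) (at x within half_space)"
proof (rule has_derivative_half_space_cong)
  show "openin (top_of_set half_space) (S \<inter> W)" using assms(1,3) by (rule openin_Int_open)
  show "(h has_derivative frechet_derivative h (at x)) (at x within half_space)"
    using ck_on_has_derivative[OF assms(5,4)] by (rule has_derivative_at_withinI)
qed (use assms in auto)

lemma smooth_on_has_derivative:
  assumes S: "openin (top_of_set half_space) S" and "smooth_on S f" "x \<in> S"
  shows "(f has_derivative hderiv f x) (at x within half_space)"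
proof -
  obtain W h where h: "open W" "x \<in> W" "\<And>k. ck_on k W h" "\<And>y. y \<in> W \<Longrightarrow> y \<in> S \<Longrightarrow> h y = f y"
    by (rule smooth_onE[OF assms(2,3)]) auto
  have "(f has_derivative frechet_derivative h (at x)) (at x within half_space)"
    by (rule smooth_on_extension_derivative[OF S assms(3) h(1,2) h(3) h(4)])
  then show ?thesis by (metis frechet_derivative_works differentiableI)
qed

text \<open>A local smooth extension of \<open>f\<close> also extends the directional derivatives of \<open>f\<close>.\<close>

lemma smooth_on_hderiv:
  assumes S: "openin (top_of_set half_space) S" and "smooth_on S f"
  shows "smooth_on S (\<lambda>x. hderiv f x v)"
  unfolding smooth_on_def
proof
  fix x assume x: "x \<in> S"
  obtain W h where h: "open W" "x \<in> W" "\<And>k. ck_on k W h" "\<And>y. y \<in> W \<Longrightarrow> y \<in> S \<Longrightarrow> h y = f y"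
    by (rule smooth_onE[OF assms(2) x]) auto
  have "frechet_derivative h (at y) v = hderiv f y v" if "y \<in> W \<inter> S" for y
  proof -
    have "(f has_derivative frechet_derivative h (at y)) (at y within half_space)"
      by (rule smooth_on_extension_derivative[OF S _ h(1) _ h(3) h(4)]) (use that in auto)
    with hderiv_eq show ?thesis using that openin_imp_subset[OF S] by fastforce
  qed
  moreover have "ck_on k W (\<lambda>y. frechet_derivative h (at y) v)" for k using h(3)[of "Suc k"] by simp
  ultimately show "\<exists>W h. open W \<and> x \<in> W \<and> (\<forall>k. ck_on k W h) \<and> (\<forall>y\<in>W \<inter> S. h y = hderiv f y v)"
    using h by (intro exI[of _ W] exI[of _ "\<lambda>y. frechet_derivative h (at y) v"]) auto
qed

lemma hderiv_chain:
  fixes f :: "real ^ 'n::finite \<Rightarrow> real ^ 'n"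
  assumes S: "openin (top_of_set half_space) S" and f: "smooth_on S f"
    and T: "openin (top_of_set half_space) T" and g: "smooth_on T g"
    and sub: "f ` S \<subseteq> T" and x: "x \<in> S"
  shows "hderiv (\<lambda>x. g (f x)) x = (\<lambda>v. hderiv g (f x) (hderiv f x v))"
proof (rule hderiv_eq)
  have S': "at x within S = at x within half_space"
    using at_within_openin_half_space[OF S _ _ x] S openin_imp_subset by blast
  have fx: "f x \<in> T" using sub x by blast
  have "(f has_derivative hderiv f x) (at x within S)"
    using smooth_on_has_derivative[OF S f x] unfolding S' .
  moreover have "(g has_derivative hderiv g (f x)) (at (f x) within f ` S)"
    using smooth_on_has_derivative[OF T g fx] sub openin_imp_subset[OF T]
    by (meson has_derivative_subset subset_trans)
  ultimately show "((\<lambda>x. g (f x)) has_derivative (\<lambda>v. hderiv g (f x) (hderiv f x v)))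
      (at x within half_space)"
    using diff_chain_within[of f _ x S g] unfolding S' comp_def by blast
  show "x \<in> half_space" using x openin_imp_subset[OF S] by blast
qed

text \<open>The line through \<open>x\<close> in a tangential direction stays in the boundary, where \<open>f\<close> vanishes.\<close>

lemma hderiv_tangential_zero:
  fixes f :: "real ^ 'n::finite \<Rightarrow> 'b::real_normed_vector"
  assumes S: "openin (top_of_set half_space) S" and f: "smooth_on S f"
    and zero: "\<And>y. y \<in> S \<Longrightarrow> y $ bdry_index = 0 \<Longrightarrow> f y = 0"
    and x: "x \<in> S" "x $ bdry_index = 0" and v: "v $ bdry_index = 0"
  shows "hderiv f x v = 0"
proof -
  have H: "x + t *\<^sub>R v \<in> half_space" for t using x v by (simp add: half_space_def)
  have "((\<lambda>t. x + t *\<^sub>R v) has_derivative (\<lambda>t. t *\<^sub>R v)) (at 0)"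
    by (auto intro!: derivative_eq_intros)
  moreover have "(f has_derivative hderiv f x) (at (x + 0 *\<^sub>R v) within range (\<lambda>t. x + t *\<^sub>R v))"
    using smooth_on_has_derivative[OF S f x(1)] H by (auto intro: has_derivative_subset)
  ultimately have 1: "((\<lambda>t. f (x + t *\<^sub>R v)) has_derivative (\<lambda>t. hderiv f x (t *\<^sub>R v))) (at 0)"
    using diff_chain_within[of "\<lambda>t. x + t *\<^sub>R v" _ 0 UNIV f] unfolding comp_def by blast
  obtain O' where O': "open O'" "S = half_space \<inter> O'" using S unfolding openin_open by blast
  have "open ((\<lambda>t. x + t *\<^sub>R v) -` O')" by (intro continuous_open_vimage O') (auto intro!: continuous_intros)
  from has_derivative_transform_within_open[OF 1 this, of "\<lambda>t. 0"]
  have "((\<lambda>t. 0) has_derivative (\<lambda>t. hderiv f x (t *\<^sub>R v))) (at 0)"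
    using O' x v H zero by auto
  then have "(\<lambda>t. hderiv f x (t *\<^sub>R v)) = (\<lambda>t. 0)"
    using has_derivative_unique has_derivative_const by blast
  from fun_cong[OF this, of 1] show ?thesis by simp
qed


section \<open>Division by the boundary coordinate\<close>

text \<open>Multiplication of the boundary coordinate by \<open>t\<close>: the segment from the projection of \<open>y\<close> to the
  boundary (\<open>t = 0\<close>) to \<open>y\<close> itself (\<open>t = 1\<close>).\<close>

definition shrink :: "real \<Rightarrow> real ^ 'n::finite \<Rightarrow> real ^ 'n" where
  "shrink t y = y - ((1 - t) * y $ bdry_index) *\<^sub>R axis bdry_index 1"

lemma shrink_nth_bdry: "shrink t y $ bdry_index = t * y $ bdry_index"
  by (simp add: shrink_def axis_def algebra_simps)

lemma shrink_1: "shrink 1 y = y"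
  by (simp add: shrink_def)

lemma shrink_fixed: "y $ bdry_index = 0 \<Longrightarrow> shrink t y = y"
  by (simp add: shrink_def)

lemma bounded_linear_shrink: "bounded_linear (shrink t :: real ^ 'n::finite \<Rightarrow> _)"
  unfolding shrink_def
  by (intro bounded_linear_sub bounded_linear_ident bounded_linear_scaleR_left
        bounded_linear_compose[OF bounded_linear_scaleR_left]
        bounded_linear_compose[OF bounded_linear_mult_right] bounded_linear_vec_nth)

lemma continuous_on_shrink: "continuous_on A (\<lambda>(y, t). shrink t y)"
  unfolding shrink_def case_prod_beta by (intro continuous_intros)

lemma shrink_ball:
  assumes "x $ bdry_index = 0" "t \<in> {0..1}" "y \<in> ball x r"
  shows "shrink t y \<in> ball x r"
proof -
  have "norm (shrink t (y - x)) \<le> norm (y - x)"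
  proof (rule norm_le_componentwise_cart)
    fix i
    show "norm (shrink t (y - x) $ i) \<le> norm ((y - x) $ i)"
    proof (cases "i = bdry_index")
      case True
      have "\<bar>t\<bar> * \<bar>(y - x) $ bdry_index\<bar> \<le> 1 * \<bar>(y - x) $ bdry_index\<bar>"
        using assms(2) by (intro mult_right_mono) auto
      with True show ?thesis by (simp only: shrink_nth_bdry abs_mult real_norm_def mult_1)
    qed (simp add: shrink_def axis_def)
  qed
  moreover have "shrink t (y - x) = shrink t y - x"
    using assms(1) by (simp add: shrink_def)
  ultimately show ?thesis using assms(3) by (simp add: dist_norm norm_minus_commute)
qed

text \<open>Differentiation under the integral sign. The derivative of \<open>g (shrink t y)\<close> in a direction with
  normal component \<open>v\<^sub>0\<close> is the directional derivative of \<open>g\<close> minus \<open>(1 - t) v\<^sub>0\<close> times the normal one; the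
  weight \<open>a\<close> absorbs the factor \<open>1 - t\<close> and keeps the statement closed under differentiation.\<close>

lemma ck_on_shrink_integral:
  fixes g :: "real ^ 'n::finite \<Rightarrow> real"
  assumes W: "open W" "convex W" "\<And>y t. y \<in> W \<Longrightarrow> t \<in> {0..1} \<Longrightarrow> shrink t y \<in> W"
    and a: "continuous_on {0..1} a" and g: "\<And>k. ck_on k W g"
  shows "ck_on k W (\<lambda>y. integral {0..1} (\<lambda>t. a t * g (shrink t y)))"
  using a g
proof (induction k arbitrary: a g)
  have cont: "continuous_on (W \<times> {0..1}) (\<lambda>(y, t). a t * g (shrink t y))"
    if a: "continuous_on {0..1} a" and g: "continuous_on W g" for a :: "real \<Rightarrow> real" and g :: "real ^ 'n \<Rightarrow> real"
  proof -
    have "continuous_on (W \<times> {0..1}) (\<lambda>z. g (shrink (snd z) (fst z)))"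
      by (rule continuous_on_compose2[OF g])
         (use continuous_on_shrink[of "W \<times> {0..1}"] W(3) in \<open>auto simp: case_prod_beta\<close>)
    moreover have "continuous_on (W \<times> {0..1}) (\<lambda>z. a (snd z))"
      by (rule continuous_on_compose2[OF a]) (auto intro: continuous_intros)
    ultimately show ?thesis unfolding case_prod_beta by (intro continuous_intros)
  qed
  have slice: "continuous_on {0..1} (\<lambda>t. a t * g (shrink t y))"
    if "continuous_on {0..1} a" "continuous_on W g" "y \<in> W"
    for a :: "real \<Rightarrow> real" and g :: "real ^ 'n \<Rightarrow> real" and y
  proof -
    have "continuous_on {0..1} (\<lambda>t. (y, t))" "(\<lambda>t. (y, t)) ` {0..1} \<subseteq> W \<times> {0..1}"
      using that(3) by (auto intro!: continuous_intros)
    from continuous_on_compose2[OF cont[OF that(1,2)] this] show ?thesis by simp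
  qed
  {
    case 0
    have "continuous_on W g" using "0.prems"(2)[of 0] by simp
    from integral_continuous_on_param[of W 0 1 "\<lambda>y t. a t * g (shrink t y)"] cont[OF "0.prems"(1) this]
    show ?case by simp
  next
    case (Suc k)
    define g' where "g' = (\<lambda>y. frechet_derivative g (at y))"
    define e :: "real ^ 'n" where "e = axis bdry_index 1"
    have g': "(g has_derivative g' y) (at y)" if "y \<in> W" for y
      unfolding g'_def by (rule ck_on_has_derivative[OF Suc.prems(2) that])
    have g'_ck: "ck_on k W (\<lambda>y. g' y v)" for k v
      using Suc.prems(2)[of "Suc k"] by (simp add: g'_def)
    have g'_cont: "continuous_on W (\<lambda>y. g' y v)" for v
      using ck_on_imp_continuous_on[OF g'_ck] .
    have lin: "linear (g' y)" if "y \<in> W" for y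
      using g'[OF that] by (rule has_derivative_linear)
    define b where "b = (\<lambda>t. (1 - t) * a t)"
    have b: "continuous_on {0..1} b" unfolding b_def by (intro continuous_intros Suc.prems)
    define I where "I = (\<lambda>a h (y :: real ^ 'n). integral {0..1} (\<lambda>t. a t * h (shrink t y) :: real))"
    define F where "F = (\<lambda>y t. Blinfun (\<lambda>v. a t * g' (shrink t y) (shrink t v)))"
    have F: "blinfun_apply (F y t) = (\<lambda>v. a t * g' (shrink t y) (shrink t v))"
      if "y \<in> W" "t \<in> {0..1}" for y t
    proof -
      have "bounded_linear (g' (shrink t y))" using g'[OF W(3)[OF that]] by (rule has_derivative_bounded_linear)
      then have "bounded_linear (\<lambda>v. a t * g' (shrink t y) (shrink t v))"
        by (intro bounded_linear_compose[OF bounded_linear_mult_right]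
             bounded_linear_compose[OF _ bounded_linear_shrink])
      then show ?thesis unfolding F_def by (rule bounded_linear_Blinfun_apply)
    qed
    have F': "blinfun_apply (F y t) v = a t * g' (shrink t y) v - v $ bdry_index * (b t * g' (shrink t y) e)"
      if "y \<in> W" "t \<in> {0..1}" for y t v
    proof -
      have "g' (shrink t y) (shrink t v) = g' (shrink t y) v - (1 - t) * v $ bdry_index * g' (shrink t y) e"
        using lin[OF W(3)[OF that]] by (simp add: shrink_def linear_diff linear_scale e_def)
      then have "a t * g' (shrink t y) (shrink t v) =
          a t * (g' (shrink t y) v - (1 - t) * v $ bdry_index * g' (shrink t y) e)" by (rule arg_cong)
      then show ?thesis by (simp add: F[OF that] b_def algebra_simps)
    qed
    have der: "((\<lambda>y. integral (cbox 0 1) (\<lambda>t. a t * g (shrink t y))) has_derivative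
        blinfun_apply (integral (cbox 0 1) (F y))) (at y within W)" if y: "y \<in> W" for y
    proof (rule leibniz_rule[OF _ _ _ y W(2)])
      fix y t assume yt: "y \<in> W" "t \<in> cbox (0::real) 1"
      then have t: "t \<in> {0..1}" by simp
      have "((\<lambda>y. g (shrink t y)) has_derivative (\<lambda>v. g' (shrink t y) (shrink t v))) (at y)"
        by (rule has_derivative_compose[OF bounded_linear_imp_has_derivative[OF bounded_linear_shrink]
              g'[OF W(3)[OF yt(1) t]]])
      then have "((\<lambda>y. a t * g (shrink t y)) has_derivative (\<lambda>v. a t * g' (shrink t y) (shrink t v))) (at y)"
        by (rule has_derivative_mult_right)
      then show "((\<lambda>y. a t * g (shrink t y)) has_derivative blinfun_apply (F y t)) (at y within W)"
        unfolding F[OF yt(1) t] by (rule has_derivative_at_withinI)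
    next
      fix y assume y: "y \<in> W"
      have "continuous_on {0..1} (\<lambda>t. a t * g (shrink t y))"
        by (rule slice[OF Suc.prems(1) ck_on_imp_continuous_on[OF Suc.prems(2)] y])
      then show "(\<lambda>t. a t * g (shrink t y)) integrable_on cbox 0 1"
        by (simp add: integrable_continuous_real)
    next
      have "continuous_on (W \<times> {0..1}) (\<lambda>(y, t). a t * g' (shrink t y) v -
          v $ bdry_index * (b t * g' (shrink t y) e))" for v
        using cont[OF Suc.prems(1) g'_cont[of v]] cont[OF b g'_cont[of e]]
        unfolding case_prod_beta by (intro continuous_on_diff continuous_on_mult_left)
      then have "continuous_on (W \<times> {0..1}) (\<lambda>z. blinfun_apply (case z of (y, t) \<Rightarrow> F y t) v)" for v
        by (rule continuous_on_eq) (auto simp: F')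
      then show "continuous_on (W \<times> cbox 0 1) (\<lambda>(y, t). F y t)"
        by (intro continuous_on_blinfun_componentwise) simp
    qed
    have I_integrable: "(\<lambda>t. a t * h (shrink t y)) integrable_on {0..1}"
      if "continuous_on {0..1} a" "continuous_on W h" "y \<in> W" for a y and h :: "real ^ 'n \<Rightarrow> real"
      by (intro integrable_continuous_real slice that)
    have F_int: "F y integrable_on cbox 0 1" if "y \<in> W" for y
    proof -
      have "continuous_on {0..1} (\<lambda>t. blinfun_apply (F y t) v)" for v
      proof (rule continuous_on_eq)
        have "continuous_on {0..1} (\<lambda>t. a t * g' (shrink t y) v)" "continuous_on {0..1} (\<lambda>t. b t * g' (shrink t y) e)"
          by (intro slice Suc.prems(1) b g'_cont that)+
        then show "continuous_on {0..1} (\<lambda>t. a t * g' (shrink t y) v - v $ bdry_index * (b t * g' (shrink t y) e))"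
          by (intro continuous_on_diff continuous_on_mult_left)
      qed (simp add: F' that)
      then have "continuous_on (cbox 0 1) (F y)"
        by (intro continuous_on_blinfun_componentwise) simp
      then show ?thesis by (rule integrable_continuous)
    qed
    have der_eq: "blinfun_apply (integral (cbox 0 1) (F y)) v =
        I a (\<lambda>y. g' y v) y - v $ bdry_index * I b (\<lambda>y. g' y e) y" if "y \<in> W" for y v
    proof -
      have "blinfun_apply (integral (cbox 0 1) (F y)) v = integral {0..1} (\<lambda>t. blinfun_apply (F y t) v)"
        using blinfun_apply_integral[OF F_int[OF that]] by simp
      also have "\<dots> = integral {0..1} (\<lambda>t. a t * g' (shrink t y) v - v $ bdry_index * (b t * g' (shrink t y) e))"
        by (rule integral_cong) (use F' that in auto)
      also have "\<dots> = I a (\<lambda>y. g' y v) y - v $ bdry_index * I b (\<lambda>y. g' y e) y"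
        unfolding I_def
        using I_integrable[OF Suc.prems(1) g'_cont that] I_integrable[OF b g'_cont that]
        by (subst integral_diff) (auto intro: integrable_on_mult_right)
      finally show ?thesis .
    qed
    show ?case
    proof (rule ck_on_SucI[OF W(1)])
      fix y assume y: "y \<in> W"
      show "((\<lambda>y. integral {0..1} (\<lambda>t. a t * g (shrink t y))) has_derivative
        (\<lambda>v. I a (\<lambda>y. g' y v) y - v $ bdry_index * I b (\<lambda>y. g' y e) y)) (at y)"
        using der[OF y] by (simp add: at_within_open[OF y W(1)] der_eq[OF y, symmetric])
    next
      fix v
      have "ck_on k W (I a (\<lambda>y. g' y v))" "ck_on k W (I b (\<lambda>y. g' y e))"
        unfolding I_def by (rule Suc.IH[OF Suc.prems(1) g'_ck], rule Suc.IH[OF b g'_ck])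
      then have "ck_on k W (\<lambda>y. I a (\<lambda>y. g' y v) y + (- v $ bdry_index) * I b (\<lambda>y. g' y e) y)"
        by (intro ck_on_add W(1) bounded_bilinear.ck_on_prod[OF bounded_bilinear_mult] ck_on_const)
      then show "ck_on k W (\<lambda>y. I a (\<lambda>y. g' y v) y - v $ bdry_index * I b (\<lambda>y. g' y e) y)" by simp
    qed
  }
qed

text \<open>The quotient \<open>f / x\<^sub>0\<close> of a function that vanishes on the boundary, with its limit as value there.\<close>

definition bdry_quotient :: "(real ^ 'n::finite \<Rightarrow> real) \<Rightarrow> real ^ 'n \<Rightarrow> real" where
  "bdry_quotient f x = (if x $ bdry_index = 0 then hderiv f x (axis bdry_index 1) else f x / x $ bdry_index)"

text \<open>Hadamard's lemma: by the fundamental theorem of calculus along the segment \<open>t \<mapsto> shrink t y\<close>, the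
  quotient is the integral over \<open>t\<close> of the normal derivative of a local smooth extension of \<open>f\<close>. That
  extension vanishes on the boundary because it agrees with \<open>f\<close> on the half space.\<close>

theorem smooth_on_bdry_quotient:
  fixes f :: "real ^ 'n::finite \<Rightarrow> real"
  assumes S: "openin (top_of_set half_space) S" and f: "smooth_on S f"
    and zero: "\<And>y. y \<in> S \<Longrightarrow> y $ bdry_index = 0 \<Longrightarrow> f y = 0"
  shows "smooth_on S (bdry_quotient f)"
proof (rule smooth_on_local)
  fix x assume x: "x \<in> S"
  have S_sub: "S \<subseteq> half_space" using S openin_imp_subset by blast
  show "\<exists>W. open W \<and> x \<in> W \<and> smooth_on (W \<inter> S) (bdry_quotient f)"
  proof (cases "x $ bdry_index = 0")
    case False
    let ?W = "{y :: real ^ 'n. y $ bdry_index > 0}"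
    have "open ?W" by (intro open_Collect_less continuous_intros)
    moreover have "x \<in> ?W" using False x S_sub by (auto simp: half_space_def less_le)
    moreover have "smooth_on (?W \<inter> S) (bdry_quotient f)"
    proof -
      have "smooth_on (?W \<inter> S) (\<lambda>y. f y * (y $ bdry_index) powr (-1))"
        by (intro smooth_on_mult smooth_on_powr smooth_on_nth smooth_on_subset[OF f]) auto
      then show ?thesis
        by (rule smooth_on_cong[THEN iffD1, rotated])
           (auto simp: bdry_quotient_def powr_minus powr_one divide_inverse)
    qed
    ultimately show ?thesis by blast
  next
    case True
    \<comment> \<open>Near a boundary point: pass to a ball centered there, which \<open>shrink\<close> maps into itself.\<close>
    obtain W h where h: "open W" "x \<in> W" "\<And>k. ck_on k W h" "\<And>y. y \<in> W \<Longrightarrow> y \<in> S \<Longrightarrow> h y = f y"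
      by (rule smooth_onE[OF f x]) auto
    obtain O' where O': "open O'" "S = half_space \<inter> O'" using S unfolding openin_open by blast
    have "open (W \<inter> O')" "x \<in> W \<inter> O'" using h O' x by auto
    then obtain r where r: "r > 0" "ball x r \<subseteq> W \<inter> O'" using open_contains_ball by blast
    define B where "B = ball x r"
    have B: "open B" "convex B" "x \<in> B" "B \<subseteq> W" "B \<inter> half_space \<subseteq> S"
      using r O' by (auto simp: B_def)
    have sh: "shrink t y \<in> B" if "y \<in> B" "t \<in> {0..1}" for y t
      using shrink_ball[OF True that(2)] that(1) unfolding B_def by blast
    define h' where "h' = (\<lambda>y. frechet_derivative h (at y))"
    let ?e = "axis bdry_index 1 :: real ^ 'n"
    have h': "(h has_derivative h' y) (at y)" if "y \<in> B" for y
      unfolding h'_def by (rule ck_on_has_derivative[OF h(3)]) (use that B in auto)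
    have h'_ck: "ck_on k B (\<lambda>y. h' y ?e)" for k
      using h(3)[of "Suc k"] ck_on_subset[OF _ B(4), of k "\<lambda>y. h' y ?e"] by (simp add: h'_def)
    let ?q = "\<lambda>y. integral {0..1} (\<lambda>t. 1 * h' (shrink t y) ?e)"
    have "smooth_on B ?q"
      by (rule smooth_on_ck_on[OF B(1)], rule ck_on_shrink_integral[OF B(1,2) sh _ h'_ck]) auto
    moreover have "?q y = bdry_quotient f y" if y: "y \<in> B \<inter> S" for y
    proof (cases "y $ bdry_index = 0")
      case True
      then have "?q y = h' y ?e" by (simp add: shrink_fixed)
      also have "h' y = hderiv f y"
      proof -
        have "(f has_derivative h' y) (at y within half_space)" unfolding h'_def
          by (rule smooth_on_extension_derivative[OF S _ h(1) _ h(3) h(4)]) (use y B in auto)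
        then show ?thesis using hderiv_eq S_sub y by fastforce
      qed
      finally show ?thesis using True by (simp add: bdry_quotient_def)
    next
      case False
      have "((\<lambda>t. h (shrink t y)) has_vector_derivative y $ bdry_index * h' (shrink t y) ?e) (at t within {0..1})"
        if t: "t \<in> {0..1}" for t
      proof -
        have sd: "((\<lambda>t. shrink t y) has_derivative (\<lambda>s. (s * y $ bdry_index) *\<^sub>R ?e)) (at t within {0..1})"
          unfolding shrink_def by (auto intro!: derivative_eq_intros simp: algebra_simps)
        have "((\<lambda>t. h (shrink t y)) has_derivative (\<lambda>s. h' (shrink t y) ((s * y $ bdry_index) *\<^sub>R ?e))) (at t within {0..1})"
          by (rule has_derivative_compose[OF sd h'[OF sh[OF _ t]]]) (use y in auto)
        moreover have "linear (h' (shrink t y))"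
          by (rule has_derivative_linear[OF h'[OF sh[OF _ t]]]) (use y in auto)
        ultimately show ?thesis
          by (simp add: has_vector_derivative_def linear_scale mult.assoc)
      qed
      then have "((\<lambda>t. y $ bdry_index * h' (shrink t y) ?e) has_integral (h (shrink 1 y) - h (shrink 0 y))) {0..1}"
        by (intro fundamental_theorem_of_calculus) auto
      then have "((\<lambda>t. (y $ bdry_index * h' (shrink t y) ?e) / y $ bdry_index) has_integral
          (h (shrink 1 y) - h (shrink 0 y)) / y $ bdry_index) {0..1}"
        by (rule has_integral_divide)
      then have "((\<lambda>t. h' (shrink t y) ?e) has_integral (h (shrink 1 y) - h (shrink 0 y)) / y $ bdry_index) {0..1}"
        using False by simp
      moreover have "h (shrink 0 y) = 0"
      proof -
        have s: "shrink 0 y $ bdry_index = 0" by (simp add: shrink_nth_bdry)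
        moreover have "shrink 0 y \<in> B" using y by (intro sh) auto
        ultimately have "shrink 0 y \<in> S" "shrink 0 y \<in> W" using B by (auto simp: half_space_def)
        with s show ?thesis using h(4) zero by metis
      qed
      moreover have "h y = f y" using h(4) y B by auto
      ultimately show ?thesis using False by (simp add: shrink_1 bdry_quotient_def integral_unique)
    qed
    ultimately have "smooth_on (B \<inter> S) (bdry_quotient f)"
      using smooth_on_cong[of "B \<inter> S" ?q "bdry_quotient f"] smooth_on_subset[of B ?q "B \<inter> S"] by blast
    with B show ?thesis by blast
  qed
qed


section \<open>Calculus in charts\<close>

lemma smooth_in_chart_cong:
  assumes "\<And>p. p \<in> V \<inter> fst c \<Longrightarrow> F p = G p" "smooth_in_chart c V F"
    "inj_on (snd c) (fst c)"
  shows "smooth_in_chart c V G"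
proof -
  have "(F \<circ> chart_inv c) x = (G \<circ> chart_inv c) x" if "x \<in> snd c ` (V \<inter> fst c)" for x
    using that assms(1,3) by (auto simp: chart_inv_def inv_into_f_f)
  with assms(2) show ?thesis
    unfolding smooth_in_chart_def using smooth_on_cong by blast
qed

lemma smooth_in_chart_subset:
  assumes "smooth_in_chart c V F" "V' \<inter> fst c \<subseteq> V"
  shows "smooth_in_chart c V' F"
  using assms(1) unfolding smooth_in_chart_def
  by (rule smooth_on_subset) (use assms(2) in auto)

lemma smooth_in_chart_const: "smooth_in_chart c V (\<lambda>p. a)"
  by (simp add: smooth_in_chart_def comp_def smooth_on_const)

lemma smooth_in_chart_add:
  "smooth_in_chart c V F \<Longrightarrow> smooth_in_chart c V G \<Longrightarrow> smooth_in_chart c V (\<lambda>p. F p + G p)"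
  unfolding smooth_in_chart_def comp_def by (rule smooth_on_add)

lemma smooth_in_chart_diff:
  "smooth_in_chart c V F \<Longrightarrow> smooth_in_chart c V G \<Longrightarrow> smooth_in_chart c V (\<lambda>p. F p - G p)"
  unfolding smooth_in_chart_def comp_def by (rule smooth_on_diff)

lemma smooth_in_chart_scaleR:
  "smooth_in_chart c V F \<Longrightarrow> smooth_in_chart c V G \<Longrightarrow> smooth_in_chart c V (\<lambda>p. F p *\<^sub>R G p)"
  unfolding smooth_in_chart_def comp_def by (rule smooth_on_scaleR)

lemma smooth_in_chart_mult:
  fixes F G :: "'a \<Rightarrow> real"
  shows "smooth_in_chart c V F \<Longrightarrow> smooth_in_chart c V G \<Longrightarrow> smooth_in_chart c V (\<lambda>p. F p * G p)"
  unfolding smooth_in_chart_def comp_def by (rule smooth_on_mult)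

lemma smooth_in_chart_sum:
  "(\<And>i. i \<in> I \<Longrightarrow> smooth_in_chart c V (F i)) \<Longrightarrow> smooth_in_chart c V (\<lambda>p. \<Sum>i\<in>I. F i p)"
  unfolding smooth_in_chart_def comp_def by (rule smooth_on_sum)

lemma smooth_in_chart_component:
  fixes F :: "'a \<Rightarrow> real ^ 'm::finite"
  shows "smooth_in_chart c V F \<Longrightarrow> smooth_in_chart c V (\<lambda>p. F p $ i)"
  unfolding smooth_in_chart_def comp_def by (rule smooth_on_component)

lemma smooth_fun_const: "smooth_fun A V (\<lambda>p. a)"
  unfolding smooth_fun_def by (intro ballI smooth_in_chart_const)

lemma sec_eqD: "sec_eq A V s t \<Longrightarrow> c \<in> A \<Longrightarrow> p \<in> V \<Longrightarrow> p \<in> fst c \<Longrightarrow> s c p = t c p"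
  unfolding sec_eq_def by (metis IntI)

lemma sec_eqI: "(\<And>c p. c \<in> A \<Longrightarrow> p \<in> V \<Longrightarrow> p \<in> fst c \<Longrightarrow> s c p = t c p) \<Longrightarrow> sec_eq A V s t"
  unfolding sec_eq_def by simp

lemma linear_axis_sum:
  fixes L :: "real ^ 'n::finite \<Rightarrow> 'b::real_vector"
  assumes "linear L"
  shows "L v = (\<Sum>i\<in>UNIV. v $ i *\<^sub>R L (axis i 1))"
proof -
  have v: "(\<Sum>i\<in>UNIV. v $ i *\<^sub>R (axis i 1 :: real ^ 'n)) = v"
    using basis_expansion[of v] by (simp add: scalar_mult_eq_scaleR)
  have "L v = L (\<Sum>i\<in>UNIV. v $ i *\<^sub>R (axis i 1 :: real ^ 'n))" by (simp only: v)
  also have "\<dots> = (\<Sum>i\<in>UNIV. v $ i *\<^sub>R L (axis i 1))"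
    by (simp only: linear_sum[OF assms] linear_scale[OF assms])
  finally show ?thesis .
qed

lemma sum_axis: "(\<Sum>k\<in>UNIV. v $ k *\<^sub>R (axis k 1 :: real ^ 'n::finite)) = v"
  using linear_axis_sum[OF linear_ident, of v] by simp


locale manifold_with_boundary =
  fixes A :: "('a::{t2_space,second_countable_topology}, 'n::finite) chart set"
  assumes manifold: "smooth_manifold_with_boundary A"
begin

lemma chart_exists: "\<exists>c\<in>A. p \<in> fst c"
proof -
  have "(\<Union>c\<in>A. fst c) = UNIV" using manifold unfolding smooth_manifold_with_boundary_def by (rule conjunct1)
  then show ?thesis by blast
qed

lemma open_chart: "c \<in> A \<Longrightarrow> open (fst c)"
  using manifold unfolding smooth_manifold_with_boundary_def by simp

lemma chart_homeomorphism: "c \<in> A \<Longrightarrow> homeomorphism (fst c) (snd c ` fst c) (snd c) (chart_inv c)"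
  using manifold unfolding smooth_manifold_with_boundary_def by simp

lemma smooth_transition:
  "c \<in> A \<Longrightarrow> d \<in> A \<Longrightarrow> smooth_on (snd c ` (fst c \<inter> fst d)) (snd d \<circ> chart_inv c)"
  using manifold unfolding smooth_manifold_with_boundary_def by simp

lemma chart_inv_coord: "c \<in> A \<Longrightarrow> p \<in> fst c \<Longrightarrow> chart_inv c (snd c p) = p"
  using chart_homeomorphism homeomorphism_apply1 by blast

lemma chart_inj: "c \<in> A \<Longrightarrow> inj_on (snd c) (fst c)"
  using chart_inv_coord by (metis inj_on_inverseI)

lemmas smooth_in_chart_cong' = smooth_in_chart_cong[OF _ _ chart_inj]

lemma openin_chart_image:
  assumes "c \<in> A" "open V"
  shows "openin (top_of_set half_space) (snd c ` (V \<inter> fst c))"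
proof -
  have "snd c ` (V \<inter> fst c) = snd c ` fst c \<inter> chart_inv c -` V"
    using chart_inv_coord[OF assms(1)] by force
  moreover have "openin (top_of_set (snd c ` fst c)) (snd c ` fst c \<inter> chart_inv c -` V)"
    using homeomorphism_cont2[OF chart_homeomorphism[OF assms(1)]] assms(2)
    by (simp add: continuous_openin_preimage_gen)
  moreover have "openin (top_of_set half_space) (snd c ` fst c)"
    using manifold assms(1) unfolding smooth_manifold_with_boundary_def by simp
  ultimately show ?thesis using openin_trans by metis
qed

lemma coord_in_half_space: "c \<in> A \<Longrightarrow> p \<in> fst c \<Longrightarrow> snd c p \<in> half_space"
  using openin_imp_subset[OF openin_chart_image[of c UNIV]] by auto

lemma continuous_on_coord: "c \<in> A \<Longrightarrow> continuous_on (fst c) (snd c)"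
  using chart_homeomorphism homeomorphism_cont1 by blast

lemma smooth_in_chart_of_coord:
  assumes "c \<in> A" "smooth_on (snd c ` (V \<inter> fst c)) G"
  shows "smooth_in_chart c V (\<lambda>p. G (snd c p))"
proof -
  have "snd c (chart_inv c x) = x" if "x \<in> snd c ` (V \<inter> fst c)" for x
    using that chart_inv_coord[OF assms(1)] by auto
  then show ?thesis unfolding smooth_in_chart_def using assms(2) by (subst smooth_on_cong[where g = G]) auto
qed

lemma smooth_in_chart_continuous_on:
  assumes "c \<in> A" "smooth_in_chart c V F"
  shows "continuous_on (V \<inter> fst c) F"
proof -
  have "continuous_on (V \<inter> fst c) (\<lambda>p. (F \<circ> chart_inv c) (snd c p))"
    by (rule continuous_on_compose2[OF smooth_on_imp_continuous_on[OF assms(2)[unfolded smooth_in_chart_def]]])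
       (use continuous_on_coord[OF assms(1)] in \<open>auto intro: continuous_on_subset\<close>)
  then show ?thesis by (rule continuous_on_eq) (simp add: chart_inv_coord assms(1))
qed

lemma smooth_in_chart_change:
  assumes "c \<in> A" "d \<in> A" "smooth_in_chart c V F"
  shows "smooth_in_chart d (V \<inter> fst c) F"
proof -
  have "smooth_on (snd d ` (V \<inter> fst c \<inter> fst d)) (\<lambda>x. (F \<circ> chart_inv c) ((snd c \<circ> chart_inv d) x))"
  proof (rule smooth_on_compose)
    show "smooth_on (snd d ` (V \<inter> fst c \<inter> fst d)) (snd c \<circ> chart_inv d)"
      by (rule smooth_on_subset[OF smooth_transition[OF assms(2,1)]]) auto
    show "smooth_on (snd c ` (V \<inter> fst c)) (F \<circ> chart_inv c)"
      using assms(3) by (simp add: smooth_in_chart_def)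
    show "(snd c \<circ> chart_inv d) ` snd d ` (V \<inter> fst c \<inter> fst d) \<subseteq> snd c ` (V \<inter> fst c)"
      using chart_inv_coord[OF assms(2)] by auto
  qed
  then show ?thesis unfolding smooth_in_chart_def
    by (rule smooth_on_cong[THEN iffD1, rotated]) (auto simp: chart_inv_coord assms(1,2))
qed

lemma smooth_in_chart_change':
  assumes "c \<in> A" "d \<in> A" "smooth_in_chart c V F" "V' \<inter> fst d \<subseteq> V \<inter> fst c"
  shows "smooth_in_chart d V' F"
  by (rule smooth_in_chart_subset[OF smooth_in_chart_change[OF assms(1-3)]]) (use assms(4) in auto)

lemma smooth_fun_in_one_chart:
  assumes "c \<in> A" "V \<subseteq> fst c" "smooth_in_chart c V f"
  shows "smooth_fun A V f"
  unfolding smooth_fun_def using smooth_in_chart_change'[OF assms(1) _ assms(3)] assms(2) by blast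

lemma chart_deriv_eq_hderiv:
  assumes "c \<in> A" "p \<in> fst c"
  shows "chart_deriv c F p = hderiv (F \<circ> chart_inv c) (snd c p)"
proof -
  have "openin (top_of_set half_space) (snd c ` fst c)" using openin_chart_image[OF assms(1), of UNIV] by simp
  then have "at (snd c p) within snd c ` fst c = at (snd c p) within half_space"
    by (rule at_within_openin_half_space[OF _ order_refl])
       (use assms coord_in_half_space[OF assms(1)] in auto)
  then show ?thesis by (simp add: chart_deriv_def)
qed

lemma smooth_in_chart_has_derivative:
  assumes "c \<in> A" "open V" "smooth_in_chart c V F" "p \<in> V" "p \<in> fst c"
  shows "(F \<circ> chart_inv c has_derivative chart_deriv c F p) (at (snd c p) within half_space)"
  unfolding chart_deriv_eq_hderiv[OF assms(1,5)]
  using smooth_on_has_derivative[OF openin_chart_image[OF assms(1,2)]] assms(3-5)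
  by (auto simp: smooth_in_chart_def)

lemma chart_derivI:
  assumes "c \<in> A" "p \<in> fst c" "(F \<circ> chart_inv c has_derivative F') (at (snd c p) within half_space)"
  shows "chart_deriv c F p = F'"
  unfolding chart_deriv_eq_hderiv[OF assms(1,2)]
  by (rule hderiv_eq[OF assms(3) coord_in_half_space[OF assms(1,2)]])

lemma chart_deriv_cong:
  assumes "c \<in> A" "open V" "smooth_in_chart c V F" "p \<in> V" "p \<in> fst c"
    "\<And>q. q \<in> V \<inter> fst c \<Longrightarrow> F q = G q"
  shows "chart_deriv c G p = chart_deriv c F p"
proof (rule chart_derivI[OF assms(1,5)])
  show "(G \<circ> chart_inv c has_derivative chart_deriv c F p) (at (snd c p) within half_space)"
    by (rule has_derivative_half_space_cong[OF openin_chart_image[OF assms(1,2)] _ _ smooth_in_chart_has_derivative[OF assms(1-5)]])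
       (use assms(4-6) chart_inv_coord[OF assms(1)] in auto)
qed

lemma chart_deriv_linear:
  assumes "c \<in> A" "open V" "smooth_in_chart c V F" "p \<in> V" "p \<in> fst c"
  shows "linear (chart_deriv c F p)"
  using smooth_in_chart_has_derivative[OF assms] by (rule has_derivative_linear)

lemma chart_deriv_const: "c \<in> A \<Longrightarrow> p \<in> fst c \<Longrightarrow> chart_deriv c (\<lambda>q. a) p = (\<lambda>v. 0)"
  by (rule chart_derivI) (auto simp: comp_def)

lemma chart_deriv_add:
  assumes "c \<in> A" "open V" "smooth_in_chart c V F" "smooth_in_chart c V G" "p \<in> V" "p \<in> fst c"
  shows "chart_deriv c (\<lambda>q. F q + G q) p = (\<lambda>v. chart_deriv c F p v + chart_deriv c G p v)"
  using smooth_in_chart_has_derivative[OF assms(1-3,5,6)] smooth_in_chart_has_derivative[OF assms(1,2,4-6)]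
  by (intro chart_derivI[OF assms(1,6)]) (auto simp: comp_def intro: has_derivative_add)

lemma chart_deriv_scaleR:
  assumes "c \<in> A" "open V" "smooth_in_chart c V f" "smooth_in_chart c V G" "p \<in> V" "p \<in> fst c"
  shows "chart_deriv c (\<lambda>q. f q *\<^sub>R G q) p = (\<lambda>v. f p *\<^sub>R chart_deriv c G p v + chart_deriv c f p v *\<^sub>R G p)"
proof (rule chart_derivI[OF assms(1,6)])
  have "((\<lambda>x. (f \<circ> chart_inv c) x *\<^sub>R (G \<circ> chart_inv c) x) has_derivative
      (\<lambda>v. (f \<circ> chart_inv c) (snd c p) *\<^sub>R chart_deriv c G p v + chart_deriv c f p v *\<^sub>R (G \<circ> chart_inv c) (snd c p)))
      (at (snd c p) within half_space)"
    by (intro has_derivative_scaleR smooth_in_chart_has_derivative[OF assms(1-3,5,6)]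
         smooth_in_chart_has_derivative[OF assms(1,2,4-6)])
  then show "((\<lambda>q. f q *\<^sub>R G q) \<circ> chart_inv c has_derivative
      (\<lambda>v. f p *\<^sub>R chart_deriv c G p v + chart_deriv c f p v *\<^sub>R G p)) (at (snd c p) within half_space)"
    by (simp add: comp_def chart_inv_coord assms(1,6))
qed

lemma chart_deriv_component:
  fixes F :: "'a \<Rightarrow> real ^ 'm::finite"
  assumes "c \<in> A" "open V" "smooth_in_chart c V F" "p \<in> V" "p \<in> fst c"
  shows "chart_deriv c (\<lambda>q. F q $ i) p = (\<lambda>v. chart_deriv c F p v $ i)"
  using bounded_linear.has_derivative[OF bounded_linear_vec_nth smooth_in_chart_has_derivative[OF assms], of i]
  by (intro chart_derivI[OF assms(1,5)]) (simp add: comp_def)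

lemma smooth_in_chart_deriv:
  assumes "c \<in> A" "open V" "smooth_in_chart c V F"
  shows "smooth_in_chart c V (\<lambda>p. chart_deriv c F p v)"
proof -
  have "smooth_on (snd c ` (V \<inter> fst c)) (\<lambda>x. hderiv (F \<circ> chart_inv c) x v)"
    using smooth_on_hderiv[OF openin_chart_image[OF assms(1,2)]] assms(3) by (simp add: smooth_in_chart_def)
  from smooth_in_chart_of_coord[OF assms(1) this] show ?thesis
    by (rule smooth_in_chart_cong'[rotated, OF _ assms(1)]) (simp add: chart_deriv_eq_hderiv assms(1))
qed

lemma smooth_in_chart_deriv_along:
  assumes "c \<in> A" "open V" "smooth_in_chart c V F" "smooth_in_chart c V X"
  shows "smooth_in_chart c V (\<lambda>p. chart_deriv c F p (X p))"
proof (rule smooth_in_chart_cong'[OF _ _ assms(1)])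
  show "smooth_in_chart c V (\<lambda>p. \<Sum>i\<in>UNIV. X p $ i *\<^sub>R chart_deriv c F p (axis i 1))"
    by (intro smooth_in_chart_sum smooth_in_chart_scaleR smooth_in_chart_component
          smooth_in_chart_deriv assms)
qed (use linear_axis_sum[OF chart_deriv_linear[OF assms(1-3)]] in auto)

lemma smooth_in_chart_coord:
  assumes "c \<in> A" "d \<in> A" "V \<inter> fst c \<subseteq> fst d"
  shows "smooth_in_chart c V (snd d)"
proof (rule smooth_in_chart_change'[OF assms(2,1)])
  show "smooth_in_chart d (fst d) (snd d)"
    by (rule smooth_in_chart_of_coord[OF assms(2) smooth_on_bounded_linear[OF bounded_linear_ident]])
qed (use assms(3) in auto)

text \<open>The chain rule for the transition map; it makes derivatives of functions along vector fields
  independent of the chart.\<close>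

lemma chart_deriv_change:
  assumes cd: "c \<in> A" "d \<in> A" and V: "open V" "smooth_in_chart d V F" and p: "p \<in> V" "p \<in> fst c" "p \<in> fst d"
  shows "chart_deriv c F p v = chart_deriv d F p (jac c d p v)"
proof -
  let ?V = "V \<inter> fst d"
  have V': "open ?V" using V(1) open_chart[OF cd(2)] by blast
  have F_c: "smooth_in_chart c ?V F" by (rule smooth_in_chart_change[OF cd(2,1) V(2)])
  let ?S = "snd c ` (?V \<inter> fst c)" and ?T = "snd d ` (V \<inter> fst d)"
  have S: "openin (top_of_set half_space) ?S" by (rule openin_chart_image[OF cd(1) V'])
  have x: "snd c p \<in> ?S" using p by blast
  have "hderiv (\<lambda>x. (F \<circ> chart_inv d) ((snd d \<circ> chart_inv c) x)) (snd c p) =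
      (\<lambda>v. hderiv (F \<circ> chart_inv d) ((snd d \<circ> chart_inv c) (snd c p)) (hderiv (snd d \<circ> chart_inv c) (snd c p) v))"
  proof (rule hderiv_chain[OF S _ openin_chart_image[OF cd(2) V(1)] _ _ x])
    show "smooth_on ?S (snd d \<circ> chart_inv c)"
      by (rule smooth_on_subset[OF smooth_transition[OF cd]]) auto
    show "smooth_on ?T (F \<circ> chart_inv d)" using V(2) by (simp add: smooth_in_chart_def)
    show "(snd d \<circ> chart_inv c) ` ?S \<subseteq> ?T" using chart_inv_coord[OF cd(1)] by auto
  qed
  also have "\<dots> = (\<lambda>v. chart_deriv d F p (jac c d p v))"
    using p chart_inv_coord[OF cd(1)]
    by (simp add: jac_def chart_deriv_eq_hderiv[OF cd(1)] chart_deriv_eq_hderiv[OF cd(2)])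
  finally have 1: "hderiv (\<lambda>x. (F \<circ> chart_inv d) ((snd d \<circ> chart_inv c) x)) (snd c p) =
      (\<lambda>v. chart_deriv d F p (jac c d p v))" .
  have "((\<lambda>x. (F \<circ> chart_inv d) ((snd d \<circ> chart_inv c) x)) has_derivative chart_deriv c F p) (at (snd c p) within half_space)"
    by (rule has_derivative_half_space_cong[OF S x _ smooth_in_chart_has_derivative[OF cd(1) V' F_c]])
       (use p chart_inv_coord[OF cd(1)] chart_inv_coord[OF cd(2)] in auto)
  with 1 show ?thesis using hderiv_eq[OF _ coord_in_half_space[OF cd(1) p(2)]] by metis
qed

lemma jac_linear:
  assumes "c \<in> A" "d \<in> A" "p \<in> fst c" "p \<in> fst d"
  shows "linear (jac c d p)"
  unfolding jac_def
  by (rule chart_deriv_linear[OF assms(1) open_chart[OF assms(2)] smooth_in_chart_coord[OF assms(1,2)]])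
     (use assms in auto)

lemma jac_cocycle:
  assumes "c \<in> A" "d \<in> A" "e \<in> A" "p \<in> fst c" "p \<in> fst d" "p \<in> fst e"
  shows "jac c e p v = jac d e p (jac c d p v)"
  unfolding jac_def[of _ e]
  by (rule chart_deriv_change[OF assms(1,2) open_chart[OF assms(3)] smooth_in_chart_coord[OF assms(2,3)]])
     (use assms in auto)

lemma jac_self:
  assumes "c \<in> A" "p \<in> fst c"
  shows "jac c c p v = v"
proof -
  have "jac c c p = (\<lambda>v. v)" unfolding jac_def
  proof (rule chart_derivI[OF assms])
    show "(snd c \<circ> chart_inv c has_derivative (\<lambda>v. v)) (at (snd c p) within half_space)"
      by (rule has_derivative_half_space_cong[OF openin_chart_image[OF assms(1) open_UNIV] _ _ has_derivative_ident])
         (use assms chart_inv_coord[OF assms(1)] in auto)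
  qed
  then show ?thesis by simp
qed

lemma jac_inverse:
  assumes "c \<in> A" "d \<in> A" "p \<in> fst c" "p \<in> fst d"
  shows "jac d c p (jac c d p v) = v"
  using jac_cocycle[OF assms(1,2,1) assms(3,4,3)] jac_self[OF assms(1,3)] by simp

lemma det_jac_nonzero:
  assumes "c \<in> A" "d \<in> A" "p \<in> fst c" "p \<in> fst d"
  shows "det (matrix (jac c d p)) \<noteq> 0"
proof -
  have "jac d c p \<circ> jac c d p = id" using jac_inverse[OF assms] by auto
  then have "matrix (jac d c p) ** matrix (jac c d p) = mat 1"
    using matrix_compose[OF jac_linear[OF assms] jac_linear[OF assms(2,1,4,3)]] by (simp add: matrix_id_mat_1)
  then have "det (matrix (jac d c p)) * det (matrix (jac c d p)) = 1"
    by (metis det_mul det_I)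
  then show ?thesis by auto
qed

lemma dens_factor_0:
  assumes "c \<in> A" "d \<in> A" "p \<in> fst c" "p \<in> fst d"
  shows "dens_factor 0 c d p = 1"
  using det_jac_nonzero[OF assms] by (simp add: dens_factor_def)

lemma smooth_in_chart_jac:
  assumes "c \<in> A" "d \<in> A" "open V" "V \<inter> fst c \<subseteq> fst d" "smooth_in_chart c V X"
  shows "smooth_in_chart c V (\<lambda>p. jac c d p (X p))"
  unfolding jac_def
  by (intro smooth_in_chart_deriv_along smooth_in_chart_coord assms)

lemma continuous_on_dens_factor:
  assumes "c \<in> A" "d \<in> A"
  shows "continuous_on (fst c \<inter> fst d) (dens_factor w c d)"
proof -
  have "continuous_on (fst d \<inter> fst c) (\<lambda>p. jac c d p (axis j 1) $ i)" for i j
    by (intro smooth_in_chart_continuous_on[OF assms(1)] smooth_in_chart_component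
          smooth_in_chart_jac[OF assms open_chart[OF assms(2)]] smooth_in_chart_const Int_lower1)
  then have "continuous_on (fst c \<inter> fst d) (\<lambda>p. det (matrix (jac c d p)))"
    unfolding det_def matrix_def by (simp add: Int_commute continuous_intros)
  then show ?thesis unfolding dens_factor_def
    by (intro continuous_intros) (use det_jac_nonzero[OF assms] in auto)
qed


section \<open>Boundary, interior and vector fields\<close>

text \<open>Whether a point lies on the boundary does not depend on the chart: by invariance of domain a
  transition map sends interior coordinates to an open subset of Euclidean space inside the half
  space, and such a set cannot meet the boundary hyperplane.\<close>

lemma interior_coord_invariant:
  assumes "c \<in> A" "d \<in> A" "p \<in> fst c" "p \<in> fst d" "snd c p $ bdry_index > 0"
  shows "snd d p $ bdry_index > 0"
proof (rule ccontr)
  assume "\<not> snd d p $ bdry_index > 0"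
  with coord_in_half_space[OF assms(2,4)] have zero: "snd d p $ bdry_index = 0" by (simp add: half_space_def)
  let ?S = "snd c ` (fst d \<inter> fst c)"
  obtain O' where O': "open O'" "?S = half_space \<inter> O'"
    using openin_chart_image[OF assms(1) open_chart[OF assms(2)]] unfolding openin_open by blast
  define T where "T = ?S \<inter> {x. x $ bdry_index > 0}"
  have "T = O' \<inter> {x. x $ bdry_index > 0}" unfolding T_def O' by (auto simp: half_space_def)
  moreover have "open {x :: real ^ 'n. x $ bdry_index > 0}" by (intro open_Collect_less continuous_intros)
  ultimately have T: "open T" using O' by auto
  have inv: "chart_inv c x \<in> fst c \<inter> fst d \<and> snd c (chart_inv c x) = x" if "x \<in> T" for x
    using that chart_inv_coord[OF assms(1)] by (auto simp: T_def)
  have "open ((snd d \<circ> chart_inv c) ` T)"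
  proof (rule invariance_of_domain[OF _ T])
    show "continuous_on T (snd d \<circ> chart_inv c)"
      by (rule continuous_on_subset[OF smooth_on_imp_continuous_on[OF smooth_transition[OF assms(1,2)]]])
         (auto simp: T_def)
    show "inj_on (snd d \<circ> chart_inv c) T"
    proof (rule inj_onI)
      fix x y assume xy: "x \<in> T" "y \<in> T" "(snd d \<circ> chart_inv c) x = (snd d \<circ> chart_inv c) y"
      then have "chart_inv c x = chart_inv c y"
        using chart_inj[OF assms(2)] inv[OF xy(1)] inv[OF xy(2)] by (auto dest: inj_onD)
      then show "x = y" using inv[OF xy(1)] inv[OF xy(2)] by metis
    qed
  qed
  moreover have "snd d p \<in> (snd d \<circ> chart_inv c) ` T"
  proof
    show "snd d p = (snd d \<circ> chart_inv c) (snd c p)" using assms chart_inv_coord by simp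
    show "snd c p \<in> T" using assms by (auto simp: T_def)
  qed
  ultimately obtain e where e: "e > 0" "ball (snd d p) e \<subseteq> (snd d \<circ> chart_inv c) ` T"
    unfolding open_contains_ball by blast
  have "snd d p - (e / 2) *\<^sub>R axis bdry_index 1 \<in> ball (snd d p) e"
    using e by (simp add: dist_norm)
  with e(2) have "snd d p - (e / 2) *\<^sub>R axis bdry_index 1 \<in> (snd d \<circ> chart_inv c) ` T" by (rule subsetD)
  then have "snd d p - (e / 2) *\<^sub>R axis bdry_index 1 \<in> half_space"
    using inv coord_in_half_space[OF assms(2)] by (elim imageE) simp
  with zero e show False by (simp add: half_space_def)
qed

lemma mfd_bdry_iff:
  assumes "c \<in> A" "p \<in> fst c"
  shows "p \<in> mfd_bdry A \<longleftrightarrow> snd c p $ bdry_index = 0"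
proof
  assume "p \<in> mfd_bdry A"
  then obtain d where d: "d \<in> A" "p \<in> fst d" "snd d p $ bdry_index = 0" by (auto simp: mfd_bdry_def)
  with interior_coord_invariant[OF assms(1) d(1) assms(2) d(2)] coord_in_half_space[OF assms]
  show "snd c p $ bdry_index = 0" by (fastforce simp: half_space_def)
qed (use assms in \<open>auto simp: mfd_bdry_def\<close>)

lemma mfd_int_iff:
  assumes "c \<in> A" "p \<in> fst c"
  shows "p \<in> mfd_int A \<longleftrightarrow> snd c p $ bdry_index > 0"
  using mfd_bdry_iff[OF assms] coord_in_half_space[OF assms]
  by (auto simp: mfd_int_def half_space_def)

lemma open_mfd_int: "open (mfd_int A)"
proof (subst open_subopen, intro ballI)
  fix p assume p: "p \<in> mfd_int A"
  obtain c where c: "c \<in> A" "p \<in> fst c" using chart_exists by blast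
  have op: "open {x :: real ^ 'n. x $ bdry_index > 0}" by (intro open_Collect_less continuous_intros)
  have "open (fst c \<inter> snd c -` {x. x $ bdry_index > 0})"
    by (rule continuous_open_preimage[OF continuous_on_coord open_chart op]) (use c in auto)
  moreover have "fst c \<inter> snd c -` {x. x $ bdry_index > 0} \<subseteq> mfd_int A" using mfd_int_iff[OF c(1)] by auto
  moreover have "p \<in> fst c \<inter> snd c -` {x. x $ bdry_index > 0}" using mfd_int_iff[OF c] c p by auto
  ultimately show "\<exists>T. open T \<and> p \<in> T \<and> T \<subseteq> mfd_int A" by blast
qed

lemma mfd_int_meets_open:
  assumes "open V" "p \<in> V"
  shows "\<exists>q\<in>V. q \<in> mfd_int A \<and> q \<noteq> p"
proof -
  obtain c where c: "c \<in> A" "p \<in> fst c" using chart_exists by blast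
  obtain O' where O': "open O'" "snd c ` (V \<inter> fst c) = half_space \<inter> O'"
    using openin_chart_image[OF c(1) assms(1)] unfolding openin_open by blast
  have "snd c p \<in> O'" using O'(2) assms c by blast
  then obtain e where e: "e > 0" "ball (snd c p) e \<subseteq> O'" using O'(1) open_contains_ball by blast
  define x where "x = snd c p + (e / 2) *\<^sub>R axis bdry_index 1"
  have "x \<in> ball (snd c p) e" using e by (simp add: x_def dist_norm)
  moreover have x0: "x $ bdry_index > 0" "x \<noteq> snd c p" using coord_in_half_space[OF c] e
    by (auto simp: x_def half_space_def axis_def vec_eq_iff)
  ultimately have "x \<in> half_space \<inter> O'" using e(2) by (auto simp: half_space_def)
  then obtain q where "q \<in> V \<inter> fst c" "x = snd c q" using O'(2) by blast
  then show ?thesis using x0 mfd_int_iff[OF c(1)] by (intro bexI[of _ q]) auto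
qed

text \<open>The interior is dense, so identities between continuous data need only be checked there.\<close>

lemma eq_by_density:
  fixes f g :: "'a \<Rightarrow> 'b::t2_space"
  assumes "open U" "continuous_on U f" "continuous_on U g" "\<And>q. q \<in> U \<inter> mfd_int A \<Longrightarrow> f q = g q" "p \<in> U"
  shows "f p = g p"
proof (rule ccontr)
  assume "f p \<noteq> g p"
  from hausdorff[OF this] obtain B C where BC: "open B" "open C" "f p \<in> B" "g p \<in> C" "B \<inter> C = {}"
    by auto
  have "open ((U \<inter> f -` B) \<inter> (U \<inter> g -` C))"
    by (intro open_Int continuous_open_preimage assms BC)
  from mfd_int_meets_open[OF this, of p] obtain q where "q \<in> U" "f q \<in> B" "g q \<in> C" "q \<in> mfd_int A"
    using BC assms(5) by blast
  with assms(4)[of q] BC(5) show False by auto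
qed

lemma smooth_funD: "smooth_fun A V f \<Longrightarrow> c \<in> A \<Longrightarrow> smooth_in_chart c V f"
  unfolding smooth_fun_def by (rule bspec)

lemma wvfieldsI:
  assumes "\<And>c. c \<in> A \<Longrightarrow> smooth_in_chart c V (X c)"
    and "\<And>c d p. c \<in> A \<Longrightarrow> d \<in> A \<Longrightarrow> p \<in> V \<Longrightarrow> p \<in> fst c \<Longrightarrow> p \<in> fst d \<Longrightarrow>
      X d p = dens_factor w c d p *\<^sub>R jac c d p (X c p)"
  shows "X \<in> wvfields A w V"
  unfolding wvfields_def by (intro CollectI conjI ballI assms) (simp_all only: Int_iff)

lemma wvfieldsD:
  assumes "X \<in> wvfields A w V" "c \<in> A"
  shows "smooth_in_chart c V (X c)"
    and "d \<in> A \<Longrightarrow> p \<in> V \<Longrightarrow> p \<in> fst c \<Longrightarrow> p \<in> fst d \<Longrightarrow> X d p = dens_factor w c d p *\<^sub>R jac c d p (X c p)"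
  using assms unfolding wvfields_def mem_Collect_eq by (metis, metis IntI)

lemma vfields_change:
  assumes "X \<in> vfields A V" "c \<in> A" "d \<in> A" "p \<in> V" "p \<in> fst c" "p \<in> fst d"
  shows "X d p = jac c d p (X c p)"
  using wvfieldsD(2)[OF assms(1-6)] dens_factor_0[OF assms(2,3,5,6)] by simp

lemma vfields_eq_vf_in:
  assumes "X \<in> vfields A V" "c \<in> A"
  shows "sec_eq A (V \<inter> fst c) (vf_in c (X c)) X"
  using vfields_change[OF assms] by (auto simp: sec_eq_def vf_in_def)

lemma wvfields_subset: "X \<in> wvfields A w V \<Longrightarrow> V' \<subseteq> V \<Longrightarrow> X \<in> wvfields A w V'"
  by (rule wvfieldsI) (auto intro!: smooth_in_chart_subset[OF wvfieldsD(1)] wvfieldsD(2))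

lemma wvfields_cong:
  assumes "X \<in> wvfields A w V" "sec_eq A V X Y"
  shows "Y \<in> wvfields A w V"
proof -
  have eq: "X c p = Y c p" if "c \<in> A" "p \<in> V" "p \<in> fst c" for c p
    using assms(2) that by (auto simp: sec_eq_def)
  show ?thesis
  proof (rule wvfieldsI)
    fix c assume c: "c \<in> A"
    show "smooth_in_chart c V (Y c)"
      by (rule smooth_in_chart_cong'[OF _ wvfieldsD(1)[OF assms(1) c] c]) (use eq c in auto)
  next
    fix c d p assume *: "c \<in> A" "d \<in> A" "p \<in> V" "p \<in> fst c" "p \<in> fst d"
    show "Y d p = dens_factor w c d p *\<^sub>R jac c d p (Y c p)"
      using wvfieldsD(2)[OF assms(1) *] eq[OF *(1,3,4)] eq[OF *(2,3,5)] by simp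
  qed
qed

lemma wvfields_add:
  assumes "X \<in> wvfields A w V" "Y \<in> wvfields A w V"
  shows "(\<lambda>c p. X c p + Y c p) \<in> wvfields A w V"
proof (rule wvfieldsI)
  fix c d p assume *: "c \<in> A" "d \<in> A" "p \<in> V" "p \<in> fst c" "p \<in> fst d"
  show "X d p + Y d p = dens_factor w c d p *\<^sub>R jac c d p (X c p + Y c p)"
    by (simp add: wvfieldsD(2)[OF assms(1) *] wvfieldsD(2)[OF assms(2) *]
        linear_add[OF jac_linear[OF *(1,2,4,5)]] scaleR_add_right)
qed (intro smooth_in_chart_add wvfieldsD(1)[OF assms(1)] wvfieldsD(1)[OF assms(2)])

lemma wvfields_scaleR:
  assumes "smooth_fun A V f" "X \<in> wvfields A w V"
  shows "(\<lambda>c p. f p *\<^sub>R X c p) \<in> wvfields A w V"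
proof (rule wvfieldsI)
  fix c d p assume *: "c \<in> A" "d \<in> A" "p \<in> V" "p \<in> fst c" "p \<in> fst d"
  show "f p *\<^sub>R X d p = dens_factor w c d p *\<^sub>R jac c d p (f p *\<^sub>R X c p)"
    by (simp add: wvfieldsD(2)[OF assms(2) *] linear_scale[OF jac_linear[OF *(1,2,4,5)]])
qed (intro smooth_in_chart_scaleR wvfieldsD(1)[OF assms(2)] smooth_funD[OF assms(1)])

lemma vfields_sum:
  assumes "\<And>i. i \<in> I \<Longrightarrow> smooth_fun A V (f i)" "\<And>i. i \<in> I \<Longrightarrow> X i \<in> vfields A V" "finite I"
  shows "(\<lambda>c p. \<Sum>i\<in>I. f i p *\<^sub>R X i c p) \<in> vfields A V"
  using assms(3,1,2)
proof (induction I)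
  case empty
  then show ?case
    by (intro wvfieldsI) (simp_all add: smooth_in_chart_const linear_0[OF jac_linear])
next
  case (insert i I)
  have "(\<lambda>c p. f i p *\<^sub>R X i c p + (\<Sum>i\<in>I. f i p *\<^sub>R X i c p)) \<in> vfields A V"
    using insert by (intro wvfields_add wvfields_scaleR) auto
  with insert.hyps show ?case by simp
qed

text \<open>Coordinate expressions in one chart define vector fields over its domain; the transformation law is
  the cocycle identity of the Jacobians.\<close>

lemma vf_in_vfields:
  assumes "c \<in> A" "open V" "V \<subseteq> fst c" "smooth_in_chart c V F"
  shows "vf_in c F \<in> vfields A V"
proof (rule wvfieldsI)
  fix d assume d: "d \<in> A"
  have "smooth_in_chart c (V \<inter> fst d) (\<lambda>p. jac c d p (F p))"
    by (rule smooth_in_chart_jac[OF assms(1) d])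
       (auto intro: smooth_in_chart_subset[OF assms(4)] open_Int[OF assms(2) open_chart[OF d]])
  then show "smooth_in_chart d V (vf_in c F d)" unfolding vf_in_def
    by (rule smooth_in_chart_change'[OF assms(1) d]) (use assms(3) in auto)
next
  fix d e p assume *: "d \<in> A" "e \<in> A" "p \<in> V" "p \<in> fst d" "p \<in> fst e"
  then have "p \<in> fst c" using assms(3) by auto
  with * show "vf_in c F e p = dens_factor 0 d e p *\<^sub>R jac d e p (vf_in c F d p)"
    using dens_factor_0[OF *(1,2,4,5)] jac_cocycle[OF assms(1) *(1,2) _ *(4,5)] by (simp add: vf_in_def)
qed

lemma vf_in_self: "c \<in> A \<Longrightarrow> p \<in> fst c \<Longrightarrow> vf_in c F c p = F p"
  by (simp add: vf_in_def jac_self)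

lemma deriv_along_eq:
  assumes "X \<in> vfields A V" "open V" "smooth_fun A V f" "c \<in> A" "p \<in> V" "p \<in> fst c"
  shows "deriv_along A X f p = chart_deriv c f p (X c p)"
proof -
  define d where "d = (SOME d. d \<in> A \<and> p \<in> fst d)"
  have d: "d \<in> A" "p \<in> fst d" using someI[of "\<lambda>d. d \<in> A \<and> p \<in> fst d" c] assms unfolding d_def by auto
  have "deriv_along A X f p = chart_deriv d f p (X d p)" by (simp add: deriv_along_def d_def Let_def)
  also have "\<dots> = chart_deriv c f p (X c p)"
    using chart_deriv_change[OF assms(4) d(1) assms(2) smooth_funD[OF assms(3) d(1)] assms(5,6) d(2)]
      vfields_change[OF assms(1,4) d(1) assms(5,6) d(2)] by simp
  finally show ?thesis .
qed


section \<open>The boundary coordinate of a chart as defining function\<close>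

definition rho :: "('a, 'n) chart \<Rightarrow> 'a \<Rightarrow> real" where
  "rho c p = snd c p $ bdry_index"

lemma smooth_in_chart_rho: "c \<in> A \<Longrightarrow> smooth_in_chart c V (rho c)"
  unfolding rho_def[abs_def]
  by (rule smooth_in_chart_subset[OF smooth_in_chart_component[OF smooth_in_chart_coord[of c c "fst c"]]]) auto

lemma smooth_fun_rho: "c \<in> A \<Longrightarrow> V \<subseteq> fst c \<Longrightarrow> smooth_fun A V (rho c)"
  by (rule smooth_fun_in_one_chart[OF _ _ smooth_in_chart_rho])

lemma chart_deriv_rho: "c \<in> A \<Longrightarrow> d \<in> A \<Longrightarrow> p \<in> fst c \<Longrightarrow> p \<in> fst d \<Longrightarrow>
    chart_deriv d (rho c) p v = jac d c p v $ bdry_index"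
  unfolding rho_def[abs_def] jac_def
  by (subst chart_deriv_component[OF _ open_chart smooth_in_chart_coord, of d c c]) auto

lemma local_defining_function_rho:
  assumes c: "c \<in> A"
  shows "local_defining_function A (fst c) (rho c)"
  unfolding local_defining_function_def
proof (intro conjI ballI)
  show "open (fst c)" using c by (rule open_chart)
  show "smooth_fun A (fst c) (rho c)" using c by (rule smooth_fun_rho) simp
  show "{p \<in> fst c. rho c p = 0} = fst c \<inter> mfd_bdry A"
    using mfd_bdry_iff[OF c] by (auto simp: rho_def)
  fix d p assume d: "d \<in> A" and p: "p \<in> fst c \<inter> mfd_bdry A \<inter> fst d"
  have "chart_deriv d (rho c) p (jac c d p (axis bdry_index 1)) = 1"
    using chart_deriv_rho[OF c d] jac_inverse[OF c d] p by (auto simp: axis_def)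
  then show "chart_deriv d (rho c) p \<noteq> (\<lambda>v. 0)" by auto
qed

lemma deriv_along_rho:
  assumes "c \<in> A" "open V" "V \<subseteq> fst c" "X \<in> vfields A V" "p \<in> V"
  shows "deriv_along A X (rho c) p = X c p $ bdry_index"
  using deriv_along_eq[OF assms(4,2) smooth_fun_rho[OF assms(1,3)] assms(1,5)] assms(1,3,5)
    chart_deriv_rho[OF assms(1,1), of p] jac_self[OF assms(1)] by auto

lemma chart_deriv_tangential:
  fixes F :: "'a \<Rightarrow> 'b::real_normed_vector"
  assumes "c \<in> A" "open V" "smooth_in_chart c V F" "\<And>q. q \<in> V \<inter> mfd_bdry A \<inter> fst c \<Longrightarrow> F q = 0"
    "p \<in> V" "p \<in> mfd_bdry A" "p \<in> fst c" "v $ bdry_index = 0"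
  shows "chart_deriv c F p v = 0"
  unfolding chart_deriv_eq_hderiv[OF assms(1,7)]
proof (rule hderiv_tangential_zero[OF openin_chart_image[OF assms(1,2)] _ _ _ _ assms(8)])
  show "smooth_on (snd c ` (V \<inter> fst c)) (F \<circ> chart_inv c)" using assms(3) by (simp add: smooth_in_chart_def)
  fix y assume "y \<in> snd c ` (V \<inter> fst c)" "y $ bdry_index = 0"
  then show "(F \<circ> chart_inv c) y = 0"
    using assms(4) mfd_bdry_iff[OF assms(1)] chart_inv_coord[OF assms(1)] by auto
qed (use assms(5-7) mfd_bdry_iff[OF assms(1)] in auto)

text \<open>In every other chart the boundary coordinate vanishes along the boundary, hence so does its
  derivative along a coordinate field of \<open>c\<close> that is tangent to the boundary.\<close>

lemma tangential_coordinate_field: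
  assumes c: "c \<in> A" and k: "k \<noteq> bdry_index"
  shows "vf_in c (\<lambda>_. axis k 1) \<in> b_wvfields A 0 (fst c)"
  unfolding b_wvfields_def
proof (intro CollectI conjI ballI)
  show "vf_in c (\<lambda>_. axis k 1) \<in> vfields A (fst c)"
    by (intro vf_in_vfields c open_chart smooth_in_chart_const) auto
  fix d p assume d: "d \<in> A" and p: "p \<in> fst c \<inter> mfd_bdry A \<inter> fst d"
  have "chart_deriv c (rho d) p (axis k 1) = 0"
  proof (rule chart_deriv_tangential[OF c open_chart[OF d]])
    show "smooth_in_chart c (fst d) (rho d)"
      using smooth_fun_rho[OF d order_refl] c by (simp add: smooth_fun_def)
    show "rho d q = 0" if "q \<in> fst d \<inter> mfd_bdry A \<inter> fst c" for q
      using that mfd_bdry_iff[OF d, of q] by (simp add: rho_def)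
    show "(axis k 1 :: real ^ 'n) $ bdry_index = 0" using k by (simp add: axis_def)
  qed (use p in auto)
  then show "vf_in c (\<lambda>_. axis k 1) d p $ bdry_index = 0"
    using chart_deriv_rho[OF d c] p by (simp add: vf_in_def)
qed

end


section \<open>Boundary limits from logarithmic derivatives\<close>

text \<open>The hypothesis on the derivative says that \<open>d ln \<bar>f / x\<^sub>0\<bar> = - \<Sum> \<tau>\<^sub>i dx\<^sub>i\<close> with \<open>\<tau>\<^sub>i\<close> continuous, hence
  bounded, up to the boundary. So the logarithm is Lipschitz on a half ball and has a finite
  limit at the center, and the quotient has a nonzero limit. This applies to \<open>\<sigma>\<close> below.\<close>

lemma logarithmic_boundary_limit:
  fixes f :: "real ^ 'n::finite \<Rightarrow> real" and \<tau> :: "'n \<Rightarrow> real ^ 'n \<Rightarrow> real"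
  assumes S: "openin (top_of_set half_space) S" "x \<in> S" "x $ bdry_index = 0"
    and \<tau>: "\<And>i. continuous_on S (\<tau> i)"
    and nz: "\<And>y. y \<in> S \<Longrightarrow> y $ bdry_index > 0 \<Longrightarrow> f y \<noteq> 0"
    and der: "\<And>y. y \<in> S \<Longrightarrow> y $ bdry_index > 0 \<Longrightarrow>
      (f has_derivative (\<lambda>v. f y * (v $ bdry_index / y $ bdry_index - (\<Sum>i\<in>UNIV. v $ i * \<tau> i y))))
        (at y within half_space)"
  shows "\<exists>L. L \<noteq> 0 \<and> ((\<lambda>y. f y / y $ bdry_index) \<longlongrightarrow> L) (at x within {y. y $ bdry_index > 0})"
proof -
  obtain O' where O': "open O'" "S = half_space \<inter> O'" using S(1) unfolding openin_open by auto
  have "x \<in> O'" using O' S(2) by simp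
  then obtain r where r: "r > 0" "cball x r \<subseteq> O'" using O'(1) open_contains_cball by metis
  define P :: "(real ^ 'n) set" where "P = {y. y $ bdry_index > 0}"
  define W where "W = ball x r \<inter> P"
  have WS: "W \<subseteq> S" "W \<subseteq> half_space" using r O' by (auto simp: W_def P_def half_space_def)
  have W_pos: "y $ bdry_index > 0" if "y \<in> W" for y using that by (simp add: W_def P_def)
  have "convex P" unfolding P_def convex_def
    by (auto simp: add_nonneg_pos add_pos_nonneg le_less)
  then have W_convex: "convex W" unfolding W_def by (intro convex_Int convex_ball)
  define Q where "Q = (\<lambda>y. f y / y $ bdry_index)"
  have Q_der: "(Q has_derivative (\<lambda>v. - Q y * (\<Sum>i\<in>UNIV. v $ i * \<tau> i y))) (at y within W)" if y: "y \<in> W" for y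
  proof -
    have "(f has_derivative (\<lambda>v. f y * (v $ bdry_index / y $ bdry_index - (\<Sum>i\<in>UNIV. v $ i * \<tau> i y)))) (at y within W)"
      using der[of y] W_pos[OF y] y WS by (auto intro: has_derivative_subset)
    moreover have "((\<lambda>y. y $ bdry_index) has_derivative (\<lambda>v. v $ bdry_index)) (at y within W)"
      by (intro bounded_linear_imp_has_derivative bounded_linear_vec_nth)
    ultimately have "(Q has_derivative (\<lambda>v. - f y * (inverse (y $ bdry_index) * v $ bdry_index * inverse (y $ bdry_index))
       + f y * (v $ bdry_index / y $ bdry_index - (\<Sum>i\<in>UNIV. v $ i * \<tau> i y)) / y $ bdry_index)) (at y within W)"
      unfolding Q_def using W_pos[OF y] by (intro has_derivative_divide) auto
    then show ?thesis
      by (rule has_derivative_eq_rhs) (use W_pos[OF y] in \<open>simp add: fun_eq_iff Q_def field_simps\<close>)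
  qed
  have Q_nz: "Q y \<noteq> 0" if "y \<in> W" for y
    using nz[of y] W_pos[OF that] WS that by (auto simp: Q_def)
  \<comment> \<open>On the convex set \<open>W\<close> the quotient has a constant sign \<open>s\<close>, so that the logarithm makes sense.\<close>
  have "connected (Q ` W)"
    using Q_der by (intro connected_continuous_image has_derivative_continuous_on[of W Q] convex_connected[OF W_convex])
  then obtain s where s: "s = 1 \<or> s = -1" "\<And>y. y \<in> W \<Longrightarrow> s * Q y > 0"
  proof (cases "\<exists>y\<in>W. Q y < 0")
    case True
    then have "Q y < 0" if "y \<in> W" for y
      using connectedD_interval[OF \<open>connected (Q ` W)\<close>, of _ "Q y" 0] Q_nz that
      by (metis imageE image_eqI less_eq_real_def not_less)
    then show ?thesis using that[of "-1"] by simp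
  next
    case False
    then show ?thesis using that[of 1] Q_nz by (metis linorder_neqE_linordered_idom mult_1)
  qed
  have g_der: "((\<lambda>y. ln (s * Q y)) has_derivative (\<lambda>v. - (\<Sum>i\<in>UNIV. v $ i * \<tau> i y))) (at y within W)" if y: "y \<in> W" for y
  proof -
    have "((\<lambda>y. s * Q y) has_derivative (\<lambda>v. s * (- Q y * (\<Sum>i\<in>UNIV. v $ i * \<tau> i y)))) (at y within W)"
      by (rule has_derivative_mult_right[OF Q_der[OF y]])
    from has_derivative_ln[OF s(2)[OF y] this] show ?thesis
      by (rule has_derivative_eq_rhs) (use s Q_nz[OF y] in \<open>auto simp: fun_eq_iff field_simps\<close>)
  qed
  have "compact (cball x r \<inter> half_space)"
    unfolding half_space_def by (intro compact_Int_closed closed_Collect_le continuous_intros) auto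
  moreover have "cball x r \<inter> half_space \<subseteq> S" using r O' by auto
  then have "continuous_on (cball x r \<inter> half_space) (\<lambda>y. \<Sum>i\<in>UNIV. \<bar>\<tau> i y\<bar>)"
    using \<tau> by (intro continuous_intros) (rule continuous_on_subset)
  ultimately have "compact ((\<lambda>y. \<Sum>i\<in>UNIV. \<bar>\<tau> i y\<bar>) ` (cball x r \<inter> half_space))"
    by (rule compact_continuous_image[rotated])
  then obtain K where "\<forall>y\<in>cball x r \<inter> half_space. \<bar>\<Sum>i\<in>UNIV. \<bar>\<tau> i y\<bar>\<bar> \<le> K"
    by (auto dest!: compact_imp_bounded simp: bounded_real)
  then have K: "(\<Sum>i\<in>UNIV. \<bar>\<tau> i y\<bar>) \<le> K" if "y \<in> W" for y
    using that WS by (force simp: W_def)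
  have K0: "0 \<le> \<bar>K\<bar>" by simp
  have lip: "norm (ln (s * Q y) - ln (s * Q z)) \<le> \<bar>K\<bar> * norm (y - z)" if "y \<in> W" "z \<in> W" for y z
  proof (rule differentiable_bound[OF W_convex g_der _ that])
    fix y assume y: "y \<in> W"
    show "onorm (\<lambda>v. - (\<Sum>i\<in>UNIV. v $ i * \<tau> i y)) \<le> \<bar>K\<bar>"
    proof (rule onorm_bound[OF K0])
      fix v :: "real ^ 'n"
      have "norm (- (\<Sum>i\<in>UNIV. v $ i * \<tau> i y)) \<le> (\<Sum>i\<in>UNIV. \<bar>v $ i\<bar> * \<bar>\<tau> i y\<bar>)"
        using sum_abs[of "\<lambda>i. v $ i * \<tau> i y" UNIV] by (simp add: abs_mult)
      also have "\<dots> \<le> (\<Sum>i\<in>UNIV. norm v * \<bar>\<tau> i y\<bar>)"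
        by (intro sum_mono mult_right_mono) (use component_le_norm_cart in auto)
      also have "\<dots> = norm v * (\<Sum>i\<in>UNIV. \<bar>\<tau> i y\<bar>)" by (simp add: sum_distrib_left)
      also have "\<dots> \<le> norm v * \<bar>K\<bar>" using K[OF y] by (intro mult_left_mono) auto
      finally show "norm (- (\<Sum>i\<in>UNIV. v $ i * \<tau> i y)) \<le> \<bar>K\<bar> * norm v" by (simp add: mult.commute)
    qed
  qed auto
  have "uniformly_continuous_on W (\<lambda>y. ln (s * Q y))"
    by (rule lipschitz_on_uniformly_continuous[of "\<bar>K\<bar>"], rule lipschitz_onI) (use lip in \<open>auto simp: dist_norm\<close>)
  moreover have "x \<in> closure W"
  proof (unfold closure_approachable, intro allI impI)
    fix e :: real assume e: "e > 0"
    let ?y = "x + (min e r / 2) *\<^sub>R axis bdry_index 1"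
    have "dist ?y x = min e r / 2" using e r by (simp add: dist_norm)
    moreover have "?y $ bdry_index > 0" using S(3) e r by simp
    ultimately show "\<exists>y\<in>W. dist y x < e" using e r
      by (intro bexI[of _ ?y]) (auto simp: W_def P_def dist_commute)
  qed
  ultimately obtain l where "((\<lambda>y. ln (s * Q y)) \<longlongrightarrow> l) (at x within W)"
    by (rule uniformly_continuous_on_extension_at_closure)
  then have "((\<lambda>y. s * exp (ln (s * Q y))) \<longlongrightarrow> s * exp l) (at x within W)"
    by (intro tendsto_intros)
  moreover have "\<forall>\<^sub>F y in at x within W. s * exp (ln (s * Q y)) = Q y"
    using s by (auto simp: eventually_at_filter)
  ultimately have lim: "(Q \<longlongrightarrow> s * exp l) (at x within W)" by (rule Lim_transform_eventually)
  have "at x within W = at x within P"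
    by (rule at_within_nhd[of x "ball x r"]) (use r in \<open>auto simp: W_def\<close>)
  with lim s(1) show ?thesis unfolding Q_def P_def by (intro exI[of _ "s * exp l"]) auto
qed


section \<open>Connections in a chart\<close>

locale precompact_connection = manifold_with_boundary A
  for A :: "('a::{t2_space,second_countable_topology}, 'n::finite) chart set" +
  fixes D :: "('a, 'n) conn"
  assumes connection: "linear_connection A (mfd_int A) (vfields A) D"
    and precompact: "proj_precompact A D"
    and special: "special A (mfd_int A) D"
begin

lemmas D_axioms = connection[unfolded linear_connection_def, rule_format, OF conjI]

lemma D_vfields:
  "open V \<Longrightarrow> V \<subseteq> mfd_int A \<Longrightarrow> \<xi> \<in> vfields A V \<Longrightarrow> s \<in> vfields A V \<Longrightarrow> D \<xi> s \<in> vfields A V"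
  by (rule D_axioms[THEN conjunct1, rule_format])

lemma D_cong:
  "open V \<Longrightarrow> V \<subseteq> mfd_int A \<Longrightarrow> \<xi> \<in> vfields A V \<Longrightarrow> \<xi>' \<in> vfields A V \<Longrightarrow> s \<in> vfields A V \<Longrightarrow>
    s' \<in> vfields A V \<Longrightarrow> sec_eq A V \<xi> \<xi>' \<Longrightarrow> sec_eq A V s s' \<Longrightarrow> sec_eq A V (D \<xi> s) (D \<xi>' s')"
  by (rule D_axioms[THEN conjunct2, THEN conjunct1, rule_format, OF _ _ _ _ _ _ conjI])

lemma D_add_left:
  "open V \<Longrightarrow> V \<subseteq> mfd_int A \<Longrightarrow> \<xi> \<in> vfields A V \<Longrightarrow> \<xi>' \<in> vfields A V \<Longrightarrow> s \<in> vfields A V \<Longrightarrow>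
    sec_eq A V (D (\<lambda>c p. \<xi> c p + \<xi>' c p) s) (\<lambda>c p. D \<xi> s c p + D \<xi>' s c p)"
  by (rule D_axioms[THEN conjunct2, THEN conjunct2, THEN conjunct1, rule_format])

lemma D_scale_left:
  "open V \<Longrightarrow> V \<subseteq> mfd_int A \<Longrightarrow> smooth_fun A V f \<Longrightarrow> \<xi> \<in> vfields A V \<Longrightarrow> s \<in> vfields A V \<Longrightarrow>
    sec_eq A V (D (\<lambda>c p. f p *\<^sub>R \<xi> c p) s) (\<lambda>c p. f p *\<^sub>R D \<xi> s c p)"
  by (rule D_axioms[THEN conjunct2, THEN conjunct2, THEN conjunct2, THEN conjunct1, rule_format])

lemma D_add_right:
  "open V \<Longrightarrow> V \<subseteq> mfd_int A \<Longrightarrow> \<xi> \<in> vfields A V \<Longrightarrow> s \<in> vfields A V \<Longrightarrow> s' \<in> vfields A V \<Longrightarrow>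
    sec_eq A V (D \<xi> (\<lambda>c p. s c p + s' c p)) (\<lambda>c p. D \<xi> s c p + D \<xi> s' c p)"
  by (rule D_axioms[THEN conjunct2, THEN conjunct2, THEN conjunct2, THEN conjunct2, THEN conjunct1, rule_format])

lemma D_leibniz:
  "open V \<Longrightarrow> V \<subseteq> mfd_int A \<Longrightarrow> smooth_fun A V f \<Longrightarrow> \<xi> \<in> vfields A V \<Longrightarrow> s \<in> vfields A V \<Longrightarrow>
    sec_eq A V (D \<xi> (\<lambda>c p. f p *\<^sub>R s c p)) (\<lambda>c p. deriv_along A \<xi> f p *\<^sub>R s c p + f p *\<^sub>R D \<xi> s c p)"
  by (rule D_axioms[THEN conjunct2, THEN conjunct2, THEN conjunct2, THEN conjunct2, THEN conjunct2, rule_format])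

lemma D_sum_left:
  assumes V: "open V" "V \<subseteq> mfd_int A" and s: "s \<in> vfields A V" and "finite I"
    and "\<And>i. i \<in> I \<Longrightarrow> smooth_fun A V (f i)" "\<And>i. i \<in> I \<Longrightarrow> X i \<in> vfields A V"
  shows "sec_eq A V (D (\<lambda>c p. \<Sum>i\<in>I. f i p *\<^sub>R X i c p) s) (\<lambda>c p. \<Sum>i\<in>I. f i p *\<^sub>R D (X i) s c p)"
  using assms(4-)
proof (induction I)
  case empty
  show ?case using D_scale_left[OF V smooth_fun_const[of A V 0] s s] by simp
next
  case (insert i I)
  have vf: "(\<lambda>c p. f i p *\<^sub>R X i c p) \<in> vfields A V" "(\<lambda>c p. \<Sum>i\<in>I. f i p *\<^sub>R X i c p) \<in> vfields A V"
    using insert by (auto intro!: wvfields_scaleR vfields_sum)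
  have 1: "sec_eq A V (D (\<lambda>c p. f i p *\<^sub>R X i c p + (\<Sum>i\<in>I. f i p *\<^sub>R X i c p)) s)
      (\<lambda>c p. D (\<lambda>c p. f i p *\<^sub>R X i c p) s c p + D (\<lambda>c p. \<Sum>i\<in>I. f i p *\<^sub>R X i c p) s c p)"
    by (rule D_add_left[OF V vf s])
  have 2: "sec_eq A V (D (\<lambda>c p. f i p *\<^sub>R X i c p) s) (\<lambda>c p. f i p *\<^sub>R D (X i) s c p)"
    using insert by (intro D_scale_left[OF V _ _ s]) auto
  have 3: "sec_eq A V (D (\<lambda>c p. \<Sum>i\<in>I. f i p *\<^sub>R X i c p) s) (\<lambda>c p. \<Sum>i\<in>I. f i p *\<^sub>R D (X i) s c p)"
    using insert by simp
  show ?case using insert.hyps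
    by (intro sec_eqI) (simp add: sec_eqD[OF 1] sec_eqD[OF 2] sec_eqD[OF 3])
qed

lemma D_sum_right:
  assumes V: "open V" "V \<subseteq> mfd_int A" and \<xi>: "\<xi> \<in> vfields A V" and "finite I"
    and "\<And>i. i \<in> I \<Longrightarrow> smooth_fun A V (f i)" "\<And>i. i \<in> I \<Longrightarrow> X i \<in> vfields A V"
  shows "sec_eq A V (D \<xi> (\<lambda>c p. \<Sum>i\<in>I. f i p *\<^sub>R X i c p))
    (\<lambda>c p. \<Sum>i\<in>I. deriv_along A \<xi> (f i) p *\<^sub>R X i c p + f i p *\<^sub>R D \<xi> (X i) c p)"
  using assms(4-)
proof (induction I)
  case empty
  have "sec_eq A V (D \<xi> (\<lambda>c p. 0 *\<^sub>R \<xi> c p)) (\<lambda>c p. deriv_along A \<xi> (\<lambda>p. 0) p *\<^sub>R \<xi> c p + 0 *\<^sub>R D \<xi> \<xi> c p)"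
    by (rule D_leibniz[OF V smooth_fun_const \<xi> \<xi>])
  moreover have "deriv_along A \<xi> (\<lambda>p. 0) p = 0" if "c \<in> A" "p \<in> V" "p \<in> fst c" for c p
    using deriv_along_eq[OF \<xi> V(1) smooth_fun_const that, of 0] chart_deriv_const[OF that(1,3), of "0 :: real"]
    by simp
  ultimately show ?case by (intro sec_eqI) (auto dest: sec_eqD)
next
  case (insert i I)
  have vf: "(\<lambda>c p. f i p *\<^sub>R X i c p) \<in> vfields A V" "(\<lambda>c p. \<Sum>i\<in>I. f i p *\<^sub>R X i c p) \<in> vfields A V"
    using insert by (auto intro!: wvfields_scaleR vfields_sum)
  have 1: "sec_eq A V (D \<xi> (\<lambda>c p. f i p *\<^sub>R X i c p + (\<Sum>i\<in>I. f i p *\<^sub>R X i c p)))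
      (\<lambda>c p. D \<xi> (\<lambda>c p. f i p *\<^sub>R X i c p) c p + D \<xi> (\<lambda>c p. \<Sum>i\<in>I. f i p *\<^sub>R X i c p) c p)"
    by (rule D_add_right[OF V \<xi> vf])
  have 2: "sec_eq A V (D \<xi> (\<lambda>c p. f i p *\<^sub>R X i c p))
      (\<lambda>c p. deriv_along A \<xi> (f i) p *\<^sub>R X i c p + f i p *\<^sub>R D \<xi> (X i) c p)"
    using insert by (intro D_leibniz[OF V _ \<xi>]) auto
  have 3: "sec_eq A V (D \<xi> (\<lambda>c p. \<Sum>i\<in>I. f i p *\<^sub>R X i c p))
      (\<lambda>c p. \<Sum>i\<in>I. deriv_along A \<xi> (f i) p *\<^sub>R X i c p + f i p *\<^sub>R D \<xi> (X i) c p)"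
    using insert by simp
  show ?case using insert.hyps
    by (intro sec_eqI) (simp add: sec_eqD[OF 1] sec_eqD[OF 2] sec_eqD[OF 3])
qed

definition frame :: "('a, 'n) chart \<Rightarrow> 'n \<Rightarrow> ('a, 'n) vfield" where
  "frame c i = vf_in c (\<lambda>_. axis i 1)"

text \<open>The Christoffel symbols \<open>\<Gamma>\<^sub>i\<^sub>k\<close> of \<open>D\<close> in the chart \<open>c\<close>, as vectors in the upper index.\<close>

definition christoffel :: "('a, 'n) chart \<Rightarrow> 'n \<Rightarrow> 'n \<Rightarrow> 'a \<Rightarrow> real ^ 'n" where
  "christoffel c i k p = D (frame c i) (frame c k) c p"

definition christoffel_trace :: "('a, 'n) chart \<Rightarrow> 'n \<Rightarrow> 'a \<Rightarrow> real" where
  "christoffel_trace c i p = (\<Sum>k\<in>UNIV. christoffel c i k p $ k)"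

lemma frame_vfields: "c \<in> A \<Longrightarrow> open V \<Longrightarrow> V \<subseteq> fst c \<Longrightarrow> frame c i \<in> vfields A V"
  unfolding frame_def by (intro vf_in_vfields smooth_in_chart_const)

lemma frame_self: "c \<in> A \<Longrightarrow> p \<in> fst c \<Longrightarrow> frame c i c p = axis i 1"
  by (simp add: frame_def vf_in_self)

lemma vf_in_frame_expansion:
  assumes "c \<in> A" "V \<subseteq> fst c"
  shows "sec_eq A V (vf_in c F) (\<lambda>d p. \<Sum>k\<in>UNIV. F p $ k *\<^sub>R frame c k d p)"
proof (rule sec_eqI)
  fix d p assume "d \<in> A" "p \<in> V" "p \<in> fst d"
  then show "vf_in c F d p = (\<Sum>k\<in>UNIV. F p $ k *\<^sub>R frame c k d p)"
    using linear_axis_sum[OF jac_linear[OF assms(1), of d p], of "F p"] assms(2)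
    by (auto simp: vf_in_def frame_def)
qed

lemma vfields_frame_expansion:
  assumes "c \<in> A" "V \<subseteq> fst c" "\<xi> \<in> vfields A V"
  shows "sec_eq A V \<xi> (\<lambda>d p. \<Sum>k\<in>UNIV. \<xi> c p $ k *\<^sub>R frame c k d p)"
proof (rule sec_eqI)
  fix d p assume *: "d \<in> A" "p \<in> V" "p \<in> fst d"
  then have "p \<in> V \<inter> fst c" using assms(2) by auto
  from sec_eqD[OF vfields_eq_vf_in[OF assms(3,1)] *(1) this *(3)]
    sec_eqD[OF vf_in_frame_expansion[OF assms(1,2)] *, of "\<xi> c"]
  show "\<xi> d p = (\<Sum>k\<in>UNIV. \<xi> c p $ k *\<^sub>R frame c k d p)" by simp
qed

lemma D_frame:
  assumes c: "c \<in> A" and V: "open V" "V \<subseteq> mfd_int A" "V \<subseteq> fst c" and \<xi>: "\<xi> \<in> vfields A V" and p: "p \<in> V"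
  shows "D \<xi> (frame c k) c p = (\<Sum>i\<in>UNIV. \<xi> c p $ i *\<^sub>R christoffel c i k p)"
proof -
  have pc: "p \<in> fst c" using p V by auto
  have sm: "smooth_fun A V (\<lambda>p. \<xi> c p $ i)" for i
    by (intro smooth_fun_in_one_chart[OF c V(3)] smooth_in_chart_component wvfieldsD(1)[OF \<xi> c])
  have fr: "frame c i \<in> vfields A V" for i by (rule frame_vfields[OF c V(1,3)])
  have 1: "sec_eq A V (D \<xi> (frame c k)) (D (\<lambda>d p. \<Sum>i\<in>UNIV. \<xi> c p $ i *\<^sub>R frame c i d p) (frame c k))"
    by (rule D_cong[OF V(1,2) \<xi> vfields_sum fr fr vfields_frame_expansion[OF c V(3) \<xi>]])
       (auto intro: sm fr simp: sec_eq_def)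
  have 2: "sec_eq A V (D (\<lambda>d p. \<Sum>i\<in>UNIV. \<xi> c p $ i *\<^sub>R frame c i d p) (frame c k))
      (\<lambda>d p. \<Sum>i\<in>UNIV. \<xi> c p $ i *\<^sub>R D (frame c i) (frame c k) d p)"
    by (rule D_sum_left[OF V(1,2) fr]) (auto intro: sm fr)
  show ?thesis by (simp add: christoffel_def sec_eqD[OF 1 c p pc] sec_eqD[OF 2 c p pc])
qed

text \<open>Locality and the Leibniz rule reduce \<open>D\<close> in a chart to its Christoffel symbols: \<open>\<xi>\<close> and the
  argument are expanded in the coordinate frame.\<close>

lemma D_vf_in:
  assumes c: "c \<in> A" and V: "open V" "V \<subseteq> mfd_int A" "V \<subseteq> fst c" and \<xi>: "\<xi> \<in> vfields A V"
    and F: "smooth_in_chart c V F" and p: "p \<in> V"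
  shows "D \<xi> (vf_in c F) c p = chart_deriv c F p (\<xi> c p) +
    (\<Sum>i\<in>UNIV. \<Sum>k\<in>UNIV. (\<xi> c p $ i * F p $ k) *\<^sub>R christoffel c i k p)"
proof -
  have pc: "p \<in> fst c" using p V by auto
  have sm: "smooth_fun A V (\<lambda>p. F p $ i)" for i
    by (intro smooth_fun_in_one_chart[OF c V(3)] smooth_in_chart_component F)
  have fr: "frame c i \<in> vfields A V" for i by (rule frame_vfields[OF c V(1,3)])
  have 1: "sec_eq A V (D \<xi> (vf_in c F)) (D \<xi> (\<lambda>d p. \<Sum>k\<in>UNIV. F p $ k *\<^sub>R frame c k d p))"
    by (rule D_cong[OF V(1,2) \<xi> \<xi> vf_in_vfields[OF c V(1,3) F] vfields_sum _ vf_in_frame_expansion[OF c V(3)]])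
       (auto intro: sm fr simp: sec_eq_def)
  have 2: "sec_eq A V (D \<xi> (\<lambda>d p. \<Sum>k\<in>UNIV. F p $ k *\<^sub>R frame c k d p))
     (\<lambda>d p. \<Sum>k\<in>UNIV. deriv_along A \<xi> (\<lambda>p. F p $ k) p *\<^sub>R frame c k d p + F p $ k *\<^sub>R D \<xi> (frame c k) d p)"
    by (rule D_sum_right[OF V(1,2) \<xi>]) (auto intro: sm fr)
  have 3: "deriv_along A \<xi> (\<lambda>p. F p $ k) p = chart_deriv c F p (\<xi> c p) $ k" for k
    using deriv_along_eq[OF \<xi> V(1) sm c p pc] chart_deriv_component[OF c V(1) F p pc] by simp
  have "D \<xi> (vf_in c F) c p = (\<Sum>k\<in>UNIV. chart_deriv c F p (\<xi> c p) $ k *\<^sub>R axis k 1) +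
      (\<Sum>k\<in>UNIV. F p $ k *\<^sub>R (\<Sum>i\<in>UNIV. \<xi> c p $ i *\<^sub>R christoffel c i k p))"
    by (simp add: sec_eqD[OF 1 c p pc] sec_eqD[OF 2 c p pc] 3 frame_self[OF c pc] D_frame[OF c V \<xi> p] sum.distrib)
  also have "(\<Sum>k\<in>UNIV. F p $ k *\<^sub>R (\<Sum>i\<in>UNIV. \<xi> c p $ i *\<^sub>R christoffel c i k p)) =
      (\<Sum>i\<in>UNIV. \<Sum>k\<in>UNIV. (\<xi> c p $ i * F p $ k) *\<^sub>R christoffel c i k p)"
    by (subst sum.swap) (simp add: scaleR_sum_right mult.commute)
  finally show ?thesis by (simp add: sum_axis)
qed

lemma conn_trace_eq:
  assumes c: "c \<in> A" and V: "open V" "V \<subseteq> mfd_int A" "V \<subseteq> fst c" and \<xi>: "\<xi> \<in> vfields A V" and p: "p \<in> V"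
  shows "conn_trace D \<xi> c p = (\<Sum>i\<in>UNIV. \<xi> c p $ i * christoffel_trace c i p)"
proof -
  have "conn_trace D \<xi> c p = (\<Sum>k\<in>UNIV. \<Sum>i\<in>UNIV. \<xi> c p $ i * christoffel c i k p $ k)"
    unfolding conn_trace_def frame_def[symmetric] D_frame[OF c V \<xi> p] by simp
  also have "\<dots> = (\<Sum>i\<in>UNIV. \<xi> c p $ i * christoffel_trace c i p)"
    by (subst sum.swap) (simp add: christoffel_trace_def sum_distrib_left)
  finally show ?thesis .
qed

text \<open>The Christoffel symbols of the connection on \<open>TM(-1)\<close>: the trace part is the contribution of \<open>\<E>(-1)\<close>.\<close>

definition weighted_christoffel :: "('a, 'n) chart \<Rightarrow> 'n \<Rightarrow> 'n \<Rightarrow> 'a \<Rightarrow> real ^ 'n" where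
  "weighted_christoffel c i k p = christoffel c i k p - (christoffel_trace c i p / (real CARD('n) + 1)) *\<^sub>R axis k 1"

lemma wvf_conn_eq:
  assumes c: "c \<in> A" and V: "open V" and \<xi>: "\<xi> \<in> vfields A V" and \<eta>: "smooth_in_chart c V (\<eta> c)"
    and p: "p \<in> V" "p \<in> mfd_int A" "p \<in> fst c"
  shows "wvf_conn (-1) D \<xi> \<eta> c p = chart_deriv c (\<eta> c) p (\<xi> c p) +
    (\<Sum>i\<in>UNIV. \<Sum>k\<in>UNIV. (\<xi> c p $ i * \<eta> c p $ k) *\<^sub>R weighted_christoffel c i k p)"
proof -
  let ?V = "V \<inter> mfd_int A \<inter> fst c" and ?N = "real CARD('n) + 1"
  have V': "open ?V" "?V \<subseteq> mfd_int A" "?V \<subseteq> fst c" using V open_mfd_int open_chart[OF c] by auto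
  have \<xi>': "\<xi> \<in> vfields A ?V" by (rule wvfields_subset[OF \<xi>]) auto
  have \<eta>': "smooth_in_chart c ?V (\<eta> c)" by (rule smooth_in_chart_subset[OF \<eta>]) auto
  have p': "p \<in> ?V" using p by simp
  have "(\<Sum>i\<in>UNIV. \<Sum>k\<in>UNIV. (\<xi> c p $ i * \<eta> c p $ k) *\<^sub>R ((christoffel_trace c i p / ?N) *\<^sub>R (axis k 1 :: real ^ 'n)))
     = (\<Sum>i\<in>UNIV. (\<xi> c p $ i * christoffel_trace c i p / ?N) *\<^sub>R (\<Sum>k\<in>UNIV. \<eta> c p $ k *\<^sub>R (axis k 1 :: real ^ 'n)))"
    by (simp add: scaleR_sum_right mult_ac)
  also have "\<dots> = (conn_trace D \<xi> c p / ?N) *\<^sub>R \<eta> c p"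
    by (simp add: sum_axis conn_trace_eq[OF c V' \<xi>' p'] scaleR_sum_left[symmetric] sum_divide_distrib)
  finally show ?thesis
    unfolding wvf_conn_def weighted_christoffel_def scaleR_diff_right sum_subtractf D_vf_in[OF c V' \<xi>' \<eta>' p']
    by (simp add: algebra_simps)
qed

text \<open>A parallel volume density \<open>\<nu>\<close> has the logarithmic derivative \<open>tr(\<nabla>\<^sub>\<xi>)\<close> in every chart. Hence
  \<open>u = \<bar>\<nu>\<bar> powr (- 1 / (N + 1))\<close>, a section of \<open>\<E>(1)\<close>, satisfies \<open>\<nabla>\<^sub>\<xi>(u\<eta>) = u \<nabla>\<^sub>\<xi>\<eta>\<close> chart by chart. Since
  \<open>u\<eta>\<close> is a vector field, so is the left-hand side, and dividing by \<open>u\<close> gives the weighted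
  transformation law. This replaces a computation with the derivative of the Jacobian determinant.\<close>

lemma wvf_conn_change:
  assumes V: "open V" and \<xi>: "\<xi> \<in> vfields A V" and \<eta>: "\<eta> \<in> wvfields A (-1) V"
    and cd: "c \<in> A" "d \<in> A" and p: "p \<in> V" "p \<in> mfd_int A" "p \<in> fst c" "p \<in> fst d"
  shows "wvf_conn (-1) D \<xi> \<eta> d p = dens_factor (-1) c d p *\<^sub>R jac c d p (wvf_conn (-1) D \<xi> \<eta> c p)"
proof -
  let ?N = "real CARD('n) + 1"
  obtain \<nu> where \<nu>: "\<nu> \<in> densities A (- ?N) (mfd_int A)" "nowhere_vanishing A (mfd_int A) \<nu>"
    "parallel A (mfd_int A) (- ?N) D \<nu>" using special unfolding special_def by auto
  \<comment> \<open>Squaring instead of taking the absolute value keeps \<open>u\<close> manifestly smooth, hence the factor \<open>2\<close>.\<close>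
  define b where "b = - 1 / (2 * ?N)"
  define u where "u = (\<lambda>c p. (\<nu> c p * \<nu> c p) powr b)"
  let ?V = "V \<inter> mfd_int A"
  have V': "open ?V" "?V \<subseteq> mfd_int A" using V open_mfd_int by auto
  have \<nu>_smooth: "smooth_in_chart e (mfd_int A) (\<nu> e)" if "e \<in> A" for e
    using \<nu>(1) that unfolding densities_def by simp
  have \<nu>_nz: "\<nu> e q \<noteq> 0" if "e \<in> A" "q \<in> mfd_int A" "q \<in> fst e" for e q
    using \<nu>(2) that unfolding nowhere_vanishing_def by simp
  have u_pos: "u e q > 0" if "e \<in> A" "q \<in> mfd_int A" "q \<in> fst e" for e q
    using \<nu>_nz[OF that] by (simp add: u_def)
  have u_smooth: "smooth_in_chart e ?V (u e)" if e: "e \<in> A" for e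
  proof -
    have "smooth_in_chart e ?V (\<lambda>q. \<nu> e q * \<nu> e q)"
      by (intro smooth_in_chart_mult smooth_in_chart_subset[OF \<nu>_smooth[OF e]]) auto
    moreover have "\<nu> e (chart_inv e x) * \<nu> e (chart_inv e x) > 0" if "x \<in> snd e ` (?V \<inter> fst e)" for x
      using that \<nu>_nz[OF e] chart_inv_coord[OF e] by (fastforce simp: zero_less_mult_iff linorder_neq_iff)
    ultimately show ?thesis unfolding u_def smooth_in_chart_def comp_def by (intro smooth_on_powr) auto
  qed
  have u_change: "dens_factor (-1) e e' q * u e' q = u e q"
    if "e \<in> A" "e' \<in> A" "q \<in> mfd_int A" "q \<in> fst e" "q \<in> fst e'" for e e' q
  proof -
    define J where "J = \<bar>det (matrix (jac e e' q))\<bar>"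
    have J: "J > 0" using det_jac_nonzero[OF that(1,2,4,5)] by (simp add: J_def)
    have "\<nu> e' q = dens_factor (- ?N) e e' q * \<nu> e q" using \<nu>(1) that unfolding densities_def by blast
    also have "dens_factor (- ?N) e e' q = J powr (-1)"
    proof -
      have "- ?N / ?N = -1" by (simp add: field_simps)
      then show ?thesis by (simp only: dens_factor_def J_def)
    qed
    finally have "u e' q = ((J powr (-1) * J powr (-1)) * (\<nu> e q * \<nu> e q)) powr b"
      by (simp add: u_def mult_ac)
    also have "J powr (-1) * J powr (-1) = J powr (-2)"
      unfolding powr_add[symmetric] by simp
    also have "(J powr (-2) * (\<nu> e q * \<nu> e q)) powr b = (J powr (-2)) powr b * u e q"
      unfolding u_def by (rule powr_mult)
    also have "(J powr (-2)) powr b = J powr (1 / ?N)" 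
    proof -
      have "-2 * b = 1 / ?N" by (simp add: b_def field_simps)
      then show ?thesis by (simp only: powr_powr)
    qed
    finally show ?thesis using J by (simp add: dens_factor_def J_def[symmetric] powr_add[symmetric] mult.assoc[symmetric])
  qed
  define X where "X = (\<lambda>c p. u c p *\<^sub>R \<eta> c p)"
  have X: "X \<in> vfields A ?V"
  proof (rule wvfieldsI)
    show "smooth_in_chart e ?V (X e)" if "e \<in> A" for e
      unfolding X_def using that
      by (intro smooth_in_chart_scaleR u_smooth smooth_in_chart_subset[OF wvfieldsD(1)[OF \<eta> that]]) auto
    fix e e' q assume *: "e \<in> A" "e' \<in> A" "q \<in> ?V" "q \<in> fst e" "q \<in> fst e'"
    then have q: "q \<in> V" "q \<in> mfd_int A" by auto
    have "X e' q = (dens_factor (-1) e e' q * u e' q) *\<^sub>R jac e e' q (\<eta> e q)"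
      by (simp add: X_def wvfieldsD(2)[OF \<eta> *(1,2) q(1) *(4,5)] mult.commute)
    then show "X e' q = dens_factor 0 e e' q *\<^sub>R jac e e' q (X e q)"
      unfolding u_change[OF *(1,2) q(2) *(4,5)] dens_factor_0[OF *(1,2,4,5)]
      by (simp add: X_def linear_scale[OF jac_linear[OF *(1,2,4,5)]])
  qed
  have \<xi>': "\<xi> \<in> vfields A ?V" by (rule wvfields_subset[OF \<xi>]) auto
  \<comment> \<open>Parallelism of \<open>u\<close>: its derivative cancels the trace term of the connection on \<open>TM(-1)\<close>.\<close>
  have key: "D \<xi> X e p = u e p *\<^sub>R wvf_conn (-1) D \<xi> \<eta> e p" if e: "e \<in> A" "p \<in> fst e" for e
  proof -
    let ?W = "?V \<inter> fst e"
    have W: "open ?W" "?W \<subseteq> mfd_int A" "?W \<subseteq> fst e" using V' open_chart[OF e(1)] by auto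
    have pW: "p \<in> ?W" using p e by simp
    have \<xi>W: "\<xi> \<in> vfields A ?W" by (rule wvfields_subset[OF \<xi>']) auto
    have XW: "X \<in> vfields A ?W" by (rule wvfields_subset[OF X]) auto
    have uW: "smooth_in_chart e ?W (u e)" by (rule smooth_in_chart_subset[OF u_smooth[OF e(1)]]) auto
    have \<eta>W: "smooth_in_chart e ?W (\<eta> e)" by (rule smooth_in_chart_subset[OF wvfieldsD(1)[OF \<eta> e(1)]]) auto
    have \<nu>W: "smooth_in_chart e ?W (\<nu> e)" by (rule smooth_in_chart_subset[OF \<nu>_smooth[OF e(1)]]) auto
    have \<nu>p: "\<nu> e p \<noteq> 0" using \<nu>_nz e p by simp
    have tr: "chart_deriv e (\<nu> e) p (\<xi> e p) = conn_trace D \<xi> e p * \<nu> e p"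
    proof -
      have "sec_eq A ?W (dens_conn (- ?N) D \<xi> \<nu>) (\<lambda>c p. 0)"
        using \<nu>(3) W \<xi>W unfolding parallel_def by simp
      from sec_eqD[OF this e(1) pW e(2)]
      have "chart_deriv e (\<nu> e) p (\<xi> e p) + - ?N / ?N * conn_trace D \<xi> e p * \<nu> e p = 0"
        by (simp only: dens_conn_def)
      moreover have "- ?N / ?N = -1" by (simp add: field_simps)
      ultimately show ?thesis by (simp only:)
    qed
    have "chart_deriv e (u e) p = (\<lambda>v. b * (\<nu> e p * \<nu> e p) powr (b - 1) *
        (\<nu> e p * chart_deriv e (\<nu> e) p v + chart_deriv e (\<nu> e) p v * \<nu> e p))"
    proof (rule chart_derivI[OF e])
      have n: "(\<nu> e \<circ> chart_inv e has_derivative chart_deriv e (\<nu> e) p) (at (snd e p) within half_space)"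
        by (rule smooth_in_chart_has_derivative[OF e(1) W(1) \<nu>W pW e(2)])
      have n2: "((\<lambda>x. (\<nu> e \<circ> chart_inv e) x * (\<nu> e \<circ> chart_inv e) x) has_derivative
          (\<lambda>v. \<nu> e p * chart_deriv e (\<nu> e) p v + chart_deriv e (\<nu> e) p v * \<nu> e p)) (at (snd e p) within half_space)"
        using has_derivative_mult[OF n n] chart_inv_coord[OF e] by simp
      have "((\<lambda>t. t powr b) has_real_derivative b * (\<nu> e p * \<nu> e p) powr (b - 1)) (at (\<nu> e p * \<nu> e p))"
        using \<nu>p by (intro has_real_derivative_powr) (auto simp: zero_less_mult_iff linorder_neq_iff)
      then have "((\<lambda>t. t powr b) has_derivative (*) (b * (\<nu> e p * \<nu> e p) powr (b - 1)))
          (at ((\<nu> e \<circ> chart_inv e) (snd e p) * (\<nu> e \<circ> chart_inv e) (snd e p)))"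
        using chart_inv_coord[OF e] by (simp add: has_field_derivative_def)
      from has_derivative_compose[OF n2 this]
      show "(u e \<circ> chart_inv e has_derivative (\<lambda>v. b * (\<nu> e p * \<nu> e p) powr (b - 1) *
        (\<nu> e p * chart_deriv e (\<nu> e) p v + chart_deriv e (\<nu> e) p v * \<nu> e p))) (at (snd e p) within half_space)"
        by (simp add: u_def comp_def)
    qed
    then have "chart_deriv e (u e) p (\<xi> e p) = 2 * b * ((\<nu> e p * \<nu> e p) powr (b - 1) * (\<nu> e p * \<nu> e p)) * conn_trace D \<xi> e p"
      by (simp add: tr)
    also have "(\<nu> e p * \<nu> e p) powr (b - 1) * (\<nu> e p * \<nu> e p) = u e p"
      using \<nu>p by (simp add: powr_diff u_def)
    also have "2 * b = - 1 / ?N" by (simp add: b_def field_simps)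
    finally have du: "chart_deriv e (u e) p (\<xi> e p) = - (u e p * conn_trace D \<xi> e p / ?N)"
      by simp
    have "sec_eq A ?W (vf_in e (X e)) X" by (rule vfields_eq_vf_in[OF X e(1)])
    then have "sec_eq A ?W (D \<xi> (vf_in e (X e))) (D \<xi> X)"
      by (intro D_cong[OF W(1,2) \<xi>W \<xi>W vf_in_vfields[OF e(1) W(1,3) wvfieldsD(1)[OF XW e(1)]] XW])
         (auto simp: sec_eq_def)
    then have "D \<xi> X e p = D \<xi> (vf_in e (X e)) e p" using sec_eqD[OF _ e(1) pW e(2)] by metis
    also have "\<dots> = chart_deriv e (X e) p (\<xi> e p) +
        (\<Sum>i\<in>UNIV. \<Sum>k\<in>UNIV. (\<xi> e p $ i * X e p $ k) *\<^sub>R christoffel e i k p)"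
      by (rule D_vf_in[OF e(1) W \<xi>W wvfieldsD(1)[OF XW e(1)] pW])
    also have "chart_deriv e (X e) p (\<xi> e p) = u e p *\<^sub>R chart_deriv e (\<eta> e) p (\<xi> e p)
        - (u e p * conn_trace D \<xi> e p / ?N) *\<^sub>R \<eta> e p"
      unfolding X_def by (simp add: chart_deriv_scaleR[OF e(1) W(1) uW \<eta>W pW e(2)] du)
    also have "(\<Sum>i\<in>UNIV. \<Sum>k\<in>UNIV. (\<xi> e p $ i * X e p $ k) *\<^sub>R christoffel e i k p) =
        u e p *\<^sub>R (\<Sum>i\<in>UNIV. \<Sum>k\<in>UNIV. (\<xi> e p $ i * \<eta> e p $ k) *\<^sub>R christoffel e i k p)"
      by (simp add: X_def scaleR_sum_right mult_ac)
    finally show ?thesis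
      unfolding wvf_conn_def D_vf_in[OF e(1) W \<xi>W \<eta>W pW] by (simp add: algebra_simps)
  qed
  have "D \<xi> X \<in> vfields A ?V" by (rule D_vfields[OF V' \<xi>' X])
  then have "D \<xi> X d p = jac c d p (D \<xi> X c p)" using vfields_change[OF _ cd] p by simp
  then have "u d p *\<^sub>R wvf_conn (-1) D \<xi> \<eta> d p = u c p *\<^sub>R jac c d p (wvf_conn (-1) D \<xi> \<eta> c p)"
    unfolding key[OF cd(1) p(3)] key[OF cd(2) p(4)] by (simp add: linear_scale[OF jac_linear[OF cd p(3,4)]])
  also have "u c p = u d p * dens_factor (-1) c d p" using u_change[OF cd p(2-4)] by (simp add: mult.commute)
  finally show ?thesis using u_pos[OF cd(2) p(2,4)] by (simp flip: scaleR_scaleR)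
qed


section \<open>Smooth extension of the connection coefficients\<close>

lemma rho_pos: "c \<in> A \<Longrightarrow> p \<in> fst c \<Longrightarrow> p \<in> mfd_int A \<Longrightarrow> rho c p > 0"
  using mfd_int_iff by (simp add: rho_def)

lemma rho_bdry: "c \<in> A \<Longrightarrow> p \<in> fst c \<Longrightarrow> p \<in> mfd_bdry A \<Longrightarrow> rho c p = 0"
  using mfd_bdry_iff by (simp add: rho_def)

lemma smooth_in_chart_inverse_rho:
  assumes "c \<in> A" "V \<subseteq> mfd_int A"
  shows "smooth_in_chart c V (\<lambda>p. inverse (rho c p))"
proof -
  have "rho c (chart_inv c x) > 0" if "x \<in> snd c ` (V \<inter> fst c)" for x
    using that rho_pos[OF assms(1)] chart_inv_coord[OF assms(1)] assms(2) by auto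
  then have "smooth_in_chart c V (\<lambda>p. rho c p powr (-1))"
    using smooth_in_chart_rho[OF assms(1), of V] unfolding smooth_in_chart_def comp_def
    by (intro smooth_on_powr) auto
  then show ?thesis
    by (rule smooth_in_chart_cong'[rotated, OF _ assms(1)])
       (use rho_pos[OF assms(1)] assms(2) in \<open>auto simp: powr_minus less_imp_le\<close>)
qed

lemma conn_rho_eq:
  assumes c: "c \<in> A" and V: "open V" "V \<subseteq> fst c" and vf: "\<xi> \<in> vfields A V" "\<eta> \<in> vfields A V" and p: "p \<in> V"
  shows "conn_rho A D (rho c) \<xi> \<eta> d p = D \<xi> \<eta> d p + (\<xi> c p $ bdry_index / rho c p) *\<^sub>R \<eta> d p
    + (\<eta> c p $ bdry_index / rho c p) *\<^sub>R \<xi> d p"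
  by (simp add: conn_rho_def proj_change_def deriv_along_rho[OF c V vf(1) p] deriv_along_rho[OF c V vf(2) p])

lemma conn_rho_vfields:
  assumes c: "c \<in> A" and V: "open V" "V \<subseteq> mfd_int A" "V \<subseteq> fst c" and vf: "\<xi> \<in> vfields A V" "\<eta> \<in> vfields A V"
  shows "conn_rho A D (rho c) \<xi> \<eta> \<in> vfields A V"
proof (rule wvfields_cong)
  have sm: "smooth_fun A V (\<lambda>p. X c p $ bdry_index * inverse (rho c p))" if "X \<in> vfields A V" for X
    by (intro smooth_fun_in_one_chart[OF c V(3)] smooth_in_chart_mult smooth_in_chart_component
         wvfieldsD(1)[OF that c] smooth_in_chart_inverse_rho[OF c V(2)])
  show "(\<lambda>d p. D \<xi> \<eta> d p + (\<xi> c p $ bdry_index * inverse (rho c p)) *\<^sub>R \<eta> d p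
    + (\<eta> c p $ bdry_index * inverse (rho c p)) *\<^sub>R \<xi> d p) \<in> vfields A V"
    by (intro wvfields_add wvfields_scaleR sm vf D_vfields[OF V(1,2)])
  show "sec_eq A V (\<lambda>d p. D \<xi> \<eta> d p + (\<xi> c p $ bdry_index * inverse (rho c p)) *\<^sub>R \<eta> d p
    + (\<eta> c p $ bdry_index * inverse (rho c p)) *\<^sub>R \<xi> d p) (conn_rho A D (rho c) \<xi> \<eta>)"
    by (intro sec_eqI) (simp add: conn_rho_eq[OF c V(1,3) vf] divide_inverse)
qed

text \<open>The Christoffel symbols of \<open>\<nabla>\<^sup>\<rho>\<close> for \<open>\<rho> = x\<^sub>0\<close>. Pre-compactness says that they extend smoothly to the
  boundary except for the tangential part at \<open>i = k = 0\<close>, which does so after multiplication by \<open>\<rho>\<close>.\<close>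

definition rho_christoffel :: "('a, 'n) chart \<Rightarrow> 'n \<Rightarrow> 'n \<Rightarrow> 'a \<Rightarrow> real ^ 'n" where
  "rho_christoffel c i k p = conn_rho A D (rho c) (frame c i) (frame c k) c p"

lemma rho_christoffel_eq:
  assumes c: "c \<in> A" and p: "p \<in> fst c"
  shows "rho_christoffel c i k p = christoffel c i k p + (axis i 1 $ bdry_index / rho c p) *\<^sub>R axis k 1
    + (axis k 1 $ bdry_index / rho c p) *\<^sub>R axis i 1"
  unfolding rho_christoffel_def
  using conn_rho_eq[OF c open_chart[OF c] order_refl frame_vfields[OF c open_chart[OF c] order_refl]
      frame_vfields[OF c open_chart[OF c] order_refl] p]
  by (simp add: christoffel_def frame_self[OF c p])

lemma precompactD:
  assumes c: "c \<in> A"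
  shows "fun_smooth_to_bdry A (fst c) (deriv_along A (conn_rho A D (rho c) (frame c i) (frame c k)) (rho c))"
    and "vf_smooth_to_bdry A (fst c) (\<lambda>d p. rho c p *\<^sub>R conn_rho A D (rho c) (frame c i) (frame c k) d p)"
    and "i \<noteq> bdry_index \<or> k \<noteq> bdry_index \<Longrightarrow>
      vf_smooth_to_bdry A (fst c) (conn_rho A D (rho c) (frame c i) (frame c k))"
proof -
  have fr: "frame c j \<in> vfields A (fst c)" for j by (rule frame_vfields[OF c open_chart[OF c] order_refl])
  have b: "j \<noteq> bdry_index \<Longrightarrow> frame c j \<in> b_wvfields A 0 (fst c)" for j
    unfolding frame_def by (rule tangential_coordinate_field[OF c])
  note pc = precompact[unfolded proj_precompact_def, rule_format, OF local_defining_function_rho[OF c] fr fr, of i k]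
  show "fun_smooth_to_bdry A (fst c) (deriv_along A (conn_rho A D (rho c) (frame c i) (frame c k)) (rho c))"
    by (rule pc[THEN conjunct1])
  show "vf_smooth_to_bdry A (fst c) (\<lambda>d p. rho c p *\<^sub>R conn_rho A D (rho c) (frame c i) (frame c k) d p)"
    by (rule pc[THEN conjunct2, THEN conjunct1])
  show "vf_smooth_to_bdry A (fst c) (conn_rho A D (rho c) (frame c i) (frame c k))"
    if "i \<noteq> bdry_index \<or> k \<noteq> bdry_index"
    by (rule pc[THEN conjunct2, THEN conjunct2, THEN mp]) (use that b in auto)
qed

lemma vf_smooth_to_bdryD:
  assumes "vf_smooth_to_bdry A U X" "c \<in> A" "U \<subseteq> fst c"
  shows "\<exists>Y. smooth_in_chart c U Y \<and> (\<forall>p\<in>U \<inter> mfd_int A. Y p = X c p)"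
proof -
  obtain Y where Y: "Y \<in> vfields A U" "sec_eq A (U \<inter> mfd_int A) Y X"
    using assms(1) by (auto simp: vf_smooth_to_bdry_def is_extension_def)
  show ?thesis
    by (intro exI[of _ "Y c"] conjI ballI wvfieldsD(1)[OF Y(1) assms(2)] sec_eqD[OF Y(2) assms(2)])
       (use assms(3) in auto)
qed

lemma rho_christoffel_normal_extends:
  assumes c: "c \<in> A"
  shows "\<exists>g. smooth_in_chart c (fst c) g \<and> (\<forall>p\<in>fst c \<inter> mfd_int A. g p = rho_christoffel c i k p $ bdry_index)"
proof -
  let ?Y = "conn_rho A D (rho c) (frame c i) (frame c k)" and ?V = "fst c \<inter> mfd_int A"
  obtain g where g: "smooth_fun A (fst c) g" "\<forall>p\<in>?V. g p = deriv_along A ?Y (rho c) p"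
    using precompactD(1)[OF c, of i k] by (auto simp: fun_smooth_to_bdry_def)
  have V: "open ?V" "?V \<subseteq> mfd_int A" "?V \<subseteq> fst c" using open_mfd_int open_chart[OF c] by auto
  have Y: "?Y \<in> vfields A ?V" by (intro conn_rho_vfields[OF c V] frame_vfields[OF c V(1,3)])
  show ?thesis
    using g deriv_along_rho[OF c V(1,3) Y]
    by (intro exI[of _ g] conjI smooth_funD[OF g(1) c]) (simp add: rho_christoffel_def)
qed

text \<open>The right-hand side is the trace of the Christoffel symbols of \<open>\<nabla>\<^sup>\<rho>\<close>. The only diagonal
  coefficient that might be singular is the normal component at \<open>i = k = 0\<close>, and normal components always
  extend.\<close>

lemma christoffel_trace_extends:
  assumes c: "c \<in> A"
  shows "\<exists>T. smooth_in_chart c (fst c) T \<and> (\<forall>p\<in>fst c \<inter> mfd_int A.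
    T p = christoffel_trace c i p + (real CARD('n) + 1) * axis i 1 $ bdry_index / rho c p)"
proof -
  have "\<exists>h. smooth_in_chart c (fst c) h \<and> (\<forall>p\<in>fst c \<inter> mfd_int A. h p = rho_christoffel c i k p $ k)" for k
  proof (cases "k = bdry_index")
    case True
    then show ?thesis using rho_christoffel_normal_extends[OF c] by simp
  next
    case False
    then obtain Y where "smooth_in_chart c (fst c) Y" "\<forall>p\<in>fst c \<inter> mfd_int A. Y p = rho_christoffel c i k p"
      using vf_smooth_to_bdryD[OF precompactD(3)[OF c, of i k] c order_refl] by (auto simp: rho_christoffel_def)
    then show ?thesis by (intro exI[of _ "\<lambda>p. Y p $ k"]) (auto intro: smooth_in_chart_component)
  qed
  then obtain h where h: "\<And>k. smooth_in_chart c (fst c) (h k)"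
    "\<And>k p. p \<in> fst c \<inter> mfd_int A \<Longrightarrow> h k p = rho_christoffel c i k p $ k" by metis
  have "(\<Sum>k\<in>UNIV. h k p) = christoffel_trace c i p + (real CARD('n) + 1) * axis i 1 $ bdry_index / rho c p"
    if p: "p \<in> fst c \<inter> mfd_int A" for p
  proof -
    have sw: "(axis k (1::real)) $ bdry_index * axis i 1 $ k = (if k = bdry_index then axis i 1 $ bdry_index else 0)" for k
      by (auto simp: axis_def)
    have "(\<Sum>k\<in>UNIV. h k p) = (\<Sum>k\<in>UNIV. christoffel c i k p $ k + axis i 1 $ bdry_index / rho c p
        + (axis k 1 $ bdry_index * axis i 1 $ k) / rho c p)"
      using p by (intro sum.cong refl) (simp add: h(2) rho_christoffel_eq[OF c])
    also have "\<dots> = christoffel_trace c i p + real CARD('n) * (axis i 1 $ bdry_index / rho c p) + axis i 1 $ bdry_index / rho c p"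
      by (simp add: sum.distrib christoffel_trace_def sw sum_divide_distrib[symmetric] sum.delta)
    finally show ?thesis by (simp add: add_divide_distrib distrib_right)
  qed
  then show ?thesis
    by (intro exI[of _ "\<lambda>p. \<Sum>k\<in>UNIV. h k p"] conjI smooth_in_chart_sum h) auto
qed

text \<open>The fields \<open>b_scale c k \<partial>\<^sub>k\<close> form a frame of the b-tangent bundle.\<close>

definition b_scale :: "('a, 'n) chart \<Rightarrow> 'n \<Rightarrow> 'a \<Rightarrow> real" where
  "b_scale c k p = (if k = bdry_index then rho c p else 1)"

text \<open>Passing from \<open>\<nabla>\<close> to \<open>\<nabla>\<^sup>\<rho>\<close> adds \<open>(\<delta>\<^sub>i\<^sub>0/\<rho>) \<partial>\<^sub>k + (\<delta>\<^sub>k\<^sub>0/\<rho>) \<partial>\<^sub>i\<close>, and weight \<open>-1\<close> is the one for which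
  the trace part removes the first of these singular terms. The second one becomes regular in the b-frame.\<close>

lemma weighted_christoffel_rho_christoffel:
  assumes c: "c \<in> A" and p: "p \<in> fst c" "p \<in> mfd_int A"
    and T: "T = christoffel_trace c i p + (real CARD('n) + 1) * axis i 1 $ bdry_index / rho c p"
  shows "b_scale c k p *\<^sub>R weighted_christoffel c i k p = b_scale c k p *\<^sub>R (rho_christoffel c i k p - (T / (real CARD('n) + 1)) *\<^sub>R axis k 1)
    - axis k 1 $ bdry_index *\<^sub>R axis i 1"
proof -
  let ?N = "real CARD('n) + 1" and ?a = "(axis i 1 :: real ^ 'n) $ bdry_index"
  have \<rho>: "rho c p > 0" using rho_pos c p by simp
  have "T / ?N = christoffel_trace c i p / ?N + ?a / rho c p" unfolding T by (simp add: add_divide_distrib)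
  then have "weighted_christoffel c i k p = rho_christoffel c i k p - (T / ?N) *\<^sub>R axis k 1 - (axis k 1 $ bdry_index / rho c p) *\<^sub>R axis i 1"
    unfolding weighted_christoffel_def rho_christoffel_eq[OF c p(1)] by (simp add: scaleR_add_left)
  then show ?thesis using \<rho> by (simp add: b_scale_def scaleR_diff_right axis_def)
qed

lemma weighted_christoffel_extends:
  assumes c: "c \<in> A"
  shows "\<exists>C. smooth_in_chart c (fst c) C \<and> (\<forall>p\<in>fst c \<inter> mfd_int A. C p = b_scale c k p *\<^sub>R weighted_christoffel c i k p)"
proof -
  obtain T where T: "smooth_in_chart c (fst c) T"
    "\<And>p. p \<in> fst c \<inter> mfd_int A \<Longrightarrow> T p = christoffel_trace c i p + (real CARD('n) + 1) * axis i 1 $ bdry_index / rho c p"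
    using christoffel_trace_extends[OF c, of i] by metis
  obtain R where R: "smooth_in_chart c (fst c) R"
    "\<And>p. p \<in> fst c \<inter> mfd_int A \<Longrightarrow> R p = b_scale c k p *\<^sub>R rho_christoffel c i k p"
  proof (cases "k = bdry_index")
    case True
    then show ?thesis using vf_smooth_to_bdryD[OF precompactD(2)[OF c, of i k] c order_refl] that
      by (auto simp: rho_christoffel_def b_scale_def)
  next
    case False
    then show ?thesis using vf_smooth_to_bdryD[OF precompactD(3)[OF c, of i k] c order_refl] that
      by (auto simp: rho_christoffel_def b_scale_def)
  qed
  have sc: "smooth_in_chart c (fst c) (b_scale c k)"
    unfolding b_scale_def[abs_def]
    by (cases "k = bdry_index") (simp_all add: smooth_in_chart_rho[OF c, unfolded rho_def[abs_def]] smooth_in_chart_const rho_def)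
  let ?C = "\<lambda>p. R p - (b_scale c k p * (T p * inverse (real CARD('n) + 1))) *\<^sub>R axis k 1 - axis k 1 $ bdry_index *\<^sub>R axis i 1"
  show ?thesis
  proof (intro exI[of _ ?C] conjI ballI)
    show "smooth_in_chart c (fst c) ?C"
      by (intro smooth_in_chart_diff smooth_in_chart_scaleR smooth_in_chart_mult R T sc smooth_in_chart_const)
    fix p assume p: "p \<in> fst c \<inter> mfd_int A"
    show "?C p = b_scale c k p *\<^sub>R weighted_christoffel c i k p"
      using weighted_christoffel_rho_christoffel[OF c _ _ T(2)[OF p], of k] p R(2)[OF p] by (simp add: scaleR_diff_right divide_inverse)
  qed
qed

text \<open>The connection coefficients with respect to the b-frame, extended smoothly over the boundary. The
  extension is unique by density; outside the domain of the chart the values do not matter.\<close>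

definition b_coefficient :: "('a, 'n) chart \<Rightarrow> 'n \<Rightarrow> 'n \<Rightarrow> 'a \<Rightarrow> real ^ 'n" where
  "b_coefficient c i k = (SOME C. smooth_in_chart c (fst c) C \<and>
     (\<forall>p\<in>fst c \<inter> mfd_int A. C p = b_scale c k p *\<^sub>R weighted_christoffel c i k p))"

lemma b_coefficient:
  assumes "c \<in> A"
  shows smooth_in_chart_b_coefficient: "smooth_in_chart c (fst c) (b_coefficient c i k)"
    and b_coefficient_interior: "p \<in> fst c \<Longrightarrow> p \<in> mfd_int A \<Longrightarrow> b_coefficient c i k p = b_scale c k p *\<^sub>R weighted_christoffel c i k p"
  using someI_ex[OF weighted_christoffel_extends[OF assms], of k i] unfolding b_coefficient_def by auto

lemma eq_on_chart_by_density:
  fixes f g :: "'a \<Rightarrow> 'b::real_normed_vector"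
  assumes c: "c \<in> A" and "open V" "smooth_in_chart c V f" "smooth_in_chart c V g"
    "\<And>q. q \<in> V \<Longrightarrow> q \<in> fst c \<Longrightarrow> q \<in> mfd_int A \<Longrightarrow> f q = g q" "p \<in> V" "p \<in> fst c"
  shows "f p = g p"
  by (rule eq_by_density[of "V \<inter> fst c"])
     (use assms open_chart[OF c] in \<open>auto intro!: smooth_in_chart_continuous_on[OF c]\<close>)

text \<open>For \<open>k = 0\<close> the normal component is \<open>\<rho>\<close> times a smooth function minus \<open>\<delta>\<^sub>i\<^sub>0\<close>.\<close>

lemma b_coefficient_normal_bdry:
  assumes c: "c \<in> A" and p: "p \<in> fst c" "p \<in> mfd_bdry A"
  shows "b_coefficient c i bdry_index p $ bdry_index = - (axis i 1 $ bdry_index)"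
proof -
  obtain T where T: "smooth_in_chart c (fst c) T"
    "\<And>p. p \<in> fst c \<inter> mfd_int A \<Longrightarrow> T p = christoffel_trace c i p + (real CARD('n) + 1) * axis i 1 $ bdry_index / rho c p"
    using christoffel_trace_extends[OF c, of i] by metis
  obtain g where g: "smooth_in_chart c (fst c) g"
    "\<And>p. p \<in> fst c \<inter> mfd_int A \<Longrightarrow> g p = rho_christoffel c i bdry_index p $ bdry_index"
    using rho_christoffel_normal_extends[OF c, of i bdry_index] by metis
  let ?h = "\<lambda>p. rho c p * (g p - T p * inverse (real CARD('n) + 1)) - axis i 1 $ bdry_index"
  have "b_coefficient c i bdry_index p $ bdry_index = ?h p"
  proof (rule eq_on_chart_by_density[OF c open_chart[OF c] _ _ _ p(1,1)])
    show "smooth_in_chart c (fst c) (\<lambda>p. b_coefficient c i bdry_index p $ bdry_index)"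
      by (intro smooth_in_chart_component smooth_in_chart_b_coefficient c)
    show "smooth_in_chart c (fst c) ?h"
      by (intro smooth_in_chart_diff smooth_in_chart_mult g T smooth_in_chart_rho[OF c] smooth_in_chart_const)
    fix q assume q: "q \<in> fst c" "q \<in> mfd_int A"
    then have q': "q \<in> fst c \<inter> mfd_int A" by simp
    show "b_coefficient c i bdry_index q $ bdry_index = ?h q"
      unfolding b_coefficient_interior[OF c q] weighted_christoffel_rho_christoffel[OF c q T(2)[OF q']]
      by (simp add: g(2)[OF q'] b_scale_def divide_inverse)
  qed
  then show ?thesis using rho_bdry[OF c p] by simp
qed

lemma b_coefficient_tangential_normal_component:
  assumes c: "c \<in> A" and k: "k \<noteq> bdry_index" and g: "smooth_in_chart c (fst c) g"
    "\<And>p. p \<in> fst c \<inter> mfd_int A \<Longrightarrow> g p = rho_christoffel c i k p $ bdry_index"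
    and p: "p \<in> fst c"
  shows "b_coefficient c i k p $ bdry_index = g p"
proof (rule eq_on_chart_by_density[OF c open_chart[OF c] _ g(1) _ p p])
  show "smooth_in_chart c (fst c) (\<lambda>p. b_coefficient c i k p $ bdry_index)"
    by (intro smooth_in_chart_component smooth_in_chart_b_coefficient c)
  fix q assume q: "q \<in> fst c" "q \<in> mfd_int A"
  then show "b_coefficient c i k q $ bdry_index = g q"
    using k unfolding b_coefficient_interior[OF c q] weighted_christoffel_rho_christoffel[OF c q refl]
    by (simp add: g(2) b_scale_def axis_def)
qed


section \<open>Strongly totally geodesic boundary\<close>

text \<open>The change from \<open>\<nabla>\<close> to \<open>\<nabla>\<^sup>\<rho>\<close> adds \<open>(N + 1) d\<rho>(\<xi>)/\<rho>\<close> to the trace, so for a parallel density of weight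
  \<open>1\<close> only \<open>(d\<rho>(\<xi>)/\<rho>) \<sigma>\<close> survives.\<close>

lemma dens_conn_rho_parallel:
  assumes \<sigma>: "parallel A (mfd_int A) 1 D \<sigma>" and c: "c \<in> A"
    and V: "open V" "V \<subseteq> mfd_int A" "V \<subseteq> fst c" and \<xi>: "\<xi> \<in> vfields A V" and p: "p \<in> V"
  shows "dens_conn 1 (conn_rho A D (rho c)) \<xi> \<sigma> c p = \<xi> c p $ bdry_index / rho c p * \<sigma> c p"
proof -
  have pc: "p \<in> fst c" using p V by auto
  let ?N = "real CARD('n) + 1" and ?x = "\<xi> c p $ bdry_index / rho c p"
  have "sec_eq A V (dens_conn 1 D \<xi> \<sigma>) (\<lambda>c p. 0)" using \<sigma> V \<xi> unfolding parallel_def by simp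
  from sec_eqD[OF this c p pc]
  have par: "chart_deriv c (\<sigma> c) p (\<xi> c p) + 1 / ?N * conn_trace D \<xi> c p * \<sigma> c p = 0"
    by (simp add: dens_conn_def)
  have "conn_trace (conn_rho A D (rho c)) \<xi> c p = (\<Sum>k\<in>UNIV. conn_rho A D (rho c) \<xi> (frame c k) c p $ k)"
    by (simp add: conn_trace_def frame_def)
  also have "\<dots> = (\<Sum>k\<in>UNIV. D \<xi> (frame c k) c p $ k + ?x + (axis k 1 $ bdry_index * \<xi> c p $ k) / rho c p)"
    by (intro sum.cong refl)
       (simp add: conn_rho_eq[OF c V(1,3) \<xi> frame_vfields[OF c V(1,3)] p] frame_self[OF c pc])
  also have "\<dots> = conn_trace D \<xi> c p + real CARD('n) * ?x + (\<Sum>k\<in>UNIV. axis k 1 $ bdry_index * \<xi> c p $ k) / rho c p"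
    by (simp add: sum.distrib conn_trace_def frame_def sum_divide_distrib)
  also have "(\<Sum>k\<in>UNIV. axis k 1 $ bdry_index * \<xi> c p $ k) = \<xi> c p $ bdry_index"
    by (subst sum.mono_neutral_right[of _ "{bdry_index}"]) (auto simp: axis_def)
  finally have "conn_trace (conn_rho A D (rho c)) \<xi> c p = conn_trace D \<xi> c p + ?N * ?x"
    by (simp add: distrib_right add_divide_distrib)
  then have "dens_conn 1 (conn_rho A D (rho c)) \<xi> \<sigma> c p =
      chart_deriv c (\<sigma> c) p (\<xi> c p) + 1 / ?N * (conn_trace D \<xi> c p + ?N * ?x) * \<sigma> c p"
    by (simp only: dens_conn_def)
  also have "\<dots> = (chart_deriv c (\<sigma> c) p (\<xi> c p) + 1 / ?N * conn_trace D \<xi> c p * \<sigma> c p) + (1 / ?N * ?N) * ?x * \<sigma> c p"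
    by (simp only: distrib_left distrib_right mult.assoc add.assoc)
  also have "1 / ?N * ?N = 1" by simp
  finally show ?thesis unfolding par by simp
qed

text \<open>The first derivative of \<open>\<sigma>\<close> along \<open>\<partial>\<^sub>k\<close> vanishes identically, since \<open>d\<rho>(\<partial>\<^sub>k) = 0\<close> for \<open>k \<noteq> 0\<close>. Only the
  correction term of the second covariant derivative remains.\<close>

lemma second_deriv_frame:
  assumes \<sigma>: "parallel A (mfd_int A) 1 D \<sigma>" and c: "c \<in> A" and k: "k \<noteq> bdry_index"
    and p: "p \<in> fst c" "p \<in> mfd_int A"
  shows "second_deriv 1 (conn_rho A D (rho c)) \<sigma> (frame c i) (frame c k) c p =
    - (rho_christoffel c i k p $ bdry_index) * (\<sigma> c p / rho c p)"
proof -
  let ?V = "fst c \<inter> mfd_int A" and ?R = "conn_rho A D (rho c)"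
  have V: "open ?V" "?V \<subseteq> mfd_int A" "?V \<subseteq> fst c" using open_mfd_int open_chart[OF c] by auto
  have pV: "p \<in> ?V" using p by simp
  have fr: "frame c j \<in> vfields A ?V" for j by (rule frame_vfields[OF c V(1,3)])
  have zero: "0 = dens_conn 1 ?R (frame c k) \<sigma> c q" if "q \<in> ?V \<inter> fst c" for q
    using dens_conn_rho_parallel[OF \<sigma> c V fr, of q k] that k frame_self[OF c, of q k] by (simp add: axis_def)
  have "chart_deriv c (dens_conn 1 ?R (frame c k) \<sigma> c) p = chart_deriv c (\<lambda>q. 0) p"
    by (rule chart_deriv_cong[OF c V(1) smooth_in_chart_const pV p(1) zero])
  then have "dens_conn 1 ?R (frame c i) (dens_conn 1 ?R (frame c k) \<sigma>) c p = 0"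
    using chart_deriv_const[OF c p(1), of "0 :: real"] zero[of p] pV
    by (simp add: dens_conn_def[of 1 ?R "frame c i"])
  moreover have "dens_conn 1 ?R (?R (frame c i) (frame c k)) \<sigma> c p = rho_christoffel c i k p $ bdry_index / rho c p * \<sigma> c p"
    unfolding rho_christoffel_def by (rule dens_conn_rho_parallel[OF \<sigma> c V conn_rho_vfields[OF c V fr fr] pV])
  ultimately show ?thesis by (simp add: second_deriv_def)
qed

text \<open>Parallelism expresses \<open>d\<sigma>/\<sigma>\<close> by the trace of the Christoffel symbols, whose singular part is exactly
  \<open>d\<rho>/\<rho>\<close>. Without the nonzero limit, the vanishing of \<open>\<Phi>\<close> would not determine the normal components
  of the connection coefficients.\<close>

lemma parallel_density_bdry_limit:
  assumes \<sigma>: "\<sigma> \<in> densities A 1 (mfd_int A)" "nowhere_vanishing A (mfd_int A) \<sigma>" "parallel A (mfd_int A) 1 D \<sigma>"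
    and c: "c \<in> A" and p: "p \<in> fst c" "p \<in> mfd_bdry A"
  shows "\<exists>L. L \<noteq> 0 \<and> ((\<lambda>q. \<sigma> c q / rho c q) \<longlongrightarrow> L) (at p within mfd_int A)"
proof -
  let ?N = "real CARD('n) + 1" and ?S = "snd c ` fst c" and ?V = "fst c \<inter> mfd_int A"
  let ?P = "{y :: real ^ 'n. y $ bdry_index > 0}"
  obtain T where T: "\<And>i. smooth_in_chart c (fst c) (T i)"
    "\<And>i p. p \<in> fst c \<inter> mfd_int A \<Longrightarrow> T i p = christoffel_trace c i p + ?N * axis i 1 $ bdry_index / rho c p"
    using christoffel_trace_extends[OF c] by metis
  define \<tau> where "\<tau> = (\<lambda>i y. T i (chart_inv c y) / ?N)"
  have V: "open ?V" "?V \<subseteq> mfd_int A" "?V \<subseteq> fst c" using open_mfd_int open_chart[OF c] by auto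
  have S: "openin (top_of_set half_space) ?S" using openin_chart_image[OF c, of UNIV] by simp
  have int: "chart_inv c y \<in> ?V \<and> snd c (chart_inv c y) = y" if "y \<in> ?S" "y $ bdry_index > 0" for y
    using that chart_inv_coord[OF c] mfd_int_iff[OF c] by auto
  have "\<exists>L. L \<noteq> 0 \<and> ((\<lambda>y. (\<sigma> c \<circ> chart_inv c) y / y $ bdry_index) \<longlongrightarrow> L) (at (snd c p) within ?P)"
  proof (rule logarithmic_boundary_limit[OF S])
    show "snd c p \<in> ?S" using p by simp
    show "snd c p $ bdry_index = 0" using mfd_bdry_iff[OF c p(1)] p(2) by simp
    show "continuous_on ?S (\<tau> i)" for i
      using T(1)[of i] unfolding \<tau>_def smooth_in_chart_def comp_def
      by (intro continuous_intros smooth_on_imp_continuous_on) auto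
  next
    fix y assume y: "y \<in> ?S" "y $ bdry_index > 0"
    let ?q = "chart_inv c y"
    from int[OF y] have q: "?q \<in> ?V" "snd c ?q = y" by auto
    then have qc: "?q \<in> fst c" by simp
    show "(\<sigma> c \<circ> chart_inv c) y \<noteq> 0" using \<sigma>(2) q c unfolding nowhere_vanishing_def by auto
    have sm: "smooth_in_chart c (mfd_int A) (\<sigma> c)" using \<sigma>(1) c unfolding densities_def by simp
    have der: "(\<sigma> c \<circ> chart_inv c has_derivative chart_deriv c (\<sigma> c) ?q) (at y within half_space)"
      using smooth_in_chart_has_derivative[OF c open_mfd_int sm _ qc] q by simp
    have der_eq: "chart_deriv c (\<sigma> c) ?q v = (\<sigma> c \<circ> chart_inv c) y * (v $ bdry_index / y $ bdry_index - (\<Sum>i\<in>UNIV. v $ i * \<tau> i y))" for v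
    proof -
      have vf: "vf_in c (\<lambda>_. v) \<in> vfields A ?V" by (intro vf_in_vfields[OF c V(1,3)] smooth_in_chart_const)
      have "sec_eq A ?V (dens_conn 1 D (vf_in c (\<lambda>_. v)) \<sigma>) (\<lambda>c p. 0)"
        using \<sigma>(3) V vf unfolding parallel_def by simp
      from sec_eqD[OF this c q(1) qc]
      have "chart_deriv c (\<sigma> c) ?q v = - (\<Sum>i\<in>UNIV. v $ i * christoffel_trace c i ?q) / ?N * \<sigma> c ?q"
        by (simp add: dens_conn_def vf_in_self[OF c qc] conn_trace_eq[OF c V vf q(1)] field_simps)
      also have "(\<Sum>i\<in>UNIV. v $ i * christoffel_trace c i ?q) =
          (\<Sum>i\<in>UNIV. v $ i * T i ?q - ?N / rho c ?q * (v $ i * axis i 1 $ bdry_index))"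
        by (intro sum.cong refl) (simp add: T(2)[OF q(1)] algebra_simps)
      also have "\<dots> = (\<Sum>i\<in>UNIV. v $ i * T i ?q) - ?N / rho c ?q * (\<Sum>i\<in>UNIV. v $ i * axis i 1 $ bdry_index)"
        by (simp only: sum_subtractf sum_distrib_left)
      also have "(\<Sum>i\<in>UNIV. v $ i * axis i 1 $ bdry_index) = v $ bdry_index"
        by (subst sum.mono_neutral_right[of _ "{bdry_index}"]) (auto simp: axis_def)
      also have "(\<Sum>i\<in>UNIV. v $ i * T i ?q) = ?N * (\<Sum>i\<in>UNIV. v $ i * \<tau> i y)"
        by (simp add: \<tau>_def sum_distrib_left)
      finally have "chart_deriv c (\<sigma> c) ?q v = - (?N * (\<Sum>i\<in>UNIV. v $ i * \<tau> i y) - ?N / rho c ?q * v $ bdry_index) / ?N * \<sigma> c ?q" .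
      also have "\<dots> = - (?N / ?N * ((\<Sum>i\<in>UNIV. v $ i * \<tau> i y) - v $ bdry_index / rho c ?q)) * \<sigma> c ?q"
        by (simp add: right_diff_distrib diff_divide_distrib)
      also have "?N / ?N = 1" by simp
      finally show ?thesis using q(2) by (simp add: rho_def algebra_simps)
    qed
    show "(\<sigma> c \<circ> chart_inv c has_derivative (\<lambda>v. (\<sigma> c \<circ> chart_inv c) y *
        (v $ bdry_index / y $ bdry_index - (\<Sum>i\<in>UNIV. v $ i * \<tau> i y)))) (at y within half_space)"
      by (rule has_derivative_eq_rhs[OF der ext[OF der_eq]])
  qed
  then obtain L where L: "L \<noteq> 0"
    "((\<lambda>y. (\<sigma> c \<circ> chart_inv c) y / y $ bdry_index) \<longlongrightarrow> L) (at (snd c p) within ?P)" by auto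
  have ev: "\<forall>\<^sub>F q in at p within mfd_int A. q \<in> ?V"
    using open_chart[OF c] p(1) by (auto simp: eventually_at_topological)
  have "isCont (snd c) p"
    using continuous_on_eq_continuous_at[OF open_chart[OF c], of "snd c"] continuous_on_coord[OF c] p(1) by simp
  then have "(snd c \<longlongrightarrow> snd c p) (at p within mfd_int A)"
    using continuous_at_imp_continuous_at_within continuous_within by metis
  moreover have "\<forall>\<^sub>F q in at p within mfd_int A. snd c q \<in> ?P \<and> snd c q \<noteq> snd c p"
    using ev by (rule eventually_mono) (use mfd_int_iff[OF c] mfd_bdry_iff[OF c p(1)] p(2) in auto)
  ultimately have "filterlim (snd c) (at (snd c p) within ?P) (at p within mfd_int A)"
    by (simp add: filterlim_at)
  from filterlim_compose[OF L(2) this]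
  have "((\<lambda>q. (\<sigma> c \<circ> chart_inv c) (snd c q) / snd c q $ bdry_index) \<longlongrightarrow> L) (at p within mfd_int A)" .
  moreover have "\<forall>\<^sub>F q in at p within mfd_int A. (\<sigma> c \<circ> chart_inv c) (snd c q) / snd c q $ bdry_index = \<sigma> c q / rho c q"
    using ev by (rule eventually_mono) (simp add: chart_inv_coord[OF c] rho_def)
  ultimately have "((\<lambda>q. \<sigma> c q / rho c q) \<longlongrightarrow> L) (at p within mfd_int A)"
    by (rule Lim_transform_eventually)
  with L(1) show ?thesis by auto
qed

text \<open>The boundary value \<open>\<Phi>(\<partial>\<^sub>i, \<partial>\<^sub>k)\<close> is minus this coefficient times the nonzero limit of \<open>\<sigma>/\<rho>\<close>.\<close>

lemma b_coefficient_tangential_bdry: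
  assumes \<sigma>: "\<sigma> \<in> densities A 1 (mfd_int A)" "nowhere_vanishing A (mfd_int A) \<sigma>" "parallel A (mfd_int A) 1 D \<sigma>"
    and stg: "strongly_totally_geodesic A D \<sigma>"
    and c: "c \<in> A" and k: "k \<noteq> bdry_index" and p: "p \<in> fst c" "p \<in> mfd_bdry A"
  shows "b_coefficient c i k p $ bdry_index = 0"
proof -
  obtain g where g: "smooth_in_chart c (fst c) g"
    "\<And>p. p \<in> fst c \<inter> mfd_int A \<Longrightarrow> g p = rho_christoffel c i k p $ bdry_index"
    using rho_christoffel_normal_extends[OF c, of i k] by metis
  obtain L where L: "L \<noteq> 0" "((\<lambda>q. \<sigma> c q / rho c q) \<longlongrightarrow> L) (at p within mfd_int A)"
    using parallel_density_bdry_limit[OF \<sigma> c p] by auto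
  have "isCont g p"
    using continuous_on_eq_continuous_at[OF open_chart[OF c], of g] smooth_in_chart_continuous_on[OF c g(1)] p(1)
    by simp
  then have "(g \<longlongrightarrow> g p) (at p within mfd_int A)"
    using continuous_at_imp_continuous_at_within continuous_within by metis
  then have "((\<lambda>q. - g q * (\<sigma> c q / rho c q)) \<longlongrightarrow> - g p * L) (at p within mfd_int A)"
    by (intro tendsto_intros L)
  moreover have "\<forall>\<^sub>F q in at p within mfd_int A. q \<in> fst c \<inter> mfd_int A"
    using open_chart[OF c] p(1) by (auto simp: eventually_at_topological)
  then have "\<forall>\<^sub>F q in at p within mfd_int A. - g q * (\<sigma> c q / rho c q) =
      second_deriv 1 (conn_rho A D (rho c)) \<sigma> (frame c i) (frame c k) c q"
    by (rule eventually_mono) (simp add: g(2) second_deriv_frame[OF \<sigma>(3) c k])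
  ultimately have "(second_deriv 1 (conn_rho A D (rho c)) \<sigma> (frame c i) (frame c k) c \<longlongrightarrow> - g p * L) (at p within mfd_int A)"
    by (rule Lim_transform_eventually)
  moreover have "at p within mfd_int A \<noteq> bot"
    unfolding trivial_limit_within using mfd_int_meets_open by (auto simp: islimpt_def)
  ultimately have "Phi A D \<sigma> (rho c) c p (axis i 1) (axis k 1) = - g p * L"
    unfolding Phi_def frame_def by (intro tendsto_Lim)
  moreover have "Phi A D \<sigma> (rho c) c p (axis i 1) (axis k 1) = 0"
    by (rule stg[unfolded strongly_totally_geodesic_def, rule_format, OF local_defining_function_rho[OF c] c])
       (use p k in \<open>auto simp: axis_def\<close>)
  ultimately have "g p = 0" using L(1) by simp
  then show ?thesis using b_coefficient_tangential_normal_component[OF c k g p(1)] by simp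
qed

section \<open>The extended connection\<close>

text \<open>The components of a section of the b-tangent bundle with respect to the b-frame: \<open>\<eta>\<^sup>k\<close> for \<open>k \<noteq> 0\<close>, and
  \<open>\<eta>\<^sup>0/x\<^sub>0\<close> extended smoothly to the boundary for \<open>k = 0\<close>.\<close>

definition b_component :: "('a, 'n) chart \<Rightarrow> ('a \<Rightarrow> real ^ 'n) \<Rightarrow> 'n \<Rightarrow> 'a \<Rightarrow> real" where
  "b_component c F k p = (if k = bdry_index then bdry_quotient (\<lambda>x. F (chart_inv c x) $ bdry_index) (snd c p) else F p $ k)"

lemma b_component_eq:
  assumes c: "c \<in> A" and V: "open V" "smooth_in_chart c V F" and p: "p \<in> V" "p \<in> fst c"
  shows "b_component c F k p = (if k = bdry_index
    then if p \<in> mfd_bdry A then chart_deriv c F p (axis bdry_index 1) $ bdry_index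
      else F p $ bdry_index / rho c p
    else F p $ k)"
proof -
  have "hderiv (\<lambda>x. F (chart_inv c x) $ bdry_index) (snd c p) = (\<lambda>v. chart_deriv c F p v $ bdry_index)"
    using chart_deriv_component[OF c V p, of bdry_index]
    unfolding chart_deriv_eq_hderiv[OF c p(2)] by (simp add: comp_def)
  then show ?thesis
    by (simp add: b_component_def bdry_quotient_def mfd_bdry_iff[OF c p(2)] chart_inv_coord[OF c p(2)] rho_def)
qed

lemma b_scale_b_component:
  assumes "c \<in> A" "p \<in> fst c" "p \<in> mfd_int A"
  shows "b_scale c k p * b_component c F k p = F p $ k"
  using rho_pos[OF assms] by (auto simp: b_scale_def b_component_def bdry_quotient_def rho_def chart_inv_coord[OF assms(1,2)])

lemma smooth_in_chart_b_component:
  assumes c: "c \<in> A" and V: "open V" "smooth_in_chart c V F"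
    and zero: "\<And>p. p \<in> V \<Longrightarrow> p \<in> fst c \<Longrightarrow> p \<in> mfd_bdry A \<Longrightarrow> F p $ bdry_index = 0"
  shows "smooth_in_chart c V (b_component c F k)"
proof (cases "k = bdry_index")
  case False
  then have "b_component c F k = (\<lambda>p. F p $ k)" by (simp add: b_component_def fun_eq_iff)
  then show ?thesis using smooth_in_chart_component[OF V(2)] by simp
next
  case True
  have "smooth_on (snd c ` (V \<inter> fst c)) (bdry_quotient (\<lambda>x. F (chart_inv c x) $ bdry_index))"
  proof (rule smooth_on_bdry_quotient[OF openin_chart_image[OF c V(1)]])
    show "smooth_on (snd c ` (V \<inter> fst c)) (\<lambda>x. F (chart_inv c x) $ bdry_index)"
      using smooth_in_chart_component[OF V(2), of bdry_index] by (simp add: smooth_in_chart_def comp_def)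
    fix y assume "y \<in> snd c ` (V \<inter> fst c)" "y $ bdry_index = 0"
    then show "F (chart_inv c y) $ bdry_index = 0"
      using chart_inv_coord[OF c] mfd_bdry_iff[OF c] zero by auto
  qed
  from smooth_in_chart_of_coord[OF c this] show ?thesis
    using True by (simp add: b_component_def[abs_def])
qed

lemma b_wvfieldsD:
  assumes "X \<in> b_wvfields A w V"
  shows "X \<in> wvfields A w V"
    and "c \<in> A \<Longrightarrow> p \<in> V \<Longrightarrow> p \<in> fst c \<Longrightarrow> p \<in> mfd_bdry A \<Longrightarrow> X c p $ bdry_index = 0"
  using assms unfolding b_wvfields_def mem_Collect_eq by (elim conjE; simp)+

lemma b_wvfieldsI:
  assumes "X \<in> wvfields A w V"
    and "\<And>c p. c \<in> A \<Longrightarrow> p \<in> V \<Longrightarrow> p \<in> fst c \<Longrightarrow> p \<in> mfd_bdry A \<Longrightarrow> X c p $ bdry_index = 0"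
  shows "X \<in> b_wvfields A w V"
  unfolding b_wvfields_def by (intro CollectI conjI ballI assms) (simp_all only: Int_iff)

text \<open>The derivative \<open>d\<eta>(\<xi>)\<close> is taken of the components in the coordinate frame, not the b-frame; this is
  the reason for the term \<open>- \<delta>\<^sub>i\<^sub>0\<close> in the normal component of the coefficients.\<close>

definition b_connection :: "('a, 'n) conn" where
  "b_connection \<xi> \<eta> c p = chart_deriv c (\<eta> c) p (\<xi> c p) +
    (\<Sum>i\<in>UNIV. \<Sum>k\<in>UNIV. (\<xi> c p $ i * b_component c (\<eta> c) k p) *\<^sub>R b_coefficient c i k p)"

lemma b_connection_interior:
  assumes V: "open V" and \<xi>: "\<xi> \<in> vfields A V" and \<eta>: "\<eta> \<in> wvfields A (-1) V"
    and c: "c \<in> A" and p: "p \<in> V" "p \<in> mfd_int A" "p \<in> fst c"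
  shows "b_connection \<xi> \<eta> c p = wvf_conn (-1) D \<xi> \<eta> c p"
proof -
  have "(\<xi> c p $ i * b_component c (\<eta> c) k p) *\<^sub>R b_coefficient c i k p = (\<xi> c p $ i * \<eta> c p $ k) *\<^sub>R weighted_christoffel c i k p" for i k
    by (simp add: b_coefficient_interior[OF c p(3,2)] b_scale_b_component[OF c p(3,2), symmetric] mult_ac)
  then show ?thesis
    unfolding b_connection_def wvf_conn_eq[where \<eta> = \<eta>, OF c V \<xi> wvfieldsD(1)[OF \<eta> c] p] by simp
qed

lemma smooth_in_chart_b_connection:
  assumes V: "open V" and \<xi>: "\<xi> \<in> vfields A V" and \<eta>: "\<eta> \<in> b_wvfields A (-1) V" and c: "c \<in> A"
  shows "smooth_in_chart c V (b_connection \<xi> \<eta> c)"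
proof -
  note \<eta>c = wvfieldsD(1)[OF b_wvfieldsD(1)[OF \<eta>] c] and \<xi>c = wvfieldsD(1)[OF \<xi> c]
  have "smooth_in_chart c V (b_coefficient c i k)" for i k
    by (rule smooth_in_chart_subset[OF smooth_in_chart_b_coefficient[OF c]]) auto
  moreover have "smooth_in_chart c V (b_component c (\<eta> c) k)" for k
    by (rule smooth_in_chart_b_component[OF c V \<eta>c b_wvfieldsD(2)[OF \<eta> c]])
  ultimately show ?thesis unfolding b_connection_def[abs_def]
    by (intro smooth_in_chart_add smooth_in_chart_sum smooth_in_chart_scaleR smooth_in_chart_mult
         smooth_in_chart_component smooth_in_chart_deriv_along[OF c V] \<xi>c \<eta>c)
qed

text \<open>The explicit formula is smooth in each chart. Its transformation law holds over the interior, where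
  it computes \<open>\<nabla>\<close>, and both sides of it are continuous up to the boundary.\<close>

lemma b_connection_wvfields:
  assumes V: "open V" and \<xi>: "\<xi> \<in> vfields A V" and \<eta>: "\<eta> \<in> b_wvfields A (-1) V"
  shows "b_connection \<xi> \<eta> \<in> wvfields A (-1) V"
proof (rule wvfieldsI)
  show "smooth_in_chart c V (b_connection \<xi> \<eta> c)" if "c \<in> A" for c
    by (rule smooth_in_chart_b_connection[OF V \<xi> \<eta> that])
  fix c d p assume cd: "c \<in> A" "d \<in> A" and p: "p \<in> V" "p \<in> fst c" "p \<in> fst d"
  note \<eta>' = b_wvfieldsD(1)[OF \<eta>]
  let ?U = "V \<inter> fst c \<inter> fst d"
  show "b_connection \<xi> \<eta> d p = dens_factor (-1) c d p *\<^sub>R jac c d p (b_connection \<xi> \<eta> c p)"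
  proof (rule eq_by_density[of ?U])
    show "open ?U" using V open_chart[OF cd(1)] open_chart[OF cd(2)] by auto
    have "continuous_on (V \<inter> fst d) (b_connection \<xi> \<eta> d)"
      by (rule smooth_in_chart_continuous_on[OF cd(2) smooth_in_chart_b_connection[OF V \<xi> \<eta> cd(2)]])
    then show "continuous_on ?U (b_connection \<xi> \<eta> d)" by (rule continuous_on_subset) auto
    have "continuous_on (V \<inter> fst d \<inter> fst c) (\<lambda>p. jac c d p (b_connection \<xi> \<eta> c p))"
      by (intro smooth_in_chart_continuous_on[OF cd(1)] smooth_in_chart_jac[OF cd]
          smooth_in_chart_subset[OF smooth_in_chart_b_connection[OF V \<xi> \<eta> cd(1)]] open_Int V open_chart[OF cd(2)]) auto
    then have "continuous_on ?U (\<lambda>p. jac c d p (b_connection \<xi> \<eta> c p))" by (rule continuous_on_subset) auto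
    moreover have "continuous_on ?U (dens_factor (-1) c d)"
      by (rule continuous_on_subset[OF continuous_on_dens_factor[OF cd]]) auto
    ultimately show "continuous_on ?U (\<lambda>p. dens_factor (-1) c d p *\<^sub>R jac c d p (b_connection \<xi> \<eta> c p))"
      by (intro continuous_intros)
    show "p \<in> ?U" using p by simp
    fix q assume "q \<in> ?U \<inter> mfd_int A"
    then have q: "q \<in> V" "q \<in> mfd_int A" "q \<in> fst c" "q \<in> fst d" by auto
    show "b_connection \<xi> \<eta> d q = dens_factor (-1) c d q *\<^sub>R jac c d q (b_connection \<xi> \<eta> c q)"
      unfolding b_connection_interior[OF V \<xi> \<eta>' cd(1) q(1-3)] b_connection_interior[OF V \<xi> \<eta>' cd(2) q(1,2,4)]
      by (rule wvf_conn_change[OF V \<xi> \<eta>' cd q])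
  qed
qed

text \<open>On the boundary \<open>d\<eta>\<^sup>0(\<xi>) = \<xi>\<^sup>0 \<partial>\<^sub>0\<eta>\<^sup>0\<close>, as \<open>\<eta>\<^sup>0\<close> vanishes along the boundary. This cancels against the
  contribution \<open>- \<xi>\<^sup>0 (\<eta>\<^sup>0/x\<^sub>0)\<close> of the normal coefficient, and the remaining coefficients are tangential.\<close>

lemma b_connection_tangent:
  assumes \<sigma>: "\<sigma> \<in> densities A 1 (mfd_int A)" "nowhere_vanishing A (mfd_int A) \<sigma>" "parallel A (mfd_int A) 1 D \<sigma>"
    and stg: "strongly_totally_geodesic A D \<sigma>"
    and V: "open V" and \<xi>: "\<xi> \<in> vfields A V" and \<eta>: "\<eta> \<in> b_wvfields A (-1) V"
    and c: "c \<in> A" and p: "p \<in> V" "p \<in> fst c" "p \<in> mfd_bdry A"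
  shows "b_connection \<xi> \<eta> c p $ bdry_index = 0"
proof -
  note \<eta>c = wvfieldsD(1)[OF b_wvfieldsD(1)[OF \<eta>] c]
  let ?q = "b_component c (\<eta> c) bdry_index p" and ?\<xi>0 = "\<xi> c p $ bdry_index"
  have lin: "linear (\<lambda>v. chart_deriv c (\<lambda>q. \<eta> c q $ bdry_index) p v)"
    by (rule chart_deriv_linear[OF c V smooth_in_chart_component[OF \<eta>c] p(1,2)])
  have tang: "chart_deriv c (\<lambda>q. \<eta> c q $ bdry_index) p (axis i 1) = 0" if "i \<noteq> bdry_index" for i
    by (rule chart_deriv_tangential[OF c V smooth_in_chart_component[OF \<eta>c] _ p(1,3,2)])
       (use b_wvfieldsD(2)[OF \<eta> c] that in \<open>auto simp: axis_def\<close>)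
  have "chart_deriv c (\<eta> c) p (\<xi> c p) $ bdry_index = chart_deriv c (\<lambda>q. \<eta> c q $ bdry_index) p (\<xi> c p)"
    by (simp add: chart_deriv_component[OF c V \<eta>c p(1,2)])
  also have "\<dots> = (\<Sum>i\<in>UNIV. \<xi> c p $ i *\<^sub>R chart_deriv c (\<lambda>q. \<eta> c q $ bdry_index) p (axis i 1))"
    by (rule linear_axis_sum[OF lin])
  also have "\<dots> = ?\<xi>0 *\<^sub>R chart_deriv c (\<lambda>q. \<eta> c q $ bdry_index) p (axis bdry_index 1)"
    by (subst sum.mono_neutral_right[of _ "{bdry_index}"]) (auto simp: tang)
  also have "chart_deriv c (\<lambda>q. \<eta> c q $ bdry_index) p (axis bdry_index 1) = ?q"
    using p(3) by (simp add: b_component_eq[OF c V \<eta>c p(1,2)] chart_deriv_component[OF c V \<eta>c p(1,2)])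
  finally have 1: "chart_deriv c (\<eta> c) p (\<xi> c p) $ bdry_index = ?\<xi>0 * ?q" by simp
  have "(\<Sum>k\<in>UNIV. \<xi> c p $ i * b_component c (\<eta> c) k p * b_coefficient c i k p $ bdry_index) =
      - (\<xi> c p $ i * axis i 1 $ bdry_index) * ?q" for i
    by (subst sum.mono_neutral_right[of _ "{bdry_index}"])
       (auto simp: b_coefficient_tangential_bdry[OF \<sigma> stg c _ p(2,3)] b_coefficient_normal_bdry[OF c p(2,3)])
  then have "(\<Sum>i\<in>UNIV. \<Sum>k\<in>UNIV. \<xi> c p $ i * b_component c (\<eta> c) k p * b_coefficient c i k p $ bdry_index) =
      (\<Sum>i\<in>UNIV. - (\<xi> c p $ i * axis i 1 $ bdry_index) * ?q)" by simp
  also have "\<dots> = - ?\<xi>0 * ?q"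
    by (subst sum.mono_neutral_right[of _ "{bdry_index}"]) (auto simp: axis_def)
  finally show ?thesis using 1 by (simp add: b_connection_def)
qed

text \<open>The formula is pointwise linear in \<open>\<xi>\<close> and in the components and first derivatives of \<open>\<eta>\<close>. The b-components
  are linear over smooth functions, also on the boundary: there
  \<open>\<partial>\<^sub>0(f \<eta>\<^sup>0) = f \<partial>\<^sub>0\<eta>\<^sup>0\<close> because \<open>\<eta>\<^sup>0\<close> vanishes.\<close>

lemma linear_connection_b_connection:
  assumes tangent: "\<And>V \<xi> \<eta>. open V \<Longrightarrow> \<xi> \<in> vfields A V \<Longrightarrow> \<eta> \<in> b_wvfields A (-1) V \<Longrightarrow>
    b_connection \<xi> \<eta> \<in> b_wvfields A (-1) V"
  shows "linear_connection A UNIV (b_wvfields A (-1)) b_connection"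
  unfolding linear_connection_def
proof (intro allI impI conjI ballI; (elim conjE)?)
  fix V :: "'a set" assume V: "open V"
  note sm = wvfieldsD(1)[OF b_wvfieldsD(1)]
  {
    fix \<xi> s assume "\<xi> \<in> vfields A V" "s \<in> b_wvfields A (-1) V"
    then show "b_connection \<xi> s \<in> b_wvfields A (-1) V" by (rule tangent[OF V])
  next
    fix \<xi> \<xi>' s s' :: "('a, 'n) vfield"
    assume s: "s \<in> b_wvfields A (-1) V" "s' \<in> b_wvfields A (-1) V" and eq: "sec_eq A V \<xi> \<xi>'" "sec_eq A V s s'"
    show "sec_eq A V (b_connection \<xi> s) (b_connection \<xi>' s')"
    proof (rule sec_eqI)
      fix c p assume c: "c \<in> A" "p \<in> V" "p \<in> fst c"
      have "chart_deriv c (s' c) p = chart_deriv c (s c) p"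
        by (rule chart_deriv_cong[OF c(1) V sm[OF s(1) c(1)] c(2,3)]) (use sec_eqD[OF eq(2) c(1)] in auto)
      moreover have "b_component c (s' c) k p = b_component c (s c) k p" for k
        unfolding b_component_eq[OF c(1) V sm[OF s(1) c(1)] c(2,3)] b_component_eq[OF c(1) V sm[OF s(2) c(1)] c(2,3)]
          calculation sec_eqD[OF eq(2) c] by simp
      ultimately show "b_connection \<xi> s c p = b_connection \<xi>' s' c p" by (simp add: b_connection_def sec_eqD[OF eq(1) c])
    qed
  next
    fix \<xi> \<xi>' s :: "('a, 'n) vfield" assume s: "s \<in> b_wvfields A (-1) V"
    show "sec_eq A V (b_connection (\<lambda>c p. \<xi> c p + \<xi>' c p) s) (\<lambda>c p. b_connection \<xi> s c p + b_connection \<xi>' s c p)"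
      by (rule sec_eqI)
         (simp add: b_connection_def linear_add[OF chart_deriv_linear[OF _ V sm[OF s]]] distrib_right scaleR_add_left sum.distrib)
  next
    fix f and \<xi> s :: "('a, 'n) vfield" assume f: "smooth_fun A V f" and s: "s \<in> b_wvfields A (-1) V"
    show "sec_eq A V (b_connection (\<lambda>c p. f p *\<^sub>R \<xi> c p) s) (\<lambda>c p. f p *\<^sub>R b_connection \<xi> s c p)"
      by (rule sec_eqI)
         (simp add: b_connection_def linear_scale[OF chart_deriv_linear[OF _ V sm[OF s]]] scaleR_add_right scaleR_sum_right mult.assoc)
  next
    fix \<xi> s s' :: "('a, 'n) vfield" assume s: "s \<in> b_wvfields A (-1) V" "s' \<in> b_wvfields A (-1) V"
    show "sec_eq A V (b_connection \<xi> (\<lambda>c p. s c p + s' c p)) (\<lambda>c p. b_connection \<xi> s c p + b_connection \<xi> s' c p)"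
    proof (rule sec_eqI)
      fix c p assume c: "c \<in> A" "p \<in> V" "p \<in> fst c"
      note sc = sm[OF s(1) c(1)] sm[OF s(2) c(1)]
      have d: "chart_deriv c (\<lambda>q. s c q + s' c q) p = (\<lambda>v. chart_deriv c (s c) p v + chart_deriv c (s' c) p v)"
        by (rule chart_deriv_add[OF c(1) V sc c(2,3)])
      have "b_component c (\<lambda>q. s c q + s' c q) k p = b_component c (s c) k p + b_component c (s' c) k p" for k
        unfolding b_component_eq[OF c(1) V sc(1) c(2,3)] b_component_eq[OF c(1) V sc(2) c(2,3)]
          b_component_eq[OF c(1) V smooth_in_chart_add[OF sc] c(2,3)] d by (simp add: add_divide_distrib)
      then show "b_connection \<xi> (\<lambda>c p. s c p + s' c p) c p = b_connection \<xi> s c p + b_connection \<xi> s' c p"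
        by (simp add: b_connection_def d distrib_left scaleR_add_left sum.distrib)
    qed
  next
    fix f \<xi> s assume f: "smooth_fun A V f" and \<xi>: "\<xi> \<in> vfields A V" and s: "s \<in> b_wvfields A (-1) V"
    show "sec_eq A V (b_connection \<xi> (\<lambda>c p. f p *\<^sub>R s c p)) (\<lambda>c p. deriv_along A \<xi> f p *\<^sub>R s c p + f p *\<^sub>R b_connection \<xi> s c p)"
    proof (rule sec_eqI)
      fix c p assume c: "c \<in> A" "p \<in> V" "p \<in> fst c"
      note sc = sm[OF s c(1)] and fc = smooth_funD[OF f c(1)]
      have d: "chart_deriv c (\<lambda>q. f q *\<^sub>R s c q) p = (\<lambda>v. f p *\<^sub>R chart_deriv c (s c) p v + chart_deriv c f p v *\<^sub>R s c p)"
        by (rule chart_deriv_scaleR[OF c(1) V fc sc c(2,3)])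
      have "b_component c (\<lambda>q. f q *\<^sub>R s c q) k p = f p * b_component c (s c) k p" for k
        unfolding b_component_eq[OF c(1) V sc c(2,3)] b_component_eq[OF c(1) V smooth_in_chart_scaleR[OF fc sc] c(2,3)] d
        using b_wvfieldsD(2)[OF s c] by simp
      then show "b_connection \<xi> (\<lambda>c p. f p *\<^sub>R s c p) c p = deriv_along A \<xi> f p *\<^sub>R s c p + f p *\<^sub>R b_connection \<xi> s c p"
        by (simp add: b_connection_def d deriv_along_eq[OF \<xi> V f c] scaleR_add_right scaleR_sum_right mult_ac)
    qed
  }
qed

end

theorem theorem2p12:
  fixes A :: "('a::{t2_space,second_countable_topology}, 'n::finite) chart set"
    and D :: "('a, 'n) conn"
  assumes "smooth_manifold_with_boundary A"
    and "linear_connection A (mfd_int A) (vfields A) D"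
    and "torsion_free A (mfd_int A) D"
    and "special A (mfd_int A) D"
    and "proj_precompact A D"
  shows "(\<forall>\<xi>\<in>vfields A UNIV. \<forall>\<eta>\<in>b_wvfields A (-1) UNIV.
            \<exists>\<zeta>. is_extension A UNIV (wvfields A (-1)) (wvf_conn (-1) D \<xi> \<eta>) \<zeta>) \<and>
         (\<forall>\<sigma>\<in>densities A 1 (mfd_int A).
            nowhere_vanishing A (mfd_int A) \<sigma> \<and> parallel A (mfd_int A) 1 D \<sigma> \<and>
            strongly_totally_geodesic A D \<sigma> \<longrightarrow>
              (\<forall>\<xi>\<in>vfields A UNIV. \<forall>\<eta>\<in>b_wvfields A (-1) UNIV. \<forall>\<zeta>.
                 is_extension A UNIV (wvfields A (-1)) (wvf_conn (-1) D \<xi> \<eta>) \<zeta> \<longrightarrow>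
                   \<zeta> \<in> b_wvfields A (-1) UNIV) \<and>
              (\<exists>Db. linear_connection A UNIV (b_wvfields A (-1)) Db \<and>
                 (\<forall>V. open V \<longrightarrow>
                    (\<forall>\<xi>\<in>vfields A V. \<forall>\<eta>\<in>b_wvfields A (-1) V.
                       sec_eq A (V \<inter> mfd_int A) (Db \<xi> \<eta>) (wvf_conn (-1) D \<xi> \<eta>)))))"
proof -
  interpret precompact_connection A D
    using assms(1,2,4,5) by unfold_locales
  have interior: "sec_eq A (V \<inter> mfd_int A) (b_connection \<xi> \<eta>) (wvf_conn (-1) D \<xi> \<eta>)"
    if "open V" "\<xi> \<in> vfields A V" "\<eta> \<in> b_wvfields A (-1) V" for V \<xi> \<eta>
    by (rule sec_eqI) (simp add: b_connection_interior[OF that(1,2) b_wvfieldsD(1)[OF that(3)]])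
  show ?thesis
  proof (intro conjI ballI impI allI; (elim conjE)?)
    fix \<xi> \<eta> assume *: "\<xi> \<in> vfields A UNIV" "\<eta> \<in> b_wvfields A (-1) UNIV"
    show "\<exists>\<zeta>. is_extension A UNIV (wvfields A (-1)) (wvf_conn (-1) D \<xi> \<eta>) \<zeta>"
      unfolding is_extension_def
      by (intro exI[of _ "b_connection \<xi> \<eta>"] conjI b_connection_wvfields[OF open_UNIV *] interior[OF open_UNIV *])
  next
    fix \<sigma> assume \<sigma>: "\<sigma> \<in> densities A 1 (mfd_int A)" "nowhere_vanishing A (mfd_int A) \<sigma>"
      "parallel A (mfd_int A) 1 D \<sigma>" and stg: "strongly_totally_geodesic A D \<sigma>"
    {
      fix \<xi> \<eta> \<zeta> assume *: "\<xi> \<in> vfields A UNIV" "\<eta> \<in> b_wvfields A (-1) UNIV"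
        and "is_extension A UNIV (wvfields A (-1)) (wvf_conn (-1) D \<xi> \<eta>) \<zeta>"
      then have \<zeta>: "\<zeta> \<in> wvfields A (-1) UNIV" "sec_eq A (UNIV \<inter> mfd_int A) \<zeta> (wvf_conn (-1) D \<xi> \<eta>)"
        unfolding is_extension_def by simp_all
      show "\<zeta> \<in> b_wvfields A (-1) UNIV"
      proof (rule b_wvfieldsI[OF \<zeta>(1)])
        fix c p assume c: "c \<in> A" "p \<in> UNIV" "p \<in> fst c" "p \<in> mfd_bdry A"
        have "\<zeta> c p = b_connection \<xi> \<eta> c p"
        proof (rule eq_on_chart_by_density[OF c(1) open_UNIV wvfieldsD(1)[OF \<zeta>(1) c(1)]
              smooth_in_chart_b_connection[OF open_UNIV * c(1)] _ c(2,3)])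
          fix q assume q: "q \<in> fst c" "q \<in> mfd_int A"
          then have "q \<in> UNIV \<inter> mfd_int A" by simp
          from sec_eqD[OF \<zeta>(2) c(1) this q(1)] sec_eqD[OF interior[OF open_UNIV *] c(1) this q(1)]
          show "\<zeta> c q = b_connection \<xi> \<eta> c q" by simp
        qed
        then show "\<zeta> c p $ bdry_index = 0" using b_connection_tangent[OF \<sigma> stg open_UNIV * c] by simp
      qed
    }
    show "\<exists>Db. linear_connection A UNIV (b_wvfields A (-1)) Db \<and> (\<forall>V. open V \<longrightarrow>
        (\<forall>\<xi>\<in>vfields A V. \<forall>\<eta>\<in>b_wvfields A (-1) V.
           sec_eq A (V \<inter> mfd_int A) (Db \<xi> \<eta>) (wvf_conn (-1) D \<xi> \<eta>)))"
    proof (intro exI[of _ b_connection] conjI allI impI ballI)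
      show "linear_connection A UNIV (b_wvfields A (-1)) b_connection"
        by (rule linear_connection_b_connection, rule b_wvfieldsI[OF b_connection_wvfields], assumption+)
           (rule b_connection_tangent[OF \<sigma> stg])
    qed (rule interior)
  qed
qed

end
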